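(* Let $(\mathcal A,(\mathcal A_t)_{t\ge0},\mathbb E_{\mathcal A})$, $(\mathcal B,(\mathcal B_t)_{t\ge0},\mathbb E_{\mathcal B})$, $(\mathcal C,(\mathcal C_t)_{t\ge0},\mathbb E_{\mathcal C})$ be filtered $\mathrm C^*$-probability spaces, let $\mathcal A_\beta\in\{\mathcal A,\mathcal A_{\mathrm{sa}}\}$ and $\mathcal B_\gamma\in\{\mathcal B,\mathcal B_{\mathrm{sa}}\}$, and let $\mathcal U\subseteq\mathcal A_\beta\times\mathcal B_\gamma$ be an open set. Suppose $A:\mathbb R_+\to\mathcal A$ is an $L^\infty$-continuous $L^\infty$-FV process and $X:\mathbb R_+\to\mathcal B$ is $L^\infty$-decomposable. If $(A(t),X(t))\in\mathcal U$ for all $t\ge0$ and $F:\mathcal U\to\mathcal C$ is adapted $C^{1,2}$, then for all $t\ge0$ $$F(A(t),X(t))=F(A(0),X(0))+\int_0^tD_aF(A(s),X(s))[dA(s)]+\int_0^tD_xF(A(s),X(s))[dX(s)]+\frac12\int_0^tD_x^2F(A(s),X(s))[dX(s),dX(s)],$$ where $D_a=D_1$ is the Fréchet derivative in the first variable, and $D_x=D_2$, $D_x^2=D_2^2$ are the first and second Fréchet derivatives in the second variable.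
   Context: A $\mathrm C^*$-probability space $(\mathcal A,\mathbb E)$ is a unital $\mathrm C^*$-algebra $\mathcal A$ with a faithful tracial state $\mathbb E$. For $p\in[1,\infty)$, $\|a\|_p=\mathbb E[|a|^p]^{1/p}$, and $L^p(\mathcal A,\mathbb E)=L^p(\mathbb E)$ is the $\|\cdot\|_p$-completion of $\mathcal A$; $L^\infty(\mathbb E):=\mathcal A$ with the $\mathrm C^*$-norm. A filtration is an increasing family $(\mathcal A_t)_{t\ge0}$ of unital norm-closed $*$-subalgebras; for such a subalgebra $\mathcal N$ and $a\in L^1(\mathbb E)$, $\mathbb E[a\mid\mathcal N]$ is the unique element of $L^1(\mathcal N,\mathbb E)$ with $\mathbb E[b_0\,\mathbb E[a\mid\mathcal N]]=\mathbb E[b_0a]$ for all $b_0\in\mathcal N$. $\mathcal A_{\mathrm{sa}}$ is the set of self-adjoint elements. Processes. A process $X:\mathbb R_+\to\mathcal A$ is adapted if $X(t)\in\mathcal A_t$ for all $t$; $L^\infty$-FV if adapted and of locally bounded variation in the $\mathrm C^*$-norm; $L^\infty$-continuous if norm-continuous; a martingale if adapted and $\mathbb E[X(t)\mid\mathcal A_s]=X(s)$ for $s\le t$. $X$ is $L^\infty$-decomposable if it is adapted and $X=X(0)+M+A$ with $M$ an $L^\infty$-continuous martingale, $A$ an $L^\infty$-continuous $L^\infty$-FV process, $M(0)=A(0)=0$. (Likewise for $\mathcal B$.) Multilinear maps. "$k$-linear" means real-$k$-linear; a $k$-linear map on $\mathcal A_{\mathrm{sa}}^k$ is identified with its complex-$k$-linear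 extension to $\mathcal A^k$. For $k$-linear $\Lambda:\mathcal A^k\to\mathcal C$, $$\|\Lambda\|_{p_1,\dots,p_k;p}=\sup\{\|\Lambda[a_1,\dots,a_k]\|_p:a_i\in\mathcal A,\|a_i\|_{p_i}\le1\},\quad |||\Lambda|||_k=\sup\Big\{\|\Lambda\|_{p_1,\dots,p_k;p}:p_i,p\in[1,\infty],\ \tfrac1{p_1}+\cdots+\tfrac1{p_k}=\tfrac1p\Big\},$$ $\mathbb B_k(\mathcal A^k;\mathcal C)=\{\Lambda:|||\Lambda|||_k<\infty\}$, and $\mathbb B_0:=\mathcal C$. Members of $\mathbb B_k$ extend uniquely to bounded $k$-linear maps $L^{p_1}\times\cdots\times L^{p_k}\to L^p$ when $\sum1/p_i\le1/p$. For $t\ge0$, $k\ge1$, $\mathcal F_{k,t}(\mathbb E_{\mathcal A},\dots,\mathbb E_{\mathcal A};\mathbb E_{\mathcal C})$ is the set of $\Lambda\in\mathbb B_k(\mathcal A^k;\mathcal C)$ such that for all $u\ge t$: $\Lambda[\mathcal A_u,\dots,\mathcal A_u]\subseteq\mathcal C_u$, and, for some (equivalently, all) $p_1,\dots,p_k,p\in[1,\infty)$ with $\sum1/p_i\le1/p$, $$\mathbb E_{\mathcal C}[\Lambda[a_1,\dots,a_{i-1},b,a_{i+1},\dots,a_k]\mid\mathcal C_u]=\Lambda[a_1,\dots,a_{i-1},\mathbb E_{\mathcal A}[b\mid\mathcal A_u],a_{i+1},\dots,a_k]$$ for all $i$, $a_j\in L^{p_j}(\mathcal A_u,\mathbb E_{\mathcal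 A})$, $b\in L^{p_i}(\mathcal A,\mathbb E_{\mathcal A})$. $\mathcal F_{0,t}:=\mathcal C_t$. The same notation is used with $\mathcal B$ in place of $\mathcal A$. Adapted $C^{k,\ell}$ maps. $F:\mathcal U\to\mathcal C$ is $C^{k,\ell}$ (real Banach spaces) if every $(v,w)\in\mathcal U$ has $r>0$ with $B_r(v)\times B_r(w)\subseteq\mathcal U$, such that for $(x,y)\in B_r(v)\times B_r(w)$, $F(x,\cdot)\in C^\ell(B_r(w);\mathcal C)$ and $F(\cdot,y)\in C^k(B_r(v);\mathcal C)$, and the maps $(x,y)\mapsto D_1^iF(x,y):=D^i(F(\cdot,y))(x)$ ($0\le i\le k$) and $(x,y)\mapsto D_2^jF(x,y):=D^j(F(x,\cdot))(y)$ ($0\le j\le\ell$) are continuous on $\mathcal U$ in operator norm. $F$ is adapted $C^{k,\ell}$ if it is $C^{k,\ell}$; $D_1^iF(a,b)\in\mathbb B_i(\mathcal A^i;\mathcal C)$ and $D_2^jF(a,b)\in\mathbb B_j(\mathcal B^j;\mathcal C)$ for $(a,b)\in\mathcal U$, with $D_1^iF$, $D_2^jF$ continuous in $|||\cdot|||_i$, $|||\cdot|||_j$ respectively; and for $t\ge0$ and $(a,b)\in(\mathcal A_t\times\mathcal B_t)\cap\mathcal U$, $D_1^iF(a,b)\in\mathcal F_{i,t}(\mathbb E_{\mathcal A},\dots,\mathbb E_{\mathcal A};\mathbb E_{\mathcal C})$ and $D_2^jF(a,b)\in\mathcal F_{j,t}(\mathbb E_{\mathcal B},\dots,\mathbb E_{\mathcal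 B};\mathbb E_{\mathcal C})$ (for all $0\le i\le k$, $0\le j\le\ell$). Integrals. $\int_0^tD_aF(A(s),X(s))[dA(s)]$ is the norm-convergent Riemann–Stieltjes integral. With partitions $\Pi=\{0=t_0<\cdots<t_n=t\}$, $s_-$ the left neighbour of $s$ ($0_-:=0$), $\Delta_sX=X(s)-X(s_-)$, mesh $|\Pi|$: $\int_0^tD_xF(A(s),X(s))[dX(s)]=L^2\text{-}\lim_{|\Pi|\to0}\sum_{s\in\Pi}D_xF(A(s_-),X(s_-))[\Delta_sX]$ and $\int_0^tD_x^2F(A(s),X(s))[dX(s),dX(s)]=L^1\text{-}\lim_{|\Pi|\to0}\sum_{s\in\Pi}D_x^2F(A(s_-),X(s_-))[\Delta_sX,\Delta_sX]$; these limits exist under the stated hypotheses. *)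

theory Defs
  imports "HOL-Analysis.Analysis"
begin

section \<open>Unital C*-algebras\<close>

text \<open>Non-trivial (norm 1 = 1), complex, and complete. The real structure of
  \<^class>\<open>real_normed_algebra_1\<close> is the restriction of the complex one.\<close>

class cstar_algebra = real_normed_algebra_1 + banach +
  fixes cscale :: "complex \<Rightarrow> 'a \<Rightarrow> 'a"
    and star :: "'a \<Rightarrow> 'a"
  assumes cscale_add_right: "cscale c (x + y) = cscale c x + cscale c y"
    and cscale_add_left: "cscale (c + d) x = cscale c x + cscale d x"
    and cscale_cscale: "cscale c (cscale d x) = cscale (c * d) x"
    and cscale_of_real: "cscale (complex_of_real r) x = r *\<^sub>R x"
    and cscale_mult_left: "cscale c x * y = cscale c (x * y)"
    and cscale_mult_right: "x * cscale c y = cscale c (x * y)"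
    and norm_cscale: "norm (cscale c x) = cmod c * norm x"
    and star_star: "star (star x) = x"
    and star_add: "star (x + y) = star x + star y"
    and star_cscale: "star (cscale c x) = cscale (cnj c) (star x)"
    and star_mult: "star (x * y) = star y * star x"
    and cstar_identity: "norm (star x * x) = (norm x)\<^sup>2"

definition selfadjoint :: "'a::cstar_algebra set" where
  "selfadjoint = {a. star a = a}"

definition star_subalgebra :: "'a::cstar_algebra set \<Rightarrow> bool" where
  "star_subalgebra S \<longleftrightarrow> closed S \<and> 1 \<in> S \<and>
     (\<forall>x\<in>S. \<forall>y\<in>S. x + y \<in> S \<and> x * y \<in> S) \<and>
     (\<forall>c. \<forall>x\<in>S. cscale c x \<in> S) \<and> (\<forall>x\<in>S. star x \<in> S)"

definition spectrum :: "'a::cstar_algebra \<Rightarrow> complex set" where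
  "spectrum a = {z. \<not> (\<exists>b. b * (a - cscale z 1) = 1 \<and> (a - cscale z 1) * b = 1)}"

definition peval :: "real poly \<Rightarrow> 'a::cstar_algebra \<Rightarrow> 'a" where
  "peval p h = (\<Sum>i\<le>degree p. coeff p i *\<^sub>R h ^ i)"

text \<open>Continuous functional calculus of a self-adjoint element: the common norm limit of
  the values at \<open>h\<close> of all polynomial sequences converging to \<open>f\<close> uniformly on the spectrum.\<close>

definition cfc :: "(real \<Rightarrow> real) \<Rightarrow> 'a::cstar_algebra \<Rightarrow> 'a" where
  "cfc f h = (THE b. \<forall>p :: nat \<Rightarrow> real poly.
      uniform_limit {x. complex_of_real x \<in> spectrum h} (\<lambda>n. poly (p n)) f sequentially \<longrightarrow>
      (\<lambda>n. peval (p n) h) \<longlonglongrightarrow> b)"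

definition cabs :: "'a::cstar_algebra \<Rightarrow> 'a" where
  "cabs a = cfc sqrt (star a * a)"

definition cabs_powr :: "'a::cstar_algebra \<Rightarrow> real \<Rightarrow> 'a" where
  "cabs_powr a r = cfc (\<lambda>x. x powr r) (cabs a)"

section \<open>Filtered C*-probability spaces\<close>

definition faithful_tracial_state :: "('a::cstar_algebra \<Rightarrow> complex) \<Rightarrow> bool" where
  "faithful_tracial_state E \<longleftrightarrow>
     (\<forall>x y. E (x + y) = E x + E y) \<and> (\<forall>c x. E (cscale c x) = c * E x) \<and>
     (\<forall>x. Im (E (star x * x)) = 0 \<and> 0 \<le> Re (E (star x * x))) \<and> E 1 = 1 \<and>
     (\<forall>x y. E (x * y) = E (y * x)) \<and> (\<forall>x. E (star x * x) = 0 \<longrightarrow> x = 0)"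

definition filtration :: "(real \<Rightarrow> 'a::cstar_algebra set) \<Rightarrow> bool" where
  "filtration N \<longleftrightarrow> (\<forall>t\<ge>0. star_subalgebra (N t)) \<and> (\<forall>s t. 0 \<le> s \<and> s \<le> t \<longrightarrow> N s \<subseteq> N t)"

section \<open>Noncommutative Lp-spaces\<close>

definition pnorm :: "('a::cstar_algebra \<Rightarrow> complex) \<Rightarrow> ennreal \<Rightarrow> 'a \<Rightarrow> real" where
  "pnorm E p a = (if p = top then norm a
     else Re (E (cabs_powr a (enn2real p))) powr (1 / enn2real p))"

text \<open>The completion consists of classes of Cauchy sequences modulo null sequences.
  \<open>Lp E p S\<close> is the completion of the subalgebra \<open>S\<close>, regarded inside that of the whole algebra.\<close>

definition pCauchy :: "('a::cstar_algebra \<Rightarrow> complex) \<Rightarrow> ennreal \<Rightarrow> (nat \<Rightarrow> 'a) \<Rightarrow> bool" where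
  "pCauchy E p s \<longleftrightarrow> (\<forall>e>0. \<exists>N. \<forall>m\<ge>N. \<forall>n\<ge>N. pnorm E p (s m - s n) < e)"

definition pclass ::
    "('a::cstar_algebra \<Rightarrow> complex) \<Rightarrow> ennreal \<Rightarrow> (nat \<Rightarrow> 'a) \<Rightarrow> (nat \<Rightarrow> 'a) set" where
  "pclass E p s = {s'. (\<lambda>n. pnorm E p (s' n - s n)) \<longlonglongrightarrow> 0}"

definition Lp ::
    "('a::cstar_algebra \<Rightarrow> complex) \<Rightarrow> ennreal \<Rightarrow> 'a set \<Rightarrow> (nat \<Rightarrow> 'a) set set" where
  "Lp E p S = {pclass E p s | s. pCauchy E p s \<and> range s \<subseteq> S}"

definition rep :: "(nat \<Rightarrow> 'a) set \<Rightarrow> nat \<Rightarrow> 'a" where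
  "rep x = (SOME s. s \<in> x)"

text \<open>The following operations do not depend on the representatives.\<close>

definition Lp_of ::
    "('a::cstar_algebra \<Rightarrow> complex) \<Rightarrow> ennreal \<Rightarrow> 'a \<Rightarrow> (nat \<Rightarrow> 'a) set" where
  "Lp_of E p a = pclass E p (\<lambda>_. a)"

definition Lp_add :: "('a::cstar_algebra \<Rightarrow> complex) \<Rightarrow> ennreal \<Rightarrow>
    (nat \<Rightarrow> 'a) set \<Rightarrow> (nat \<Rightarrow> 'a) set \<Rightarrow> (nat \<Rightarrow> 'a) set" where
  "Lp_add E p x y = pclass E p (\<lambda>n. rep x n + rep y n)"

definition Lp_scaleR :: "('a::cstar_algebra \<Rightarrow> complex) \<Rightarrow> ennreal \<Rightarrow>
    real \<Rightarrow> (nat \<Rightarrow> 'a) set \<Rightarrow> (nat \<Rightarrow> 'a) set" where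
  "Lp_scaleR E p r x = pclass E p (\<lambda>n. r *\<^sub>R rep x n)"

definition Lp_dist :: "('a::cstar_algebra \<Rightarrow> complex) \<Rightarrow> ennreal \<Rightarrow>
    (nat \<Rightarrow> 'a) set \<Rightarrow> (nat \<Rightarrow> 'a) set \<Rightarrow> real" where
  "Lp_dist E p x y = lim (\<lambda>n. pnorm E p (rep x n - rep y n))"

definition to_L1 ::
    "('a::cstar_algebra \<Rightarrow> complex) \<Rightarrow> (nat \<Rightarrow> 'a) set \<Rightarrow> (nat \<Rightarrow> 'a) set" where
  \<comment> \<open>the canonical inclusion of an Lp-space into the L1-space\<close>
  "to_L1 E x = pclass E 1 (rep x)"

definition Lp_tendsto :: "('c::cstar_algebra \<Rightarrow> complex) \<Rightarrow> ennreal \<Rightarrow>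
    ('i \<Rightarrow> 'c) \<Rightarrow> (nat \<Rightarrow> 'c) set \<Rightarrow> 'i filter \<Rightarrow> bool" where
  "Lp_tendsto E p f x G \<longleftrightarrow>
     x \<in> Lp E p UNIV \<and> ((\<lambda>i. Lp_dist E p (Lp_of E p (f i)) x) \<longlongrightarrow> 0) G"

definition pairing :: "('a::cstar_algebra \<Rightarrow> complex) \<Rightarrow> 'a \<Rightarrow> (nat \<Rightarrow> 'a) set \<Rightarrow> complex" where
  \<comment> \<open>E[b x] for b in the algebra and x in L1\<close>
  "pairing E b x = lim (\<lambda>n. E (b * rep x n))"

text \<open>\<open>is_cond_exp E N x z\<close>: the conditional expectation of \<open>x\<close> in L1 given \<open>N\<close> is \<open>z\<close>.
  For \<open>x\<close> in L1 such a \<open>z\<close> exists and is unique.\<close>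

definition is_cond_exp :: "('a::cstar_algebra \<Rightarrow> complex) \<Rightarrow> 'a set \<Rightarrow>
    (nat \<Rightarrow> 'a) set \<Rightarrow> (nat \<Rightarrow> 'a) set \<Rightarrow> bool" where
  "is_cond_exp E N x z \<longleftrightarrow> z \<in> Lp E 1 N \<and> (\<forall>b\<in>N. pairing E b z = pairing E b x)"

section \<open>Partitions and processes\<close>

text \<open>A process is a function on the reals of which only the values on \<open>{0..}\<close> matter.\<close>

definition is_partition :: "real \<Rightarrow> real set \<Rightarrow> bool" where
  "is_partition t P \<longleftrightarrow> finite P \<and> 0 \<in> P \<and> t \<in> P \<and> P \<subseteq> {0..t}"

definition left_nb :: "real set \<Rightarrow> real \<Rightarrow> real" where
  "left_nb P s = (if s = 0 then 0 else Max {r \<in> P. r < s})"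

definition mesh :: "real set \<Rightarrow> real" where
  "mesh P = Max ((\<lambda>s. s - left_nb P s) ` P)"

definition mesh_to_0 :: "real \<Rightarrow> real set filter" where
  "mesh_to_0 t = (INF d\<in>{0<..}. principal {P. is_partition t P \<and> mesh P < d})"

definition tagged_mesh_to_0 :: "real \<Rightarrow> (real set \<times> (real \<Rightarrow> real)) filter" where
  "tagged_mesh_to_0 t = (INF d\<in>{0<..}. principal
     {(P, \<xi>). is_partition t P \<and> mesh P < d \<and> (\<forall>s\<in>P. \<xi> s \<in> {left_nb P s..s})})"

definition incr :: "(real \<Rightarrow> 'a::cstar_algebra) \<Rightarrow> real set \<Rightarrow> real \<Rightarrow> 'a" where
  "incr X P s = X s - X (left_nb P s)"

definition adapted :: "(real \<Rightarrow> 'a::cstar_algebra set) \<Rightarrow> (real \<Rightarrow> 'a) \<Rightarrow> bool" where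
  "adapted N X \<longleftrightarrow> (\<forall>t\<ge>0. X t \<in> N t)"

definition FV_process :: "(real \<Rightarrow> 'a::cstar_algebra set) \<Rightarrow> (real \<Rightarrow> 'a) \<Rightarrow> bool" where
  "FV_process N X \<longleftrightarrow> adapted N X \<and>
     (\<forall>t\<ge>0. \<exists>K. \<forall>P. is_partition t P \<longrightarrow> (\<Sum>s\<in>P. norm (incr X P s)) \<le> K)"

definition martingale ::
    "('a::cstar_algebra \<Rightarrow> complex) \<Rightarrow> (real \<Rightarrow> 'a set) \<Rightarrow> (real \<Rightarrow> 'a) \<Rightarrow> bool" where
  "martingale E N X \<longleftrightarrow> adapted N X \<and>
     (\<forall>s t. 0 \<le> s \<and> s \<le> t \<longrightarrow> is_cond_exp E (N s) (Lp_of E 1 (X t)) (Lp_of E 1 (X s)))"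

definition decomposable ::
    "('a::cstar_algebra \<Rightarrow> complex) \<Rightarrow> (real \<Rightarrow> 'a set) \<Rightarrow> (real \<Rightarrow> 'a) \<Rightarrow> bool" where
  "decomposable E N X \<longleftrightarrow> adapted N X \<and>
     (\<exists>M A. martingale E N M \<and> continuous_on {0..} M \<and>
        FV_process N A \<and> continuous_on {0..} A \<and> M 0 = 0 \<and> A 0 = 0 \<and>
        (\<forall>t\<ge>0. X t = X 0 + M t + A t))"

section \<open>Multilinear maps\<close>

text \<open>A k-linear map takes its arguments as a list of length k.\<close>

definition multilinear :: "nat \<Rightarrow> ('a::cstar_algebra list \<Rightarrow> 'c::cstar_algebra) \<Rightarrow> bool" where
  "multilinear k \<Lambda> \<longleftrightarrow>
     (\<forall>as i. length as = k \<and> i < k \<longrightarrow> linear (\<lambda>x. \<Lambda> (as[i := x])))"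

definition cmultilinear :: "nat \<Rightarrow> ('a::cstar_algebra list \<Rightarrow> 'c::cstar_algebra) \<Rightarrow> bool" where
  "cmultilinear k \<Lambda> \<longleftrightarrow> multilinear k \<Lambda> \<and>
     (\<forall>as i c x. length as = k \<and> i < k \<longrightarrow>
        \<Lambda> (as[i := cscale c x]) = cscale c (\<Lambda> (as[i := x])))"

text \<open>A k-linear map on self-adjoint elements is represented by its complex k-linear
  extension; a k-linear map on the whole algebra is only required to be real k-linear.\<close>

definition multilinear_on ::
    "'a::cstar_algebra set \<Rightarrow> nat \<Rightarrow> ('a list \<Rightarrow> 'c::cstar_algebra) \<Rightarrow> bool" where
  "multilinear_on V k \<Lambda> \<longleftrightarrow> (if V = selfadjoint then cmultilinear k \<Lambda> else multilinear k \<Lambda>)"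

definition opnorm ::
    "'a::cstar_algebra set \<Rightarrow> nat \<Rightarrow> ('a list \<Rightarrow> 'c::cstar_algebra) \<Rightarrow> ennreal" where
  "opnorm V k \<Lambda> = (SUP hs \<in> {hs. length hs = k \<and> set hs \<subseteq> V \<and> (\<forall>h\<in>set hs. norm h \<le> 1)}.
      ennreal (norm (\<Lambda> hs)))"

definition pp_norm :: "('a::cstar_algebra \<Rightarrow> complex) \<Rightarrow> ('c::cstar_algebra \<Rightarrow> complex) \<Rightarrow>
    ennreal list \<Rightarrow> ennreal \<Rightarrow> ('a list \<Rightarrow> 'c) \<Rightarrow> ennreal" where
  "pp_norm EA EC ps q \<Lambda> =
     (SUP as \<in> {as. list_all2 (\<lambda>p a. pnorm EA p a \<le> 1) ps as}. ennreal (pnorm EC q (\<Lambda> as)))"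

definition trinorm :: "('a::cstar_algebra \<Rightarrow> complex) \<Rightarrow> ('c::cstar_algebra \<Rightarrow> complex) \<Rightarrow>
    nat \<Rightarrow> ('a list \<Rightarrow> 'c) \<Rightarrow> ennreal" where
  "trinorm EA EC k \<Lambda> = (SUP (ps, q) \<in> {(ps, q). length ps = k \<and> (\<forall>p\<in>set ps. 1 \<le> p) \<and>
      1 \<le> q \<and> sum_list (map inverse ps) = inverse q}. pp_norm EA EC ps q \<Lambda>)"

text \<open>For k = 0 the only exponent is infinite, so that the space below is the target algebra.\<close>

definition BB :: "('a::cstar_algebra \<Rightarrow> complex) \<Rightarrow> ('c::cstar_algebra \<Rightarrow> complex) \<Rightarrow>
    nat \<Rightarrow> ('a list \<Rightarrow> 'c) set" where
  "BB EA EC k = {\<Lambda>. multilinear k \<Lambda> \<and> trinorm EA EC k \<Lambda> < top}"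

definition Lp_extend :: "('c::cstar_algebra \<Rightarrow> complex) \<Rightarrow> ennreal \<Rightarrow>
    ('a::cstar_algebra list \<Rightarrow> 'c) \<Rightarrow> (nat \<Rightarrow> 'a) set list \<Rightarrow> (nat \<Rightarrow> 'c) set" where
  "Lp_extend EC q \<Lambda> xs = pclass EC q (\<lambda>n. \<Lambda> (map (\<lambda>x. rep x n) xs))"

text \<open>In the second condition \<open>z\<close> is the conditional expectation of \<open>b\<close>; it lies
  in the Lp-space of \<open>NA u\<close> because conditional expectations are contractive for all p-norms.
  For k = 0 the conditions say that \<open>\<Lambda> []\<close> belongs to \<open>NC t\<close>.\<close>

definition FF :: "('a::cstar_algebra \<Rightarrow> complex) \<Rightarrow> (real \<Rightarrow> 'a set) \<Rightarrow>
    ('c::cstar_algebra \<Rightarrow> complex) \<Rightarrow> (real \<Rightarrow> 'c set) \<Rightarrow> nat \<Rightarrow> real \<Rightarrow> ('a list \<Rightarrow> 'c) set" where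
  "FF EA NA EC NC k t = {\<Lambda> \<in> BB EA EC k. \<forall>u\<ge>t.
     (\<forall>as. length as = k \<and> set as \<subseteq> NA u \<longrightarrow> \<Lambda> as \<in> NC u) \<and>
     (\<exists>ps q. length ps = k \<and> (\<forall>p\<in>set ps. 1 \<le> p \<and> p < top) \<and> 1 \<le> q \<and> q < top \<and>
        sum_list (map inverse ps) \<le> inverse q \<and>
        (\<forall>i<k. \<forall>xs b z. length xs = k \<longrightarrow>
           (\<forall>j<k. j \<noteq> i \<longrightarrow> xs ! j \<in> Lp EA (ps ! j) (NA u)) \<longrightarrow>
           b \<in> Lp EA (ps ! i) UNIV \<longrightarrow> z \<in> Lp EA (ps ! i) (NA u) \<longrightarrow>
           is_cond_exp EA (NA u) (to_L1 EA b) (to_L1 EA z) \<longrightarrow>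
           is_cond_exp EC (NC u) (to_L1 EC (Lp_extend EC q \<Lambda> (xs[i := b])))
             (to_L1 EC (Lp_extend EC q \<Lambda> (xs[i := z])))))}"

section \<open>Adapted \<open>C\<^sup>k\<^sup>,\<^sup>l\<close> maps\<close>

definition cont_wrt :: "(('a list \<Rightarrow> 'c::cstar_algebra) \<Rightarrow> ennreal) \<Rightarrow>
    'u::topological_space set \<Rightarrow> ('u \<Rightarrow> 'a list \<Rightarrow> 'c) \<Rightarrow> bool" where
  "cont_wrt N S D \<longleftrightarrow> (\<forall>u\<in>S. ((\<lambda>v. N (\<lambda>hs. D v hs - D u hs)) \<longlongrightarrow> 0) (at u within S))"

text \<open>\<open>Ck_derivs V S k f D\<close>: on the relatively open subset \<open>S\<close> of the real Banach space \<open>V\<close>,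
  \<open>f\<close> is of class \<open>C\<^sup>k\<close> and its Frechet derivative of order i is \<open>D i\<close>, for i up to k.
  The direction of the last differentiation is the first argument.\<close>

definition Ck_derivs :: "'a::cstar_algebra set \<Rightarrow> 'a set \<Rightarrow> nat \<Rightarrow>
    ('a \<Rightarrow> 'c::cstar_algebra) \<Rightarrow> (nat \<Rightarrow> 'a \<Rightarrow> 'a list \<Rightarrow> 'c) \<Rightarrow> bool" where
  "Ck_derivs V S k f D \<longleftrightarrow>
     (\<forall>x\<in>S. D 0 x [] = f x) \<and>
     (\<forall>i\<le>k. (\<forall>x\<in>S. multilinear_on V i (D i x) \<and> opnorm V i (D i x) < top) \<and>
        cont_wrt (opnorm V i) S (D i)) \<and>
     (\<forall>i<k. \<forall>x\<in>S.
        ((\<lambda>y. opnorm V i (\<lambda>hs. D i y hs - D i x hs - D (Suc i) x ((y - x) # hs))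
               / ennreal (norm (y - x))) \<longlongrightarrow> 0) (at x within S))"

text \<open>\<open>F\<close> is of class \<open>C\<^sup>k\<^sup>,\<^sup>l\<close> on \<open>U\<close>, with partial derivatives \<open>D1 i\<close> and \<open>D2 j\<close>.
  These are determined by \<open>F\<close> on \<open>U\<close> and lists of length i and j.\<close>

definition Ckl_derivs :: "'a::cstar_algebra set \<Rightarrow> 'b::cstar_algebra set \<Rightarrow> ('a \<times> 'b) set \<Rightarrow>
    nat \<Rightarrow> nat \<Rightarrow> ('a \<times> 'b \<Rightarrow> 'c::cstar_algebra) \<Rightarrow>
    (nat \<Rightarrow> 'a \<times> 'b \<Rightarrow> 'a list \<Rightarrow> 'c) \<Rightarrow> (nat \<Rightarrow> 'a \<times> 'b \<Rightarrow> 'b list \<Rightarrow> 'c) \<Rightarrow> bool" where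
  "Ckl_derivs V W U k l F D1 D2 \<longleftrightarrow>
     (\<forall>(v, w)\<in>U. \<exists>r>0. (V \<inter> ball v r) \<times> (W \<inter> ball w r) \<subseteq> U \<and>
        (\<forall>x \<in> V \<inter> ball v r. \<forall>y \<in> W \<inter> ball w r.
           Ck_derivs W (W \<inter> ball w r) l (\<lambda>y'. F (x, y')) (\<lambda>j y'. D2 j (x, y')) \<and>
           Ck_derivs V (V \<inter> ball v r) k (\<lambda>x'. F (x', y)) (\<lambda>i x'. D1 i (x', y)))) \<and>
     (\<forall>i\<le>k. cont_wrt (opnorm V i) U (D1 i)) \<and> (\<forall>j\<le>l. cont_wrt (opnorm W j) U (D2 j))"

definition adapted_Ckl_derivs ::
    "('a::cstar_algebra \<Rightarrow> complex) \<Rightarrow> (real \<Rightarrow> 'a set) \<Rightarrow>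
     ('b::cstar_algebra \<Rightarrow> complex) \<Rightarrow> (real \<Rightarrow> 'b set) \<Rightarrow>
     ('c::cstar_algebra \<Rightarrow> complex) \<Rightarrow> (real \<Rightarrow> 'c set) \<Rightarrow>
     'a set \<Rightarrow> 'b set \<Rightarrow> ('a \<times> 'b) set \<Rightarrow> nat \<Rightarrow> nat \<Rightarrow> ('a \<times> 'b \<Rightarrow> 'c) \<Rightarrow>
     (nat \<Rightarrow> 'a \<times> 'b \<Rightarrow> 'a list \<Rightarrow> 'c) \<Rightarrow> (nat \<Rightarrow> 'a \<times> 'b \<Rightarrow> 'b list \<Rightarrow> 'c) \<Rightarrow> bool" where
  "adapted_Ckl_derivs EA NA EB NB EC NC V W U k l F D1 D2 \<longleftrightarrow>
     Ckl_derivs V W U k l F D1 D2 \<and>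
     (\<forall>i\<le>k. (\<forall>u\<in>U. D1 i u \<in> BB EA EC i) \<and> cont_wrt (trinorm EA EC i) U (D1 i)) \<and>
     (\<forall>j\<le>l. (\<forall>u\<in>U. D2 j u \<in> BB EB EC j) \<and> cont_wrt (trinorm EB EC j) U (D2 j)) \<and>
     (\<forall>t\<ge>0. \<forall>u \<in> (NA t \<times> NB t) \<inter> U.
        (\<forall>i\<le>k. D1 i u \<in> FF EA NA EC NC i t) \<and> (\<forall>j\<le>l. D2 j u \<in> FF EB NB EC NC j t))"

section \<open>Integrals\<close>

definition has_RS_integral :: "(real \<Rightarrow> 'a::cstar_algebra list \<Rightarrow> 'c::cstar_algebra) \<Rightarrow>
    (real \<Rightarrow> 'a) \<Rightarrow> real \<Rightarrow> 'c \<Rightarrow> bool" where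
  "has_RS_integral H A t I \<longleftrightarrow>
     ((\<lambda>(P, \<xi>). \<Sum>s\<in>P. H (\<xi> s) [incr A P s]) \<longlongrightarrow> I) (tagged_mesh_to_0 t)"

definition has_L2_integral :: "('c::cstar_algebra \<Rightarrow> complex) \<Rightarrow>
    (real \<Rightarrow> 'a::cstar_algebra list \<Rightarrow> 'c) \<Rightarrow> (real \<Rightarrow> 'a) \<Rightarrow> real \<Rightarrow> (nat \<Rightarrow> 'c) set \<Rightarrow> bool" where
  "has_L2_integral EC H X t I \<longleftrightarrow>
     Lp_tendsto EC 2 (\<lambda>P. \<Sum>s\<in>P. H (left_nb P s) [incr X P s]) I (mesh_to_0 t)"

definition has_L1_quadratic_integral :: "('c::cstar_algebra \<Rightarrow> complex) \<Rightarrow>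
    (real \<Rightarrow> 'a::cstar_algebra list \<Rightarrow> 'c) \<Rightarrow> (real \<Rightarrow> 'a) \<Rightarrow> real \<Rightarrow> (nat \<Rightarrow> 'c) set \<Rightarrow> bool" where
  "has_L1_quadratic_integral EC H X t I \<longleftrightarrow>
     Lp_tendsto EC 1 (\<lambda>P. \<Sum>s\<in>P. H (left_nb P s) [incr X P s, incr X P s]) I (mesh_to_0 t)"

end

theory Submission
  imports Defs "HOL-Computational_Algebra.Fundamental_Theorem_Algebra"
begin

text \<open>
  The proof is the classical one. Along a partition, the increment of \<open>F (A, X)\<close> telescopes, and each
  summand is expanded to first order in \<open>A\<close> and to second order in \<open>X\<close> (\<open>taylor_increment\<close>). The
  path over \<open>{0..t}\<close> is compact, so the remainders are uniformly small: in the 1-norm they are at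
  most \<open>\<epsilon> (norm (\<Delta>A) + (norm2 (\<Delta>X))\<^sup>2)\<close>. The sums of \<open>norm (\<Delta>A)\<close> are bounded by the variation,
  and those of \<open>(norm2 (\<Delta>X))\<^sup>2\<close> by orthogonality of martingale increments
  (\<open>sum_norm2_incr_bounded\<close>). Hence the two first-order sums plus half the quadratic sum
  converge in \<open>L\<^sup>1\<close> to the increment of \<open>F (A, X)\<close>. The sums for \<open>dA\<close> converge in norm
  (\<open>has_RS_integral_exists\<close>), and those
  for \<open>dX\<close> converge in \<open>L\<^sup>2\<close> (\<open>has_L2_integral_exists\<close>); therefore the quadratic sums converge
  too, to the limit that makes Ito's formula true.

  The \<open>L\<^sup>2\<close> integral rests on \<open>left_sums_close\<close>. On a common refinement of two partitions the
  difference of their sums has the terms \<open>(\<Lambda> - \<Lambda>')[\<Delta>M]\<close>, where \<open>\<Lambda>\<close> and \<open>\<Lambda>'\<close> are derivatives taken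
  at or before the left end point. Adaptedness of the derivative turns a vanishing conditional
  expectation of \<open>\<Delta>M\<close> into one of \<open>\<Lambda>[\<Delta>M]\<close> (\<open>FF_preserves_zero_expectation\<close>), so that these terms
  are orthogonal and their squared 2-norms add up to at most \<open>\<epsilon>\<^sup>2 (norm2 (M t))\<^sup>2\<close>.

  The noncommutative p-norms are defined by functional calculus, which has to be developed first. The
  key point is that the norm of a self-adjoint \<open>k\<close> is, up to sign, in its spectrum; it
  follows from \<open>(norm k)\<^sup>2 \<le> norm (k\<^sup>2 + y\<^sup>2)\<close> for commuting self-adjoint \<open>k\<close> and \<open>y\<close>
  (\<open>norm_sq_le_norm_sum_squares\<close>) and square roots given by power series. The faithful trace then
  yields positivity of \<open>a\<^sup>* a\<close>. The 2-norm is a Hilbert space norm. The 1-norm is dual to the norm of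
  the algebra under the trace pairing (\<open>norm_E_mult_le\<close> and \<open>norm1_dual_attained\<close>), which gives its
  triangle inequality and reduces Taylor's formula in \<open>L\<^sup>1\<close> to the real mean value theorem. Other
  finite exponents enter mainly through \<open>norm1_le_pnorm\<close>, an instance of Jensen's inequality.
\<close>

section \<open>Elementary facts about unital C*-algebras\<close>

lemma le_at_right_limit:
  fixes f :: "real \<Rightarrow> real"
  assumes "(f \<longlongrightarrow> f a) (at_right a)" "\<And>x. a < x \<Longrightarrow> y \<le> f x" shows "y \<le> f a"
  by (rule tendsto_lowerbound[OF assms(1)])
     (use assms(2) in \<open>auto intro: eventually_mono[OF eventually_at_right_less]\<close>)

lemma cscale_zero_left [simp]: "cscale 0 (x::'a::cstar_algebra) = 0"
  using cscale_of_real[of 0 x] by simp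

lemma cscale_zero_right [simp]: "cscale c (0::'a::cstar_algebra) = 0"
  using cscale_add_right[of c 0 "0::'a"] by simp

lemma cscale_one [simp]: "cscale 1 (x::'a::cstar_algebra) = x"
  using cscale_of_real[of 1 x] by simp

lemma cscale_minus_left [simp]: "cscale (- c) (x::'a::cstar_algebra) = - cscale c x"
  using cscale_add_left[of c "- c" x] by (simp add: eq_neg_iff_add_eq_0 add.commute)

lemma cscale_minus_right [simp]: "cscale c (- x::'a::cstar_algebra) = - cscale c x"
  using cscale_add_right[of c x "- x"] by (simp add: eq_neg_iff_add_eq_0 add.commute)

lemma cscale_diff_right: "cscale c (x - y::'a::cstar_algebra) = cscale c x - cscale c y"
  using cscale_add_right[of c x "- y"] by simp

lemma cscale_scaleR [simp]: "cscale c (r *\<^sub>R (x::'a::cstar_algebra)) = r *\<^sub>R cscale c x"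
  by (metis cscale_cscale cscale_of_real mult.commute)

lemma star_zero [simp]: "star (0::'a::cstar_algebra) = 0"
  using star_add[of 0 "0::'a"] by simp

lemma star_minus [simp]: "star (- x::'a::cstar_algebra) = - star x"
  using star_add[of x "- x"] by (simp add: eq_neg_iff_add_eq_0 add.commute)

lemma star_diff: "star (x - y::'a::cstar_algebra) = star x - star y"
  using star_add[of x "- y"] by simp

lemma star_one [simp]: "star (1::'a::cstar_algebra) = 1"
  by (metis mult.right_neutral mult.left_neutral star_mult star_star)

lemma star_scaleR [simp]: "star (r *\<^sub>R (x::'a::cstar_algebra)) = r *\<^sub>R star x"
  by (metis complex_cnj_complex_of_real cscale_of_real star_cscale)

lemma norm_star [simp]: "norm (star (x::'a::cstar_algebra)) = norm x"
proof -
  have le: "norm y \<le> norm (star y)" for y :: 'a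
  proof (cases "y = 0")
    case False
    have "norm y * norm y \<le> norm (star y) * norm y"
      using norm_mult_ineq[of "star y" y] by (simp add: cstar_identity power2_eq_square)
    then show ?thesis using False by simp
  qed auto
  show ?thesis using le[of x] le[of "star x"] by (simp add: star_star)
qed

lemma bounded_linear_star: "bounded_linear (star :: 'a::cstar_algebra \<Rightarrow> 'a)"
  by (rule bounded_linear_intro[of _ 1]) (auto simp: star_add)

lemma star_power: "star (x ^ n :: 'a::cstar_algebra) = star x ^ n"
  by (induction n) (auto simp: star_mult power_commutes)

lemma selfadjoint_iff: "x \<in> selfadjoint \<longleftrightarrow> star x = x"
  by (simp add: selfadjoint_def)

lemma star_square_selfadjoint: "star x * x \<in> selfadjoint"
  by (simp add: selfadjoint_iff star_mult star_star)

lemma norm_square_selfadjoint: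
  "(x::'a::cstar_algebra) \<in> selfadjoint \<Longrightarrow> norm (x * x) = (norm x)\<^sup>2"
  using cstar_identity[of x] by (simp add: selfadjoint_iff)

section \<open>Square roots and the spectrum of self-adjoint elements\<close>

lemma abs_gbinomial_half_le_1: "\<bar>(1/2::real) gchoose n\<bar> \<le> 1"
proof (induction n)
  case (Suc n)
  have "(1/2::real) gchoose Suc n = ((1/2::real) gchoose n) * ((1/2 - real n) / (real n + 1))"
    using gbinomial_mult_1[of "1/2::real" n] by (simp add: field_simps)
  moreover have "\<bar>(1/2 - real n) / (real n + 1)\<bar> \<le> 1" by (simp add: field_simps)
  ultimately show ?case using Suc by (metis abs_mult mult_le_one abs_ge_zero)
qed auto

text \<open>The binomial series of \<open>(1 - a)\<^bsup>1/2\<^esup>\<close> converges absolutely because its coefficients are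
  bounded; Vandermonde's identity evaluates its Cauchy square.\<close>

lemma selfadjoint_sqrt_one_minus:
  fixes a :: "'a::cstar_algebra"
  assumes sa: "a \<in> selfadjoint" and small: "norm a < 1"
  obtains s where "s \<in> selfadjoint" "s * s = 1 - a" "\<forall>x. x * a = a * x \<longrightarrow> x * s = s * x"
proof -
  define c where "c n = ((1/2::real) gchoose n) * (-1) ^ n" for n
  define f where "f n = c n *\<^sub>R a ^ n" for n
  have "\<bar>c n\<bar> \<le> 1" for n
    by (simp add: c_def abs_mult power_abs abs_gbinomial_half_le_1)
  then have nf: "norm (f n) \<le> norm a ^ n" for n
    using mult_mono[of "\<bar>c n\<bar>" 1 "norm (a ^ n)" "norm a ^ n"]
    by (simp add: f_def norm_power_ineq)
  have sn: "summable (\<lambda>n. norm (f n))"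
    by (rule summable_comparison_test'[of "\<lambda>n. norm a ^ n" 0])
       (use small nf in \<open>auto simp: summable_geometric\<close>)
  then have sm: "summable f" by (rule summable_norm_cancel)
  define s where "s = suminf f"
  have "(\<Sum>i\<le>k. c i * c (k - i)) = ((1::real) gchoose k) * (-1) ^ k" for k
  proof -
    have "(\<Sum>i\<le>k. c i * c (k - i))
        = (\<Sum>i=0..k. ((1/2::real) gchoose i) * ((1/2) gchoose (k - i))) * (-1) ^ k"
      unfolding c_def sum_distrib_right atMost_atLeast0
      by (rule sum.cong) (auto simp: power_add[symmetric] mult_ac)
    then show ?thesis using gbinomial_Vandermonde[of "1/2::real" "1/2" k] by simp
  qed
  then have conv: "(\<Sum>i\<le>k. f i * f (k - i)) = (((1::real) gchoose k) * (-1) ^ k) *\<^sub>R a ^ k" for k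
  proof -
    have "(\<Sum>i\<le>k. f i * f (k - i)) = (\<Sum>i\<le>k. (c i * c (k - i)) *\<^sub>R a ^ k)"
      by (rule sum.cong) (auto simp: f_def power_add[symmetric])
    then show ?thesis
      using \<open>(\<Sum>i\<le>k. c i * c (k - i)) = ((1::real) gchoose k) * (-1) ^ k\<close>
      by (simp add: scaleR_sum_left[symmetric])
  qed
  have "(\<lambda>k. (((1::real) gchoose k) * (-1) ^ k) *\<^sub>R a ^ k) sums
      (\<Sum>k\<in>{0,1}. (((1::real) gchoose k) * (-1) ^ k) *\<^sub>R a ^ k)"
  proof (rule sums_finite)
    fix n :: nat assume "n \<notin> {0,1}"
    then have "1 < n" by auto
    then show "(((1::real) gchoose n) * (-1) ^ n) *\<^sub>R a ^ n = 0"
      using binomial_gbinomial[of 1 n, where 'a = real] by (simp add: binomial_eq_0)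
  qed simp
  moreover have "(\<Sum>k\<in>{0,1}. (((1::real) gchoose k) * (-1) ^ k) *\<^sub>R a ^ k) = 1 - a" by simp
  ultimately have "s * s = 1 - a"
    using Cauchy_product_sums[OF sn sn] unfolding conv s_def by (metis sums_unique2)
  moreover have "star s = s"
  proof -
    have "star (f n) = f n" for n
      using sa by (simp add: f_def star_power selfadjoint_iff)
    then show ?thesis
      using bounded_linear.suminf[OF bounded_linear_star sm] by (simp add: s_def)
  qed
  moreover have "\<forall>x. x * a = a * x \<longrightarrow> x * s = s * x"
  proof (intro allI impI)
    fix x assume x: "x * a = a * x"
    have "x * a ^ n = a ^ n * x" for n
    proof (induction n)
      case (Suc n)
      have "x * a ^ Suc n = a * (x * a ^ n)" by (simp add: x flip: mult.assoc)
      then show ?case by (simp add: Suc mult.assoc)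
    qed simp
    then have "(\<lambda>n. x * f n) = (\<lambda>n. f n * x)" by (simp add: f_def)
    then show "x * s = s * x"
      unfolding s_def suminf_mult[OF sm, symmetric] suminf_mult2[OF sm] by simp
  qed
  ultimately show ?thesis unfolding selfadjoint_iff[symmetric] by (intro that)
qed

lemma selfadjoint_sqrt_diff:
  fixes a :: "'a::cstar_algebra"
  assumes sa: "a \<in> selfadjoint" and small: "norm a < r"
  obtains s where "s \<in> selfadjoint" "s * s = r *\<^sub>R 1 - a" "\<forall>x. x * a = a * x \<longrightarrow> x * s = s * x"
proof -
  have r: "r > 0" using small norm_ge_zero[of a] by linarith
  have 1: "(1/r) *\<^sub>R a \<in> selfadjoint" and 2: "norm ((1/r) *\<^sub>R a) < 1"
    using sa r small by (auto simp: selfadjoint_iff field_simps)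
  obtain s where
    s: "s \<in> selfadjoint" "s * s = 1 - (1/r) *\<^sub>R a"
       "\<forall>x. x * ((1/r) *\<^sub>R a) = ((1/r) *\<^sub>R a) * x \<longrightarrow> x * s = s * x"
    by (rule selfadjoint_sqrt_one_minus[OF 1 2])
  show ?thesis
  proof (rule that[of "sqrt r *\<^sub>R s"])
    show "sqrt r *\<^sub>R s \<in> selfadjoint" using s(1) by (simp add: selfadjoint_iff)
    show "sqrt r *\<^sub>R s * sqrt r *\<^sub>R s = r *\<^sub>R 1 - a" using r by (simp add: s(2) scaleR_diff_right)
    show "\<forall>x. x * a = a * x \<longrightarrow> x * sqrt r *\<^sub>R s = sqrt r *\<^sub>R s * x"
    proof (intro allI impI)
      fix x assume "x * a = a * x"
      then have "x * ((1/r) *\<^sub>R a) = ((1/r) *\<^sub>R a) * x" by simp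
      from s(3)[rule_format, OF this] show "x * sqrt r *\<^sub>R s = sqrt r *\<^sub>R s * x" by simp
    qed
  qed
qed

text \<open>Here \<open>w = k + i y\<close> satisfies \<open>w\<^sup>* w = k\<^sup>2 + y\<^sup>2\<close> because \<open>k\<close> and \<open>y\<close> commute, and \<open>k\<close> is the
  average of \<open>w\<close> and \<open>w\<^sup>*\<close>.\<close>

lemma norm_sq_le_norm_sum_squares:
  fixes k y :: "'a::cstar_algebra"
  assumes k: "k \<in> selfadjoint" and y: "y \<in> selfadjoint" and comm: "k * y = y * k"
  shows "(norm k)\<^sup>2 \<le> norm (k * k + y * y)"
proof -
  define w where "w = k + cscale \<i> y"
  have sw: "star w = k - cscale \<i> y"
    using k y by (simp add: w_def star_add star_cscale selfadjoint_iff)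
  have "star w * w = k * k + y * y"
    unfolding sw unfolding w_def
    by (simp add: algebra_simps cscale_mult_left cscale_mult_right cscale_diff_right
        cscale_cscale comm)
  then have nw: "(norm w)\<^sup>2 = norm (k * k + y * y)" by (metis cstar_identity)
  have "2 *\<^sub>R k = w + star w" unfolding sw unfolding w_def by (simp add: scaleR_2)
  then have "2 * norm k \<le> norm w + norm (star w)"
    by (metis norm_triangle_ineq norm_scaleR abs_numeral)
  then have "norm k \<le> norm w" by simp
  then show ?thesis using nw by (metis norm_ge_zero power_mono)
qed

definition invertible_elt :: "'a::cstar_algebra \<Rightarrow> bool" where
  "invertible_elt x \<longleftrightarrow> (\<exists>b. b * x = 1 \<and> x * b = 1)"

lemma spectrum_iff: "z \<in> spectrum a \<longleftrightarrow> \<not> invertible_elt (a - cscale z 1)"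
  by (simp add: spectrum_def invertible_elt_def)

lemma invertible_elt_mult:
  assumes "invertible_elt x" "invertible_elt y" shows "invertible_elt (x * y)"
proof -
  obtain b c where "b * x = 1" "x * b = 1" "c * y = 1" "y * c = 1"
    using assms by (auto simp: invertible_elt_def)
  then have "(c * b) * (x * y) = 1" "(x * y) * (c * b) = 1"
    by (metis mult.assoc mult.left_neutral)+
  then show ?thesis by (auto simp: invertible_elt_def)
qed

lemma invertible_elt_cscale:
  assumes "c \<noteq> 0" shows "invertible_elt (cscale c 1 :: 'a::cstar_algebra)"
  unfolding invertible_elt_def
  by (rule exI[of _ "cscale (inverse c) 1"])
     (use assms in \<open>simp add: cscale_mult_left cscale_cscale\<close>)

text \<open>If \<open>b\<close> inverts \<open>x y = y x\<close>, then \<open>y b\<close> and \<open>b y\<close> are one-sided inverses of \<open>x\<close> on opposite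
  sides and therefore agree.\<close>

lemma invertible_elt_factor:
  assumes inv: "invertible_elt (x * y)" and comm: "x * y = y * x"
  shows "invertible_elt x"
proof -
  obtain b where b: "b * (x * y) = 1" "(x * y) * b = 1"
    using inv by (auto simp: invertible_elt_def)
  have 1: "x * (y * b) = 1" using b by (simp add: mult.assoc)
  have 2: "(b * y) * x = 1" using b comm by (simp add: mult.assoc)
  have "b * y = y * b" by (metis 1 2 mult.assoc mult.left_neutral mult.right_neutral)
  then show ?thesis using 1 2 unfolding invertible_elt_def by metis
qed

lemma invertible_elt_one_minus:
  fixes a :: "'a::cstar_algebra"
  assumes "norm a < 1" shows "invertible_elt (1 - a)"
proof -
  have sm: "summable (\<lambda>n. a ^ n)" using assms by (rule complete_algebra_summable_geometric)
  have eq: "(\<Sum>n. a ^ n) = 1 + (\<Sum>n. a ^ Suc n)"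
    using suminf_split_initial_segment[OF sm, of 1] by simp
  have "(1 - a) * (\<Sum>n. a ^ n) = 1"
    using eq suminf_mult[OF sm, of a] by (simp add: algebra_simps)
  moreover have "(\<Sum>n. a ^ n) * (1 - a) = 1"
    using eq suminf_mult2[OF sm, of a] by (simp add: algebra_simps power_commutes)
  ultimately show ?thesis unfolding invertible_elt_def by blast
qed

text \<open>For \<open>norm a < cmod z\<close> the Neumann series inverts \<open>1 - a / z\<close>.\<close>

lemma norm_ge_of_spectrum:
  fixes a :: "'a::cstar_algebra"
  assumes "z \<in> spectrum a" shows "cmod z \<le> norm a"
proof (rule ccontr)
  assume "\<not> cmod z \<le> norm a"
  then have z: "norm a < cmod z" "z \<noteq> 0" by auto
  have "norm (cscale (inverse z) a) < 1"
    using z by (simp add: norm_cscale norm_inverse divide_inverse[symmetric] mult.commute)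
  from invertible_elt_mult[OF invertible_elt_cscale[of "- z"] invertible_elt_one_minus[OF this]]
  have "invertible_elt (a - cscale z 1)"
    using z by (simp add: cscale_mult_left right_diff_distrib cscale_cscale)
  then show False using assms by (simp add: spectrum_iff)
qed

text \<open>If \<open>1 - k\<^sup>2\<close> had an inverse \<open>R\<close>, then for small \<open>\<delta>\<close> and every \<open>\<eta> > 0\<close> the element
  \<open>1 - k\<^sup>2 + \<eta>\<close> and \<open>1 - \<delta> R\<close> would have commuting self-adjoint square roots with product \<open>y\<close>, say,
  and \<open>k\<^sup>2 + y\<^sup>2\<close> would be \<open>1 - \<delta>\<close> up to \<open>O(\<eta>)\<close>, so that \<open>norm k\<close> would be less than 1.
  This replaces the spectral radius formula.\<close>

lemma not_invertible_one_minus_square: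
  fixes k :: "'a::cstar_algebra"
  assumes sa: "k \<in> selfadjoint" and n1: "norm k = 1"
  shows "\<not> invertible_elt (1 - k * k)"
proof
  assume "invertible_elt (1 - k * k)"
  then obtain R where R: "R * (1 - k * k) = 1" "(1 - k * k) * R = 1"
    by (auto simp: invertible_elt_def)
  have sk: "star k = k" using sa by (simp add: selfadjoint_iff)
  have "star R * (1 - k * k) = 1"
    using arg_cong[OF R(2), of star] by (simp add: star_mult star_diff sk)
  then have sR: "star R = R" by (metis R(2) mult.assoc mult.left_neutral mult.right_neutral)
  define c where "c = 1 - k * k"
  have commR: "x * R = R * x" if "x * c = c * x" for x
  proof -
    have "R * (x * c) * R = R * (c * x) * R" using that by simp
    then show ?thesis using R unfolding c_def[symmetric] by (metis mult.assoc mult.left_neutral mult.right_neutral)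
  qed
  have kc: "k * c = c * k" by (simp add: c_def algebra_simps mult.assoc)
  define \<delta> where "\<delta> = 1 / (norm R + 1)"
  have \<delta>: "\<delta> > 0" by (simp add: \<delta>_def add_nonneg_pos)
  have 1: "norm (\<delta> *\<^sub>R R) < 1"
    using norm_ge_zero[of R] by (simp add: \<delta>_def divide_less_eq del: norm_ge_zero)
  have 2: "\<delta> *\<^sub>R R \<in> selfadjoint" using sR by (simp add: selfadjoint_iff)
  obtain q where q: "q \<in> selfadjoint" "q * q = 1 - \<delta> *\<^sub>R R"
    "\<forall>x. x * (\<delta> *\<^sub>R R) = (\<delta> *\<^sub>R R) * x \<longrightarrow> x * q = q * x"
    by (rule selfadjoint_sqrt_one_minus[OF 2 1])
  have main: "1 \<le> \<bar>1 - \<delta> + \<eta>\<bar> + \<eta> * \<delta> * norm R" if \<eta>: "\<eta> > 0" for \<eta>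
  proof -
    have 1: "k * k \<in> selfadjoint" using sk by (simp add: selfadjoint_iff star_mult)
    have 2: "norm (k * k) < 1 + \<eta>"
      using norm_square_selfadjoint[OF sa] n1 \<eta> by simp
    obtain s where s: "s \<in> selfadjoint" "s * s = (1 + \<eta>) *\<^sub>R 1 - k * k"
      "\<forall>x. x * (k * k) = (k * k) * x \<longrightarrow> x * s = s * x"
      by (rule selfadjoint_sqrt_diff[OF 1 2])
    have ss: "s * s = c + \<eta> *\<^sub>R 1" using s(2) by (simp add: c_def algebra_simps)
    have ks: "k * s = s * k" by (rule s(3)[rule_format]) (simp add: mult.assoc)
    have sc: "s * c = c * s"
      by (simp add: c_def algebra_simps) (metis ks mult.assoc)
    have sRc: "s * R = R * s" by (rule commR[OF sc])
    have sq: "s * q = q * s" by (rule q(3)[rule_format]) (simp add: sRc)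
    have kq: "k * q = q * k" by (rule q(3)[rule_format]) (simp add: commR[OF kc])
    define y where "y = s * q"
    have "y \<in> selfadjoint"
      using s(1) q(1) sq by (simp add: y_def selfadjoint_iff star_mult)
    moreover have "k * y = y * k" unfolding y_def by (metis ks kq mult.assoc)
    ultimately have le: "(norm k)\<^sup>2 \<le> norm (k * k + y * y)"
      by (rule norm_sq_le_norm_sum_squares[OF sa])
    have "y * y = (s * s) * (q * q)" unfolding y_def by (metis sq mult.assoc)
    also have "\<dots> = c + \<eta> *\<^sub>R 1 - \<delta> *\<^sub>R 1 - (\<eta> * \<delta>) *\<^sub>R R"
      unfolding ss q(2) using R(2) by (simp add: c_def[symmetric] algebra_simps)
    finally have "k * k + y * y = (1 - \<delta> + \<eta>) *\<^sub>R 1 - (\<eta> * \<delta>) *\<^sub>R R"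
      by (simp add: c_def algebra_simps)
    then have "norm (k * k + y * y) \<le> \<bar>1 - \<delta> + \<eta>\<bar> + \<eta> * \<delta> * norm R"
      using norm_triangle_ineq4[of "(1 - \<delta> + \<eta>) *\<^sub>R (1::'a)" "(\<eta> * \<delta>) *\<^sub>R R"] \<eta> \<delta>
      by (simp add: abs_mult)
    then show ?thesis using le n1 by simp
  qed
  have "1 \<le> \<bar>1 - \<delta> + 0\<bar> + 0 * \<delta> * norm R"
    by (rule le_at_right_limit[of "\<lambda>\<eta>. \<bar>1 - \<delta> + \<eta>\<bar> + \<eta> * \<delta> * norm R"]) (intro tendsto_intros main)+
  moreover have "\<delta> \<le> 1"
    using norm_ge_zero[of R] by (simp add: \<delta>_def divide_le_eq del: norm_ge_zero)
  ultimately show False using \<delta> by simp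
qed

definition real_spectrum :: "'a::cstar_algebra \<Rightarrow> real set" where
  "real_spectrum h = {x. complex_of_real x \<in> spectrum h}"

lemma real_spectrum_iff: "x \<in> real_spectrum h \<longleftrightarrow> \<not> invertible_elt (h - x *\<^sub>R 1)"
  by (simp add: real_spectrum_def spectrum_iff cscale_of_real)

lemma real_spectrum_bound: "x \<in> real_spectrum h \<Longrightarrow> \<bar>x\<bar> \<le> norm h"
  using norm_ge_of_spectrum[of "complex_of_real x" h] by (simp add: real_spectrum_def)

text \<open>After scaling \<open>k\<close> to norm 1, invertibility of both \<open>k - 1\<close> and \<open>k + 1\<close> would make
  \<open>1 - k\<^sup>2\<close> invertible.\<close>

lemma norm_in_real_spectrum:
  fixes k :: "'a::cstar_algebra"
  assumes sa: "k \<in> selfadjoint"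
  obtains x where "x \<in> real_spectrum k" "\<bar>x\<bar> = norm k"
proof (cases "k = 0")
  case True
  have "0 \<in> real_spectrum k" by (simp add: True real_spectrum_iff invertible_elt_def)
  then show ?thesis using that[of 0] True by simp
next
  case False
  define n where "n = norm k"
  have n: "n > 0" using False by (simp add: n_def)
  have "norm k \<in> real_spectrum k \<or> - norm k \<in> real_spectrum k"
  proof (rule ccontr)
    assume "\<not> ?thesis"
    then have "invertible_elt (k - n *\<^sub>R 1)" "invertible_elt (k + n *\<^sub>R 1)"
      by (auto simp: real_spectrum_iff n_def)
    note prod = invertible_elt_mult[OF this]
    define z where "z = complex_of_real (- (1 / n\<^sup>2))"
    have "z \<noteq> 0" using n by (simp add: z_def)
    from invertible_elt_mult[OF invertible_elt_cscale[OF this] prod]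
    have "invertible_elt (cscale z 1 * ((k - n *\<^sub>R 1) * (k + n *\<^sub>R 1)))" .
    also have "cscale z 1 * ((k - n *\<^sub>R 1) * (k + n *\<^sub>R 1))
        = 1 - ((1/n) *\<^sub>R k) * ((1/n) *\<^sub>R k)"
      using n unfolding z_def cscale_of_real by (simp add: algebra_simps power2_eq_square)
    finally show False
      using not_invertible_one_minus_square[of "(1/n) *\<^sub>R k"] sa n
      by (simp add: selfadjoint_iff n_def)
  qed
  then show ?thesis using that[of "norm k"] that[of "- norm k"] by (elim disjE) simp_all
qed

text \<open>Arens' argument: for real \<open>t\<close>, the distance of \<open>i (b + t)\<close> from 0 exceeds the norm of
  \<open>h - a + i t\<close>, whose square is at most that of \<open>h - a\<close> plus \<open>t\<^sup>2\<close>, as soon as \<open>b t\<close> is large.\<close>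

lemma spectrum_selfadjoint_real:
  fixes h :: "'a::cstar_algebra"
  assumes sa: "h \<in> selfadjoint" and z: "z \<in> spectrum h"
  shows "Im z = 0"
proof (rule ccontr)
  define a b where "a = Re z" and "b = Im z"
  assume "Im z \<noteq> 0"
  then have b: "b \<noteq> 0" by (simp add: b_def)
  define k where "k = h - a *\<^sub>R 1"
  have sk: "star k = k" using sa by (simp add: k_def star_diff selfadjoint_iff)
  define t where "t = (norm k)\<^sup>2 / (2 * b)"
  define w where "w = k + cscale (\<i> * complex_of_real t) 1"
  have "star w * w = k * k + t\<^sup>2 *\<^sub>R 1"
    by (simp add: w_def star_add star_cscale sk algebra_simps cscale_mult_left cscale_mult_right
        cscale_cscale cscale_diff_right cscale_add_right power2_eq_square) (simp add: cscale_of_real flip: of_real_mult)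
  then have "(norm w)\<^sup>2 \<le> (norm k)\<^sup>2 + t\<^sup>2"
    using norm_triangle_ineq[of "k * k" "t\<^sup>2 *\<^sub>R 1"] norm_square_selfadjoint[of k] sk
    by (simp add: selfadjoint_iff cstar_identity[of w, symmetric])
  also have "\<dots> < (b + t)\<^sup>2"
  proof -
    have "2 * b * t = (norm k)\<^sup>2" using b by (simp add: t_def)
    then show ?thesis using b by (simp add: power2_sum)
  qed
  finally have "norm w < \<bar>b + t\<bar>"
    by (metis abs_norm_cancel power2_abs power2_less_imp_less abs_ge_zero)
  moreover have "\<i> * complex_of_real (b + t) \<in> spectrum w"
  proof -
    have "w - cscale (\<i> * complex_of_real (b + t)) 1 = h - cscale z 1"
    proof -
      have zz: "z = complex_of_real a + \<i> * complex_of_real b"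
        unfolding a_def b_def by (rule complex_eq)
      show ?thesis
        unfolding w_def k_def zz
        by (simp add: cscale_add_left distrib_left cscale_of_real algebra_simps)
    qed
    then show ?thesis using z by (simp add: spectrum_iff)
  qed
  ultimately show False
    using norm_ge_of_spectrum[of "\<i> * complex_of_real (b + t)" w]
    by (simp add: norm_mult del: of_real_add)
qed

section \<open>Continuous functional calculus\<close>

definition cpeval :: "complex poly \<Rightarrow> 'a::cstar_algebra \<Rightarrow> 'a" where
  "cpeval p h = (\<Sum>i\<le>degree p. cscale (coeff p i) (h ^ i))"

lemma cpeval_bound:
  assumes "degree p \<le> n" shows "cpeval p h = (\<Sum>i\<le>n. cscale (coeff p i) (h ^ i))"
  unfolding cpeval_def
  by (rule sum.mono_neutral_left) (use assms in \<open>auto simp: coeff_eq_0\<close>)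

lemma cpeval_pCons: "cpeval (pCons c p) h = cscale c 1 + h * cpeval p h"
proof -
  have "degree (pCons c p) \<le> Suc (degree p)" by (rule degree_pCons_le)
  from cpeval_bound[OF this] show ?thesis
    by (simp add: cpeval_def sum.atMost_Suc_shift sum_distrib_left cscale_mult_right
        del: sum.atMost_Suc)
qed

lemma cpeval_0 [simp]: "cpeval 0 h = 0"
  by (simp add: cpeval_def)

lemma peval_eq_cpeval: "peval p h = cpeval (map_poly complex_of_real p) h"
  by (simp add: peval_def cpeval_def degree_map_poly coeff_map_poly cscale_of_real)

lemma peval_pCons: "peval (pCons c p) h = c *\<^sub>R 1 + h * peval p h"
  by (simp add: peval_eq_cpeval map_poly_pCons cpeval_pCons cscale_of_real)

lemma peval_0 [simp]: "peval 0 h = 0"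
  by (simp add: peval_def)

lemma peval_add: "peval (p + q) h = peval p h + peval q h"
  by (induction p q rule: poly_induct2) (simp_all add: peval_pCons algebra_simps)

lemma peval_smult: "peval (smult c p) h = c *\<^sub>R peval p h"
  by (induction p) (simp_all add: peval_pCons algebra_simps)

lemma peval_mult: "peval (p * q) h = peval p h * peval q h"
  by (induction p)
     (simp_all add: mult_pCons_left peval_add peval_smult peval_pCons algebra_simps mult.assoc)

lemma peval_diff: "peval (p - q) h = peval p h - peval q h"
  using peval_add[of p "smult (-1) q" h] peval_smult[of "-1" q h] by simp

lemma cpeval_commute: "x * h = h * x \<Longrightarrow> x * cpeval p h = cpeval p h * x"
proof (induction p)
  case (pCons c p)
  have "x * (h * cpeval p h) = (h * x) * cpeval p h" by (simp add: pCons(3) flip: mult.assoc)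
  then show ?case
    using pCons by (simp add: cpeval_pCons algebra_simps cscale_mult_left cscale_mult_right)
qed simp

lemma peval_selfadjoint:
  assumes "h \<in> selfadjoint" shows "peval p h \<in> selfadjoint"
proof -
  have h: "star h = h" using assms by (simp add: selfadjoint_iff)
  have "star (peval p h) = peval p h"
  proof (induction p)
    case (pCons c p)
    moreover have "peval p h * h = h * peval p h"
      unfolding peval_eq_cpeval by (rule cpeval_commute[symmetric]) simp
    ultimately show ?case by (simp add: peval_pCons star_add star_mult h)
  qed simp
  then show ?thesis by (simp add: selfadjoint_iff)
qed

lemma poly_map_poly_of_real:
  "poly (map_poly complex_of_real p) (complex_of_real x) = complex_of_real (poly p x)"
  by (induction p) (simp_all add: map_poly_pCons)

lemma cpeval_synthetic_div:
  "cpeval p h - cscale (poly p z) 1 = (h - cscale z 1) * cpeval (synthetic_div p z) h"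
proof (induction p)
  case (pCons c p)
  have "cpeval (pCons c p) h - cscale (poly (pCons c p) z) 1
      = h * (cpeval p h - cscale (poly p z) 1) + (h - cscale z 1) * cscale (poly p z) 1"
    by (simp add: cpeval_pCons algebra_simps cscale_add_left cscale_mult_left cscale_mult_right
        cscale_cscale cscale_diff_right)
  also have "h * (cpeval p h - cscale (poly p z) 1)
      = (h - cscale z 1) * (h * cpeval (synthetic_div p z) h)"
    unfolding pCons.IH
    by (simp add: algebra_simps cscale_mult_left cscale_mult_right)
  finally show ?case by (simp add: cpeval_pCons synthetic_div_pCons algebra_simps)
qed simp

text \<open>Over the complex numbers a polynomial splits into linear factors.\<close>

lemma invertible_cpeval:
  assumes "p \<noteq> 0" "\<And>z. poly p z = 0 \<Longrightarrow> z \<notin> spectrum h"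
  shows "invertible_elt (cpeval p h)"
  using assms
proof (induction "degree p" arbitrary: p)
  case 0
  then obtain c where "p = [:c:]" "c \<noteq> 0" by (metis degree_0_id pCons_0_0 degree_eq_zeroE)
  then show ?case by (simp add: cpeval_pCons invertible_elt_cscale)
next
  case (Suc n)
  then have deg: "degree p \<noteq> 0" by simp
  then obtain z where z: "poly p z = 0"
    using fundamental_theorem_of_algebra constant_degree by metis
  define q where "q = synthetic_div p z"
  have pq: "p = [:- z, 1:] * q" using synthetic_div_correct'[of z p] z by (simp add: q_def)
  have "q \<noteq> 0" using deg by (simp add: q_def synthetic_div_eq_0_iff)
  moreover have "n = degree q" using Suc(2) by (simp add: q_def degree_synthetic_div)
  moreover have "y \<notin> spectrum h" if "poly q y = 0" for y
    using that Suc(4)[of y] by (simp add: pq)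
  ultimately have "invertible_elt (cpeval q h)" using Suc(1) by blast
  moreover have "invertible_elt (h - cscale z 1)" using Suc(4)[OF z] by (simp add: spectrum_iff)
  ultimately have "invertible_elt ((h - cscale z 1) * cpeval q h)"
    by (rule invertible_elt_mult[rotated])
  then show ?case using cpeval_synthetic_div[of p h z] by (simp add: z q_def)
qed

text \<open>The norm of the self-adjoint \<open>p h\<close> is, up to sign, a point \<open>y\<close> of its spectrum, and by the
  previous lemma \<open>p - y\<close> has a zero in the spectrum of \<open>h\<close>, which is real.\<close>

lemma norm_peval_le:
  assumes sa: "h \<in> selfadjoint" and M: "\<And>x. x \<in> real_spectrum h \<Longrightarrow> \<bar>poly p x\<bar> \<le> M"
  shows "norm (peval p h) \<le> M"
proof -
  obtain y where y: "y \<in> real_spectrum (peval p h)" "\<bar>y\<bar> = norm (peval p h)"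
    using norm_in_real_spectrum[OF peval_selfadjoint[OF sa]] by metis
  define q where "q = p - [:y:]"
  have pq: "peval p h - y *\<^sub>R 1 = peval q h"
    by (simp add: q_def peval_diff peval_pCons)
  have "\<exists>x\<in>real_spectrum h. poly q x = 0"
  proof (rule ccontr)
    assume no: "\<not> ?thesis"
    have "\<not> invertible_elt (peval q h)"
      using y(1) by (simp add: real_spectrum_iff pq)
    moreover have "invertible_elt (cpeval (map_poly complex_of_real q) h)"
    proof (rule invertible_cpeval)
      obtain x where "x \<in> real_spectrum h" using norm_in_real_spectrum[OF sa] by metis
      then have "q \<noteq> 0" using no by auto
      then show "map_poly complex_of_real q \<noteq> 0" by (simp add: map_poly_eq_0_iff)
      fix z assume z: "poly (map_poly complex_of_real q) z = 0"
      show "z \<notin> spectrum h"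
      proof
        assume zs: "z \<in> spectrum h"
        then have "z = complex_of_real (Re z)"
          using spectrum_selfadjoint_real[OF sa] by (simp add: complex_eq_iff)
        then have "Re z \<in> real_spectrum h" "poly q (Re z) = 0"
          using zs z poly_map_poly_of_real[of q "Re z"] by (auto simp: real_spectrum_def)
        then show False using no by blast
      qed
    qed
    ultimately show False by (simp add: peval_eq_cpeval)
  qed
  then obtain x where "x \<in> real_spectrum h" "poly p x = y" by (auto simp: q_def)
  then show ?thesis using M[of x] y(2) by simp
qed

text \<open>By synthetic division \<open>h - x\<close> is a factor of \<open>p h - p(x)\<close>, so \<open>p(x)\<close> is in the spectrum
  of \<open>p h\<close>.\<close>

lemma abs_poly_le_norm_peval:
  assumes x: "x \<in> real_spectrum h" shows "\<bar>poly p x\<bar> \<le> norm (peval p h)"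
proof -
  define q where "q = map_poly complex_of_real p"
  have "h * (h - cscale (complex_of_real x) 1) = (h - cscale (complex_of_real x) 1) * h"
    by (simp add: algebra_simps cscale_of_real)
  then have "(h - cscale (complex_of_real x) 1) * h = h * (h - cscale (complex_of_real x) 1)"
    by simp
  note comm = cpeval_commute[OF this]
  have "\<not> invertible_elt (cpeval q h - cscale (poly q (complex_of_real x)) 1)"
    unfolding cpeval_synthetic_div
    using invertible_elt_factor[OF _ comm] x unfolding real_spectrum_def spectrum_iff by blast
  then have "poly p x \<in> real_spectrum (peval p h)"
    unfolding real_spectrum_def spectrum_iff peval_eq_cpeval q_def poly_map_poly_of_real by simp
  then show ?thesis by (rule real_spectrum_bound)
qed

text \<open>By \<open>norm_peval_le\<close>, the values at \<open>h\<close> of polynomials that are uniformly close on the spectrum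
  are close in norm. This gives the Cauchy property and independence of the approximating sequence,
  so that the definite description in the definition of \<open>cfc\<close> denotes.\<close>

lemma cfc_limit:
  assumes sa: "h \<in> selfadjoint"
    and p: "uniform_limit (real_spectrum h) (\<lambda>n. poly (p n)) f sequentially"
  shows "(\<lambda>n. peval (p n) h) \<longlonglongrightarrow> cfc f h"
proof -
  have close: "\<exists>N. \<forall>m\<ge>N. \<forall>n\<ge>N. norm (peval (p m) h - peval (q n) h) \<le> e"
    if q: "uniform_limit (real_spectrum h) (\<lambda>n. poly (q n)) f sequentially" and e: "e > 0"
    for q :: "nat \<Rightarrow> real poly" and e
  proof -
    have "\<forall>\<^sub>F n in sequentially. \<forall>x\<in>real_spectrum h. dist (poly (p n) x) (f x) < e/2"
      using uniform_limitD[OF p, of "e/2"] e by simp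
    moreover have "\<forall>\<^sub>F n in sequentially. \<forall>x\<in>real_spectrum h. dist (poly (q n) x) (f x) < e/2"
      using uniform_limitD[OF q, of "e/2"] e by simp
    ultimately obtain N where N: "\<And>n x. n \<ge> N \<Longrightarrow> x \<in> real_spectrum h \<Longrightarrow>
        dist (poly (p n) x) (f x) < e/2 \<and> dist (poly (q n) x) (f x) < e/2"
      unfolding eventually_sequentially by (metis nle_le order_trans)
    have "norm (peval (p m) h - peval (q n) h) \<le> e" if "m \<ge> N" "n \<ge> N" for m n
      unfolding peval_diff[symmetric]
    proof (rule norm_peval_le[OF sa])
      fix x assume "x \<in> real_spectrum h"
      then show "\<bar>poly (p m - q n) x\<bar> \<le> e"
        using N[of m x] N[of n x] that unfolding dist_real_def poly_diff by linarith
    qed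
    then show ?thesis by blast
  qed
  have "Cauchy (\<lambda>n. peval (p n) h)"
  proof (rule CauchyI)
    fix e :: real assume e: "e > 0"
    then obtain N where "\<And>m n. m \<ge> N \<Longrightarrow> n \<ge> N \<Longrightarrow> norm (peval (p m) h - peval (p n) h) \<le> e/2"
      using close[OF p, of "e/2"] by auto
    moreover have "e/2 < e" using e by simp
    ultimately show "\<exists>M. \<forall>m\<ge>M. \<forall>n\<ge>M. norm (peval (p m) h - peval (p n) h) < e"
      by (meson le_less_trans)
  qed
  then obtain b where b: "(\<lambda>n. peval (p n) h) \<longlonglongrightarrow> b"
    using Cauchy_convergent_iff convergent_def by blast
  have uniq: "(\<lambda>n. peval (q n) h) \<longlonglongrightarrow> b"
    if q: "uniform_limit (real_spectrum h) (\<lambda>n. poly (q n)) f sequentially" for q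
  proof -
    have "(\<lambda>n. peval (p n) h - peval (q n) h) \<longlonglongrightarrow> 0"
    proof (rule LIMSEQ_I)
      fix r :: real assume "r > 0"
      then show "\<exists>N. \<forall>n\<ge>N. norm (peval (p n) h - peval (q n) h - 0) < r"
        using close[OF q, of "r/2"] by fastforce
    qed
    from tendsto_diff[OF b this] show ?thesis by simp
  qed
  have "cfc f h = b"
    unfolding cfc_def real_spectrum_def[symmetric]
  proof (rule the_equality)
    show "\<forall>p. uniform_limit (real_spectrum h) (\<lambda>n. poly (p n)) f sequentially \<longrightarrow>
        (\<lambda>n. peval (p n) h) \<longlonglongrightarrow> b"
      using uniq by blast
    fix c assume "\<forall>p. uniform_limit (real_spectrum h) (\<lambda>n. poly (p n)) f sequentially \<longrightarrow>
        (\<lambda>n. peval (p n) h) \<longlonglongrightarrow> c"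
    then show "c = b" using p b LIMSEQ_unique by blast
  qed
  then show ?thesis using b by simp
qed

lemma polynomial_uniform_approximation:
  fixes f :: "real \<Rightarrow> real"
  assumes "continuous_on {a..b} f"
  obtains p where "uniform_limit {a..b} (\<lambda>n. poly (p n)) f sequentially"
proof -
  have "\<exists>p. \<forall>x\<in>{a..b}. \<bar>f x - poly p x\<bar> < e" if e: "e > 0" for e
  proof -
    obtain g where g: "real_polynomial_function g" "\<And>x. x \<in> {a..b} \<Longrightarrow> \<bar>f x - g x\<bar> < e"
      using Stone_Weierstrass_real_polynomial_function[OF compact_Icc assms e] by metis
    obtain c n where "g = (\<lambda>x. \<Sum>i\<le>n. c i * x ^ i)"
      using g(1) unfolding real_polynomial_function_iff_sum by auto
    then have "g = poly (\<Sum>i\<le>n. monom (c i) i)" by (auto simp: poly_sum poly_monom)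
    then show ?thesis using g(2) by blast
  qed
  then have "\<forall>n. \<exists>p. \<forall>x\<in>{a..b}. \<bar>f x - poly p x\<bar> < inverse (real (Suc n))"
    by simp
  then obtain p where p: "\<And>n x. x \<in> {a..b} \<Longrightarrow> \<bar>f x - poly (p n) x\<bar> < inverse (real (Suc n))"
    by metis
  have "uniform_limit {a..b} (\<lambda>n. poly (p n)) f sequentially"
  proof (rule uniform_limitI)
    fix e :: real assume "e > 0"
    then have "\<forall>\<^sub>F n in sequentially. inverse (real (Suc n)) < e"
      using LIMSEQ_inverse_real_of_nat by (metis order_tendstoD(2))
    then show "\<forall>\<^sub>F n in sequentially. \<forall>x\<in>{a..b}. dist (poly (p n) x) (f x) < e"
    proof eventually_elim
      case (elim n)
      then show ?case using p[of _ n] by (fastforce simp: dist_real_def abs_minus_commute)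
    qed
  qed
  then show ?thesis using that by blast
qed

text \<open>An interval that contains the spectrum is a compact set on which Weierstrass approximation
  applies.\<close>

locale selfadjoint_interval =
  fixes h :: "'a::cstar_algebra" and a b :: real
  assumes sa: "h \<in> selfadjoint" and spec: "real_spectrum h \<subseteq> {a..b}"
begin

lemma cfc_approx:
  assumes "continuous_on {a..b} f"
  obtains p where "uniform_limit {a..b} (\<lambda>n. poly (p n)) f sequentially"
    "(\<lambda>n. peval (p n) h) \<longlonglongrightarrow> cfc f h"
  using polynomial_uniform_approximation[OF assms] cfc_limit[OF sa]
    uniform_limit_on_subset[OF _ spec] by metis

lemma cfc_limit_interval:
  assumes "uniform_limit {a..b} (\<lambda>n. poly (p n)) f sequentially"
  shows "(\<lambda>n. peval (p n) h) \<longlonglongrightarrow> cfc f h"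
  by (rule cfc_limit[OF sa uniform_limit_on_subset[OF assms spec]])

lemma bounded_image_interval:
  assumes "continuous_on {a..b} f"
  shows "bounded (f ` {a..b})"
  using assms compact_Icc compact_continuous_image compact_imp_bounded by blast

lemma cfc_mult:
  assumes f: "continuous_on {a..b} f" and g: "continuous_on {a..b} g"
  shows "cfc (\<lambda>x. f x * g x) h = cfc f h * cfc g h"
proof -
  obtain p where p: "uniform_limit {a..b} (\<lambda>n. poly (p n)) f sequentially"
    "(\<lambda>n. peval (p n) h) \<longlonglongrightarrow> cfc f h" using cfc_approx[OF f] .
  obtain q where q: "uniform_limit {a..b} (\<lambda>n. poly (q n)) g sequentially"
    "(\<lambda>n. peval (q n) h) \<longlonglongrightarrow> cfc g h" using cfc_approx[OF g] .
  have "uniform_limit {a..b} (\<lambda>n x. poly (p n) x * poly (q n) x) (\<lambda>x. f x * g x) sequentially"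
    by (rule uniform_lim_mult[OF p(1) q(1)]) (rule bounded_image_interval f g)+
  then have "uniform_limit {a..b} (\<lambda>n. poly (p n * q n)) (\<lambda>x. f x * g x) sequentially"
    by (simp add: poly_mult[abs_def])
  from cfc_limit_interval[OF this]
  have "(\<lambda>n. peval (p n) h * peval (q n) h) \<longlonglongrightarrow> cfc (\<lambda>x. f x * g x) h"
    by (simp add: peval_mult)
  then show ?thesis using tendsto_mult[OF p(2) q(2)] LIMSEQ_unique by blast
qed

lemma cfc_lincomb:
  assumes f: "continuous_on {a..b} f" and g: "continuous_on {a..b} g"
  shows "cfc (\<lambda>x. r * f x + s * g x) h = r *\<^sub>R cfc f h + s *\<^sub>R cfc g h"
proof -
  obtain p where p: "uniform_limit {a..b} (\<lambda>n. poly (p n)) f sequentially"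
    "(\<lambda>n. peval (p n) h) \<longlonglongrightarrow> cfc f h" using cfc_approx[OF f] .
  obtain q where q: "uniform_limit {a..b} (\<lambda>n. poly (q n)) g sequentially"
    "(\<lambda>n. peval (q n) h) \<longlonglongrightarrow> cfc g h" using cfc_approx[OF g] .
  have "uniform_limit {a..b} (\<lambda>n x. r * poly (p n) x + s * poly (q n) x)
      (\<lambda>x. r * f x + s * g x) sequentially"
    by (intro uniform_limit_intros p q)
  then have "uniform_limit {a..b} (\<lambda>n. poly (smult r (p n) + smult s (q n)))
      (\<lambda>x. r * f x + s * g x) sequentially"
    by (simp add: poly_add[abs_def])
  from cfc_limit_interval[OF this]
  have "(\<lambda>n. r *\<^sub>R peval (p n) h + s *\<^sub>R peval (q n) h) \<longlonglongrightarrow> cfc (\<lambda>x. r * f x + s * g x) h"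
    by (simp add: peval_add peval_smult)
  moreover have "(\<lambda>n. r *\<^sub>R peval (p n) h + s *\<^sub>R peval (q n) h)
      \<longlonglongrightarrow> r *\<^sub>R cfc f h + s *\<^sub>R cfc g h"
    by (intro tendsto_intros p q)
  ultimately show ?thesis using LIMSEQ_unique by blast
qed

lemma cfc_selfadjoint:
  assumes f: "continuous_on {a..b} f" shows "cfc f h \<in> selfadjoint"
proof -
  obtain p where p: "(\<lambda>n. peval (p n) h) \<longlonglongrightarrow> cfc f h" using cfc_approx[OF f] .
  have "(\<lambda>n. star (peval (p n) h)) \<longlonglongrightarrow> star (cfc f h)"
    by (rule bounded_linear.tendsto[OF bounded_linear_star p])
  moreover have "star (peval (p n) h) = peval (p n) h" for n
    using peval_selfadjoint[OF sa] by (simp add: selfadjoint_iff)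
  ultimately have "(\<lambda>n. peval (p n) h) \<longlonglongrightarrow> star (cfc f h)" by simp
  from LIMSEQ_unique[OF this p] show ?thesis by (simp add: selfadjoint_iff)
qed

lemma cfc_cong:
  assumes f: "continuous_on {a..b} f" and eq: "\<And>x. x \<in> {a..b} \<Longrightarrow> f x = g x"
  shows "cfc f h = cfc g h"
proof -
  obtain p where p: "uniform_limit {a..b} (\<lambda>n. poly (p n)) f sequentially"
    "(\<lambda>n. peval (p n) h) \<longlonglongrightarrow> cfc f h" using cfc_approx[OF f] .
  have "uniform_limit {a..b} (\<lambda>n. poly (p n)) g sequentially"
    by (rule iffD1[OF uniform_limit_cong' p(1)]) (auto simp: eq)
  from LIMSEQ_unique[OF p(2) cfc_limit_interval[OF this]] show ?thesis .
qed

lemma cfc_one: "cfc (\<lambda>_. 1) h = 1"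
proof -
  have lim: "uniform_limit {a..b} (\<lambda>n. poly [:1:]) (\<lambda>_. 1::real) sequentially"
    by (rule uniform_limitI) simp
  from LIMSEQ_unique[OF cfc_limit_interval[OF lim] tendsto_const] show ?thesis
    by (simp add: peval_pCons)
qed

lemma cfc_id: "cfc (\<lambda>x. x) h = h"
proof -
  have lim: "uniform_limit {a..b} (\<lambda>n. poly [:0, 1:]) (\<lambda>x. x::real) sequentially"
    by (rule uniform_limitI) simp
  from LIMSEQ_unique[OF cfc_limit_interval[OF lim] tendsto_const] show ?thesis
    by (simp add: peval_pCons)
qed

lemma norm_cfc_le:
  assumes f: "continuous_on {a..b} f" and M: "\<And>x. x \<in> {a..b} \<Longrightarrow> \<bar>f x\<bar> \<le> M"
  shows "norm (cfc f h) \<le> M"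
proof -
  obtain p where p: "uniform_limit {a..b} (\<lambda>n. poly (p n)) f sequentially"
    "(\<lambda>n. peval (p n) h) \<longlonglongrightarrow> cfc f h" using cfc_approx[OF f] .
  have "norm (cfc f h) \<le> M + e" if e: "e > 0" for e
  proof (rule tendsto_upperbound[OF tendsto_norm[OF p(2)]])
    have "\<forall>\<^sub>F n in sequentially. \<forall>x\<in>{a..b}. dist (poly (p n) x) (f x) < e"
      using uniform_limitD[OF p(1) e] .
    then show "\<forall>\<^sub>F n in sequentially. norm (peval (p n) h) \<le> M + e"
    proof eventually_elim
      case (elim n)
      show ?case
      proof (rule norm_peval_le[OF sa])
        fix x assume "x \<in> real_spectrum h"
        then have "x \<in> {a..b}" using spec by blast
        then show "\<bar>poly (p n) x\<bar> \<le> M + e"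
          using elim M[of x] unfolding dist_real_def by fastforce
      qed
    qed
  qed simp
  then show ?thesis by (rule field_le_epsilon)
qed

lemma abs_le_norm_cfc:
  assumes f: "continuous_on {a..b} f" and x: "x \<in> real_spectrum h"
  shows "\<bar>f x\<bar> \<le> norm (cfc f h)"
proof -
  obtain p where p: "uniform_limit {a..b} (\<lambda>n. poly (p n)) f sequentially"
    "(\<lambda>n. peval (p n) h) \<longlonglongrightarrow> cfc f h" using cfc_approx[OF f] .
  have "(\<lambda>n. poly (p n) x) \<longlonglongrightarrow> f x"
    using tendsto_uniform_limitI[OF p(1)] x spec by blast
  then have "(\<lambda>n. \<bar>poly (p n) x\<bar>) \<longlonglongrightarrow> \<bar>f x\<bar>" by (rule tendsto_rabs)
  then show ?thesis
    by (rule tendsto_le[OF _ tendsto_norm[OF p(2)], rotated]) (simp_all add: abs_poly_le_norm_peval[OF x])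
qed

text \<open>For \<open>y\<close> outside \<open>{c..d}\<close> the calculus applied to \<open>1 / (f - y)\<close> inverts \<open>f h - y\<close>.\<close>

lemma selfadjoint_interval_cfc:
  assumes f: "continuous_on {a..b} f" and cd: "\<And>x. x \<in> {a..b} \<Longrightarrow> f x \<in> {c..d}"
  shows "selfadjoint_interval (cfc f h) c d"
proof
  show "cfc f h \<in> selfadjoint" by (rule cfc_selfadjoint[OF f])
  show "real_spectrum (cfc f h) \<subseteq> {c..d}"
  proof
    fix y assume y: "y \<in> real_spectrum (cfc f h)"
    show "y \<in> {c..d}"
    proof (rule ccontr)
      assume no: "y \<notin> {c..d}"
      then have nz: "f x - y \<noteq> 0" if "x \<in> {a..b}" for x using cd[OF that] by auto
      define g where "g x = 1 * f x + (- y) * 1" for x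
      have g: "continuous_on {a..b} g" unfolding g_def by (intro continuous_intros f)
      have gi: "continuous_on {a..b} (\<lambda>x. inverse (g x))"
        using nz by (intro continuous_intros g) (auto simp: g_def)
      have "cfc g h = cfc f h - y *\<^sub>R 1"
        using cfc_lincomb[OF f continuous_on_const[of _ 1], of 1 "- y"] cfc_one
        by (simp add: g_def[abs_def])
      moreover have "cfc g h * cfc (\<lambda>x. inverse (g x)) h = 1"
        "cfc (\<lambda>x. inverse (g x)) h * cfc g h = 1"
        using cfc_mult[OF g gi] cfc_mult[OF gi g] cfc_cong[OF continuous_on_const[of _ 1]] nz
          cfc_one by (auto simp: g_def)
      ultimately have "invertible_elt (cfc f h - y *\<^sub>R 1)" unfolding invertible_elt_def by metis
      then show False using y by (simp add: real_spectrum_iff)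
    qed
  qed
qed

lemma cfc_comp:
  assumes f: "continuous_on {a..b} f" and cd: "\<And>x. x \<in> {a..b} \<Longrightarrow> f x \<in> {c..d}"
    and g: "continuous_on {c..d} g"
  shows "cfc g (cfc f h) = cfc (\<lambda>x. g (f x)) h"
proof -
  interpret f: selfadjoint_interval "cfc f h" c d by (rule selfadjoint_interval_cfc[OF f cd])
  obtain p where p: "uniform_limit {c..d} (\<lambda>n. poly (p n)) g sequentially"
    "(\<lambda>n. peval (p n) (cfc f h)) \<longlonglongrightarrow> cfc g (cfc f h)" using f.cfc_approx[OF g] .
  have gf: "continuous_on {a..b} (\<lambda>x. g (f x))"
    by (rule continuous_on_compose2[OF g f]) (use cd in auto)
  have cont: "continuous_on {a..b} (\<lambda>x. poly q (f x))" for q by (intro continuous_intros f)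
  have poly: "peval q (cfc f h) = cfc (\<lambda>x. poly q (f x)) h" for q
  proof (induction q)
    case 0
    show ?case using cfc_lincomb[OF f f, of 0 0] by simp
  next
    case (pCons c q)
    have "cfc (\<lambda>x. poly (pCons c q) (f x)) h
        = c *\<^sub>R cfc (\<lambda>_. 1) h + 1 *\<^sub>R cfc (\<lambda>x. f x * poly q (f x)) h"
      using cfc_lincomb[of "\<lambda>_. 1" "\<lambda>x. f x * poly q (f x)" c 1]
      by (simp add: continuous_on_mult[OF f cont])
    then show ?case by (simp add: cfc_one cfc_mult[OF f cont] peval_pCons pCons)
  qed
  have "(\<lambda>n. peval (p n) (cfc f h)) \<longlonglongrightarrow> cfc (\<lambda>x. g (f x)) h"
  proof (rule LIMSEQ_I)
    fix r :: real assume "r > 0"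
    then have "\<forall>\<^sub>F n in sequentially. \<forall>y\<in>{c..d}. dist (poly (p n) y) (g y) < r/2"
      using uniform_limitD[OF p(1), of "r/2"] by simp
    then obtain N where N: "\<And>n y. n \<ge> N \<Longrightarrow> y \<in> {c..d} \<Longrightarrow> dist (poly (p n) y) (g y) < r/2"
      unfolding eventually_sequentially by blast
    have "norm (peval (p n) (cfc f h) - cfc (\<lambda>x. g (f x)) h) \<le> r/2" if "n \<ge> N" for n
    proof -
      have "peval (p n) (cfc f h) - cfc (\<lambda>x. g (f x)) h
          = cfc (\<lambda>x. 1 * poly (p n) (f x) + (-1) * g (f x)) h"
        unfolding cfc_lincomb[OF cont gf] poly by simp
      also have "norm \<dots> \<le> r/2"
        by (rule norm_cfc_le, intro continuous_intros cont gf)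
           (use N[OF that] cd in \<open>fastforce simp: dist_real_def\<close>)
      finally show ?thesis .
    qed
    moreover have "r/2 < r" using \<open>r > 0\<close> by simp
    ultimately show "\<exists>no. \<forall>n\<ge>no. norm (peval (p n) (cfc f h) - cfc (\<lambda>x. g (f x)) h) < r"
      by (meson le_less_trans)
  qed
  then show ?thesis using p(2) LIMSEQ_unique by blast
qed

end

section \<open>The trace, absolute values, and the first two Lp-norms\<close>

locale tracial_state =
  fixes E :: "'a::cstar_algebra \<Rightarrow> complex"
  assumes state: "faithful_tracial_state E"
begin

lemma E_add: "E (x + y) = E x + E y"
  and E_cscale: "E (cscale c x) = c * E x"
  and E_square_real: "Im (E (star x * x)) = 0"
  and E_square_nonneg: "0 \<le> Re (E (star x * x))"
  and E_one: "E 1 = 1"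
  and E_commute: "E (x * y) = E (y * x)"
  and E_faithful: "E (star x * x) = 0 \<Longrightarrow> x = 0"
  using state by (auto simp: faithful_tracial_state_def)

lemma E_scaleR: "E (r *\<^sub>R x) = complex_of_real r * E x"
  using E_cscale[of "complex_of_real r" x] by (simp add: cscale_of_real)

lemma E_zero [simp]: "E 0 = 0"
  using E_scaleR[of 0 0] by simp

lemma E_minus: "E (- x) = - E x"
  using E_scaleR[of "-1" x] by simp

lemma E_diff: "E (x - y) = E x - E y"
  using E_add[of x "- y"] by (simp add: E_minus)

lemma E_sum: "E (sum f A) = (\<Sum>i\<in>A. E (f i))"
  by (induction A rule: infinite_finite_induct) (auto simp: E_add)

text \<open>The real numbers \<open>E[(x + z)\<^sup>* (x + z)]\<close> with \<open>z = 1\<close> and \<open>z = i\<close> determine the imaginary and the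
  real part of \<open>E[x\<^sup>*]\<close>.\<close>

lemma E_star: "E (star x) = cnj (E x)"
proof (rule complex_eqI)
  have "star (x + cscale \<i> 1) * (x + cscale \<i> 1)
      = star x * x + cscale \<i> (star x) - cscale \<i> x + 1"
    by (simp add: star_add star_cscale algebra_simps cscale_mult_left cscale_mult_right cscale_cscale
        cscale_add_right cscale_diff_right)
  then show "Re (E (star x)) = Re (cnj (E x))"
    using E_square_real[of "x + cscale \<i> 1"] E_square_real[of x]
    by (simp add: E_add E_diff E_cscale E_one)
  have "star (x + 1) * (x + 1) = star x * x + star x + x + 1"
    by (simp add: star_add algebra_simps)
  then show "Im (E (star x)) = Im (cnj (E x))"
    using E_square_real[of "x + 1"] E_square_real[of x]
    by (simp add: E_add E_one)
qed

definition norm2 :: "'a \<Rightarrow> real" where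
  "norm2 x = sqrt (Re (E (star x * x)))"

lemma norm2_nonneg [simp]: "0 \<le> norm2 x"
  by (simp add: norm2_def E_square_nonneg)

lemma norm2_square: "(norm2 x)\<^sup>2 = Re (E (star x * x))"
  by (simp add: norm2_def E_square_nonneg)

lemma norm2_eq_0: "norm2 x = 0 \<Longrightarrow> x = 0"
  using E_faithful[of x] E_square_real[of x] by (simp add: norm2_def complex_eq_iff)

lemma norm2_zero [simp]: "norm2 0 = 0"
  by (simp add: norm2_def)

lemma norm2_star [simp]: "norm2 (star x) = norm2 x"
  using E_commute[of x "star x"] by (simp add: norm2_def star_star)

lemma norm2_cscale: "norm2 (cscale c x) = cmod c * norm2 x"
proof -
  have "star (cscale c x) * cscale c x = cscale (complex_of_real ((cmod c)\<^sup>2)) (star x * x)"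
    unfolding complex_norm_square
    by (simp add: star_cscale cscale_mult_left cscale_mult_right cscale_cscale mult.commute)
  then show ?thesis
    by (simp add: norm2_def E_cscale real_sqrt_mult del: of_real_power)
qed

lemma norm2_scaleR: "norm2 (r *\<^sub>R x) = \<bar>r\<bar> * norm2 x"
  using norm2_cscale[of "complex_of_real r" x] by (simp add: cscale_of_real)

lemma norm2_minus [simp]: "norm2 (- x) = norm2 x"
  by (simp add: norm2_def)

lemma norm2_add_square:
  "(norm2 (x + y))\<^sup>2 = (norm2 x)\<^sup>2 + 2 * Re (E (star x * y)) + (norm2 y)\<^sup>2"
proof -
  have "Re (E (star y * x)) = Re (E (star x * y))"
    using E_star[of "star x * y"] by (simp add: star_mult star_star)
  then show ?thesis
    by (simp add: norm2_square star_add distrib_left distrib_right E_add)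
qed

lemma Re_Cauchy_Schwarz: "Re (E (star x * y)) \<le> norm2 x * norm2 y"
proof (cases "norm2 x = 0")
  case True
  then have "x = 0" by (rule norm2_eq_0)
  then show ?thesis by simp
next
  case False
  define c where "c = Re (E (star x * y))"
  define r where "r = - c / (norm2 x)\<^sup>2"
  have x: "norm2 x > 0" using False by (simp add: less_le)
  have "0 \<le> (norm2 (r *\<^sub>R x + y))\<^sup>2" by simp
  also have "\<dots> = r\<^sup>2 * (norm2 x)\<^sup>2 + 2 * (r * c) + (norm2 y)\<^sup>2"
    by (simp add: norm2_add_square norm2_scaleR E_scaleR c_def power_mult_distrib)
  also have "\<dots> = (norm2 y)\<^sup>2 - c\<^sup>2 / (norm2 x)\<^sup>2"
    using x by (simp add: r_def field_simps power2_eq_square)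
  finally have "c\<^sup>2 \<le> (norm2 x * norm2 y)\<^sup>2"
    using x by (simp add: field_simps power_mult_distrib)
  then show ?thesis unfolding c_def[symmetric]
    by (rule power2_le_imp_le) simp
qed

text \<open>Rotating \<open>y\<close> by a complex phase makes \<open>E[x\<^sup>* y]\<close> real and nonnegative.\<close>

lemma Cauchy_Schwarz: "cmod (E (star x * y)) \<le> norm2 x * norm2 y"
proof -
  define z where "z = E (star x * y)"
  define c where "c = cnj (sgn z)"
  have "c * z = complex_of_real (cmod z)"
    by (simp add: c_def sgn_div_norm complex_norm_square[symmetric] scaleR_conv_of_real mult.assoc
        mult.commute[of "cnj z"] power2_eq_square field_simps)
  then have "cmod z = Re (E (star x * cscale c y))"
    by (simp add: cscale_mult_right E_cscale z_def[symmetric])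
  also have "\<dots> \<le> norm2 x * norm2 (cscale c y)" by (rule Re_Cauchy_Schwarz)
  also have "\<dots> \<le> norm2 x * norm2 y"
    by (rule mult_left_mono) (auto simp: norm2_cscale c_def norm_sgn)
  finally show ?thesis by (simp add: z_def)
qed

lemma norm2_triangle: "norm2 (x + y) \<le> norm2 x + norm2 y"
proof (rule power2_le_imp_le)
  show "(norm2 (x + y))\<^sup>2 \<le> (norm2 x + norm2 y)\<^sup>2"
    using Re_Cauchy_Schwarz[of x y] by (simp add: norm2_add_square power2_sum)
qed simp

text \<open>For \<open>r > norm (c\<^sup>* c)\<close> the difference \<open>r - c\<^sup>* c\<close> is a square \<open>s\<^sup>2\<close>, so that
  \<open>r E[y\<^sup>* y] - E[(c y)\<^sup>* (c y)] = E[(s y)\<^sup>* (s y)]\<close> is nonnegative.\<close>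

lemma norm2_mult_left: "norm2 (c * y) \<le> norm c * norm2 y"
proof -
  have main: "(norm2 (c * y))\<^sup>2 \<le> r * (norm2 y)\<^sup>2" if r: "(norm c)\<^sup>2 < r" for r
  proof -
    have 1: "star c * c \<in> selfadjoint" by (rule star_square_selfadjoint)
    have 2: "norm (star c * c) < r" using r by (simp add: cstar_identity)
    obtain s where s: "s \<in> selfadjoint" "s * s = r *\<^sub>R 1 - star c * c"
      using selfadjoint_sqrt_diff[OF 1 2] by metis
    have "star (s * y) * (s * y) = star y * (s * s) * y"
      using s(1) by (simp add: star_mult selfadjoint_iff mult.assoc)
    also have "\<dots> = r *\<^sub>R (star y * y) - star (c * y) * (c * y)"
      by (simp add: s(2) star_mult algebra_simps mult.assoc)
    finally show ?thesis
      using E_square_nonneg[of "s * y"] by (simp add: norm2_square E_diff E_scaleR)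
  qed
  have "(norm2 (c * y))\<^sup>2 \<le> (norm c)\<^sup>2 * (norm2 y)\<^sup>2"
    by (rule le_at_right_limit[of "\<lambda>r. r * (norm2 y)\<^sup>2"]) (intro tendsto_intros main)+
  then have "(norm2 (c * y))\<^sup>2 \<le> (norm c * norm2 y)\<^sup>2" by (simp add: power_mult_distrib)
  then show ?thesis by (rule power2_le_imp_le) simp
qed

lemma norm2_one: "norm2 1 = 1"
  by (simp add: norm2_def E_one)

lemma norm2_le_norm: "norm2 x \<le> norm x"
  using norm2_mult_left[of x 1] by (simp add: norm2_one)

lemma norm_E_le: "cmod (E x) \<le> norm x"
  using Cauchy_Schwarz[of 1 x] norm2_le_norm[of x] by (simp add: norm2_one)

text \<open>A nonnegative function of \<open>h\<close> is the square of its self-adjoint square root.\<close>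

lemma E_cfc_mono:
  assumes "selfadjoint_interval h a b"
    and f: "continuous_on {a..b} f" and g: "continuous_on {a..b} g"
    and le: "\<And>x. x \<in> {a..b} \<Longrightarrow> f x \<le> g x"
  shows "Re (E (cfc f h)) \<le> Re (E (cfc g h))"
proof -
  interpret selfadjoint_interval h a b by fact
  define d where "d x = 1 * g x + (-1) * f x" for x
  define s where "s x = sqrt (d x)" for x
  have d: "continuous_on {a..b} d" unfolding d_def by (intro continuous_intros f g)
  have s: "continuous_on {a..b} s" unfolding s_def by (intro continuous_intros d)
  have "cfc d h = cfc s h * cfc s h"
    unfolding cfc_mult[OF s s, symmetric]
    by (rule cfc_cong[OF d]) (use le in \<open>auto simp: s_def d_def\<close>)
  also have "\<dots> = star (cfc s h) * cfc s h"
    using cfc_selfadjoint[OF s] by (simp add: selfadjoint_iff)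
  finally have "0 \<le> Re (E (cfc d h))" by (simp add: E_square_nonneg)
  then show ?thesis
    using cfc_lincomb[OF g f, of 1 "-1"] by (simp add: d_def[abs_def] E_diff)
qed

text \<open>Let \<open>w\<close> be the negative part of \<open>h = a\<^sup>* a\<close>. Then \<open>(a w)\<^sup>* (a w) = w h w = - w\<^sup>3\<close> has both a
  nonnegative and a nonpositive trace, and faithfulness yields \<open>w = 0\<close>.\<close>

lemma selfadjoint_interval_star_square:
  fixes a :: 'a
  shows "selfadjoint_interval (star a * a) 0 ((norm a)\<^sup>2)"
proof -
  define h where "h = star a * a"
  define c where "c = norm h"
  interpret selfadjoint_interval h "- c" c
  proof
    show "h \<in> selfadjoint" by (simp add: h_def star_square_selfadjoint)
    show "real_spectrum h \<subseteq> {- c..c}"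
      using real_spectrum_bound[of _ h] by (fastforce simp: c_def)
  qed
  define w where "w x = max (- x) (0::real)" for x
  define v where "v x = w x * sqrt (w x)" for x
  have w: "continuous_on {- c..c} w" unfolding w_def by (intro continuous_intros)
  have v: "continuous_on {- c..c} v" unfolding v_def by (intro continuous_intros w)
  have id: "continuous_on {- c..c} (\<lambda>x. x::real)" by (intro continuous_intros)
  have sw: "star (cfc w h) = cfc w h" and sv: "star (cfc v h) = cfc v h"
    using cfc_selfadjoint w v by (auto simp: selfadjoint_iff)
  have vv: "cfc (\<lambda>x. v x * v x) h = cfc v h * cfc v h" by (rule cfc_mult[OF v v])
  have "star (a * cfc w h) * (a * cfc w h) = cfc w h * (h * cfc w h)"
    by (simp add: star_mult sw mult.assoc) (simp add: h_def mult.assoc)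
  also have "\<dots> = cfc (\<lambda>x. w x * (x * w x)) h"
    using cfc_mult[OF id w] cfc_mult[OF w continuous_on_mult[OF id w]] cfc_id by simp
  also have "\<dots> = cfc (\<lambda>x. (-1) * (v x * v x) + 0 * v x) h"
  proof (rule cfc_cong)
    show "continuous_on {- c..c} (\<lambda>x. w x * (x * w x))" by (intro continuous_intros w)
    fix x :: real
    have "sqrt (w x) * sqrt (w x) = w x" by (simp add: w_def)
    then have "v x * v x = w x * w x * w x" unfolding v_def by (metis mult.assoc mult.commute)
    moreover have "w x * x = - (w x * w x)" by (simp add: w_def max_def)
    then have "w x * (x * w x) = - (w x * w x * w x)"
      by (metis mult.assoc mult.commute mult_minus_left)
    ultimately show "w x * (x * w x) = (-1) * (v x * v x) + 0 * v x" by simp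
  qed
  also have "\<dots> = (-1) *\<^sub>R (star (cfc v h) * cfc v h)"
    using cfc_lincomb[OF continuous_on_mult[OF v v] v, of "-1" 0] by (simp add: vv sv)
  finally have "Re (E (star (cfc v h) * cfc v h)) \<le> 0"
    using E_square_nonneg[of "a * cfc w h"] by (simp add: E_minus)
  then have "cfc v h = 0"
    using E_square_nonneg[of "cfc v h"] E_square_real[of "cfc v h"]
    by (intro E_faithful) (auto simp: complex_eq_iff)
  then have v0: "v x = 0" if "x \<in> real_spectrum h" for x
    using abs_le_norm_cfc[OF v that] by simp
  show ?thesis unfolding h_def[symmetric]
  proof
    show "h \<in> selfadjoint" by (rule sa)
    show "real_spectrum h \<subseteq> {0..(norm a)\<^sup>2}"
    proof
      fix x assume x: "x \<in> real_spectrum h"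
      have "0 \<le> x"
      proof (rule ccontr)
        assume "\<not> 0 \<le> x"
        then have "v x > 0" by (simp add: v_def w_def mult_neg_pos)
        then show False using v0[OF x] by simp
      qed
      moreover have "x \<le> (norm a)\<^sup>2"
        using real_spectrum_bound[OF x] cstar_identity[of a] by (simp add: h_def)
      ultimately show "x \<in> {0..(norm a)\<^sup>2}" by simp
    qed
  qed
qed

lemma cabs_powr_eq_cfc:
  fixes a :: 'a
  assumes r: "r > 0"
  shows "cabs_powr a r = cfc (\<lambda>x. sqrt x powr r) (star a * a)"
proof -
  interpret selfadjoint_interval "star a * a" 0 "(norm a)\<^sup>2"
    by (rule selfadjoint_interval_star_square)
  show ?thesis unfolding cabs_powr_def cabs_def
  proof (rule cfc_comp)
    show "continuous_on {0..(norm a)\<^sup>2} sqrt" by (intro continuous_intros)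
    show "sqrt x \<in> {0..norm a}" if "x \<in> {0..(norm a)\<^sup>2}" for x
      using that real_le_lsqrt by auto
    show "continuous_on {0..norm a} (\<lambda>x. x powr r)"
      using r by (intro continuous_on_powr' continuous_intros) auto
  qed
qed

lemma continuous_on_sqrt_powr:
  "r > 0 \<Longrightarrow> continuous_on {0..c} (\<lambda>x::real. sqrt x powr r)"
  by (intro continuous_on_powr' continuous_intros) auto

lemma pnorm_eq_cfc:
  assumes "1 \<le> p" "p < top"
  shows "pnorm E p a = Re (E (cfc (\<lambda>x. sqrt x powr enn2real p) (star a * a))) powr (1 / enn2real p)"
    and "1 \<le> enn2real p"
proof -
  show r: "1 \<le> enn2real p"
    using enn2real_mono[of 1 p] assms by simp
  then show "pnorm E p a
      = Re (E (cfc (\<lambda>x. sqrt x powr enn2real p) (star a * a))) powr (1 / enn2real p)"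
    using assms by (simp add: pnorm_def cabs_powr_eq_cfc)
qed

lemma pnorm_2: "pnorm E 2 = norm2"
proof
  fix a :: 'a
  interpret selfadjoint_interval "star a * a" 0 "(norm a)\<^sup>2"
    by (rule selfadjoint_interval_star_square)
  have "cfc (\<lambda>x. sqrt x powr 2) (star a * a) = cfc (\<lambda>x. x) (star a * a)"
    by (rule cfc_cong, rule continuous_on_sqrt_powr)
       (auto simp: powr_numeral power2_eq_square)
  then have "cabs_powr a 2 = star a * a" by (simp add: cabs_powr_eq_cfc cfc_id)
  then show "pnorm E 2 a = norm2 a"
    by (simp add: pnorm_def norm2_def powr_half_sqrt E_square_nonneg)
qed

definition norm1 :: "'a \<Rightarrow> real" where
  "norm1 a = Re (E (cfc sqrt (star a * a)))"

lemma norm1_nonneg [simp]: "0 \<le> norm1 a"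
proof -
  interpret selfadjoint_interval "star a * a" 0 "(norm a)\<^sup>2"
    by (rule selfadjoint_interval_star_square)
  have c0: "cfc (\<lambda>_. 0) (star a * a) = 0"
    using cfc_lincomb[of "\<lambda>_. 1" "\<lambda>_. 1" 0 0] by simp
  have "Re (E (cfc (\<lambda>_. 0) (star a * a))) \<le> Re (E (cfc sqrt (star a * a)))"
    by (rule E_cfc_mono[OF selfadjoint_interval_star_square]) (auto intro!: continuous_intros)
  then show ?thesis by (simp add: norm1_def c0)
qed

lemma pnorm_1: "pnorm E 1 = norm1"
proof
  fix a :: 'a
  interpret selfadjoint_interval "star a * a" 0 "(norm a)\<^sup>2"
    by (rule selfadjoint_interval_star_square)
  have "cfc (\<lambda>x. sqrt x powr 1) (star a * a) = cfc sqrt (star a * a)"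
    by (rule cfc_cong, rule continuous_on_sqrt_powr) auto
  then show "pnorm E 1 a = norm1 a"
    using norm1_nonneg[of a] by (simp add: pnorm_def cabs_powr_eq_cfc norm1_def)
qed

lemma norm1_minus [simp]: "norm1 (- a) = norm1 a"
  by (simp add: norm1_def)

text \<open>The error made by replacing \<open>h\<^bsup>1/2\<^esup>\<close> by \<open>h (h + e)\<^bsup>-1/2\<^esup>\<close>.\<close>

lemma sqrt_regularisation:
  fixes x e :: real
  assumes x: "0 \<le> x" and e: "0 < e"
  shows "0 \<le> sqrt x - x / sqrt (x + e)" "sqrt x - x / sqrt (x + e) \<le> sqrt e"
proof -
  have s: "sqrt (x + e) > 0" using x e by simp
  have le: "sqrt x \<le> sqrt (x + e)" using e by simp
  have eq: "sqrt x - x / sqrt (x + e) = sqrt x / sqrt (x + e) * (sqrt (x + e) - sqrt x)"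
  proof -
    have "sqrt x * sqrt x = x" using x by simp
    then show ?thesis using s by (simp add: field_simps)
  qed
  have q: "0 \<le> sqrt x / sqrt (x + e)" "sqrt x / sqrt (x + e) \<le> 1"
    using s le x by (auto simp: divide_le_eq)
  show "0 \<le> sqrt x - x / sqrt (x + e)" unfolding eq using q(1) le by (intro mult_nonneg_nonneg) auto
  have "sqrt x / sqrt (x + e) * (sqrt (x + e) - sqrt x) \<le> 1 * (sqrt (x + e) - sqrt x)"
    by (rule mult_right_mono) (use q le in auto)
  also have "\<dots> \<le> sqrt e" using sqrt_add_le_add_sqrt[of x e] x e by simp
  finally show "sqrt x - x / sqrt (x + e) \<le> sqrt e" unfolding eq .
qed

text \<open>An approximate polar decomposition: the contraction \<open>u = a (a\<^sup>* a + e)\<^bsup>-1/2\<^esup>\<close> plays the role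
  of the partial isometry, which need not belong to the algebra.\<close>

lemma approximate_polar_decomposition:
  assumes e: "0 < e"
  obtains u where "norm u \<le> 1" "norm (a - u * cfc sqrt (star a * a)) \<le> sqrt e"
    "norm1 a \<le> Re (E (star u * a)) + sqrt e"
proof -
  define h where "h = star a * a"
  define c where "c = (norm a)\<^sup>2"
  have si: "selfadjoint_interval h 0 c"
    unfolding h_def c_def by (rule selfadjoint_interval_star_square)
  interpret selfadjoint_interval h 0 c by (rule si)
  define g where "g x = 1 / sqrt (x + e)" for x
  have g: "continuous_on {0..c} g"
    unfolding g_def using e by (intro continuous_intros) auto
  have id: "continuous_on {0..c} (\<lambda>x. x::real)" by (intro continuous_intros)
  have sq: "continuous_on {0..c} sqrt" by (intro continuous_intros)
  have sg: "star (cfc g h) = cfc g h" using cfc_selfadjoint[OF g] by (simp add: selfadjoint_iff)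
  define u where "u = a * cfc g h"
  have hg: "cfc (\<lambda>x. x * g x) h = h * cfc g h"
    using cfc_mult[OF id g] cfc_id by simp
  have gh: "cfc (\<lambda>x. g x * x) h = cfc g h * h"
    using cfc_mult[OF g id] cfc_id by simp
  have "star u * u = cfc g h * (h * cfc g h)"
    by (simp add: u_def star_mult sg mult.assoc) (simp add: h_def mult.assoc)
  also have "\<dots> = cfc (\<lambda>x. g x * (x * g x)) h"
    using cfc_mult[OF g continuous_on_mult[OF id g]] hg by simp
  also have "norm \<dots> \<le> 1"
  proof (rule norm_cfc_le)
    show "continuous_on {0..c} (\<lambda>x. g x * (x * g x))" by (intro continuous_intros g)
    fix x assume x: "x \<in> {0..c}"
    then have "g x * (x * g x) = x / (x + e)" using e by (simp add: g_def)
    then show "\<bar>g x * (x * g x)\<bar> \<le> 1" using x e by simp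
  qed
  finally have "(norm u)\<^sup>2 \<le> 1\<^sup>2" by (simp add: cstar_identity)
  then have u1: "norm u \<le> 1" by (rule power2_le_imp_le) simp
  define k where "k x = 1 * 1 + (-1) * (g x * sqrt x)" for x
  have k: "continuous_on {0..c} k" unfolding k_def by (intro continuous_intros g)
  have ck: "cfc k h = 1 - cfc g h * cfc sqrt h"
    using cfc_lincomb[OF continuous_on_const[of _ 1] continuous_on_mult[OF g sq], of 1 "-1"]
    by (simp add: k_def[abs_def] cfc_one cfc_mult[OF g sq])
  have sk: "star (cfc k h) = cfc k h" using cfc_selfadjoint[OF k] by (simp add: selfadjoint_iff)
  define d where "d = a - u * cfc sqrt h"
  have "d = a * cfc k h" by (simp add: d_def u_def ck algebra_simps mult.assoc)
  then have "star d * d = cfc k h * (h * cfc k h)"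
    by (simp add: star_mult sk mult.assoc) (simp add: h_def mult.assoc)
  also have "\<dots> = cfc (\<lambda>x. k x * (x * k x)) h"
    using cfc_mult[OF k continuous_on_mult[OF id k]] cfc_mult[OF id k] cfc_id by simp
  also have "norm \<dots> \<le> (sqrt e)\<^sup>2"
  proof (rule norm_cfc_le)
    show "continuous_on {0..c} (\<lambda>x. k x * (x * k x))" by (intro continuous_intros k)
    fix x assume x: "x \<in> {0..c}"
    have sx: "sqrt x * sqrt x = x" using x by simp
    have "k x * (x * k x) = (sqrt x * k x)\<^sup>2" using x by (simp add: power2_eq_square)
    moreover have "sqrt x * k x = sqrt x - x / sqrt (x + e)"
      using x by (simp add: k_def g_def right_diff_distrib sx)
    ultimately have "k x * (x * k x) = (sqrt x - x / sqrt (x + e))\<^sup>2" by simp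
    then show "\<bar>k x * (x * k x)\<bar> \<le> (sqrt e)\<^sup>2"
      using sqrt_regularisation[of x e] x e by (simp add: power_mono del: real_sqrt_pow2 real_sqrt_pow2_iff)
  qed
  finally have "(norm d)\<^sup>2 \<le> (sqrt e)\<^sup>2" by (simp only: cstar_identity)
  then have u2: "norm d \<le> sqrt e" by (rule power2_le_imp_le) (use e in simp)
  have "star u * a = cfc (\<lambda>x. g x * x) h"
    by (simp add: u_def star_mult sg gh mult.assoc) (simp add: h_def mult.assoc)
  moreover have "Re (E (cfc sqrt h)) \<le> Re (E (cfc (\<lambda>x. 1 * (g x * x) + sqrt e * 1) h))"
  proof (rule E_cfc_mono[OF si sq])
    show "continuous_on {0..c} (\<lambda>x. 1 * (g x * x) + sqrt e * 1)" by (intro continuous_intros g)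
    show "sqrt x \<le> 1 * (g x * x) + sqrt e * 1" if "x \<in> {0..c}" for x
      using sqrt_regularisation(2)[of x e] that e by (auto simp: g_def)
  qed
  moreover have "cfc (\<lambda>x. 1 * (g x * x) + sqrt e * 1) h
      = cfc (\<lambda>x. g x * x) h + sqrt e *\<^sub>R 1"
    using cfc_lincomb[OF continuous_on_mult[OF g id] continuous_on_const[of _ 1], of 1 "sqrt e"]
    by (simp add: cfc_one)
  ultimately have u3: "norm1 a \<le> Re (E (star u * a)) + sqrt e"
    by (simp add: norm1_def h_def[symmetric] E_add E_scaleR E_one)
  show ?thesis using that[OF u1 _ u3] u2 by (simp add: d_def h_def)
qed

lemma norm1_dual_attained:
  assumes "0 < e" obtains b where "norm b \<le> 1" "norm1 a \<le> Re (E (b * a)) + e"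
proof -
  have "0 < e\<^sup>2" using assms by simp
  then obtain u where "norm u \<le> 1" "norm1 a \<le> Re (E (star u * a)) + sqrt (e\<^sup>2)"
    using approximate_polar_decomposition by metis
  then show ?thesis using that[of "star u"] assms by simp
qed

text \<open>With \<open>a\<close> close to \<open>u |a|\<close> and \<open>|a| = l\<^sup>2\<close>, the trace of \<open>b u |a|\<close> is that of \<open>l (b u l)\<close>.\<close>

lemma norm_E_mult_le: "cmod (E (b * a)) \<le> norm b * norm1 a"
proof -
  have main: "cmod (E (b * a)) \<le> norm b * norm1 a + norm b * e" if e: "e > 0" for e
  proof -
    have "0 < e\<^sup>2" using e by simp
    then obtain u where u: "norm u \<le> 1" "norm (a - u * cfc sqrt (star a * a)) \<le> sqrt (e\<^sup>2)"
      using approximate_polar_decomposition by metis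
    define h where "h = star a * a"
    interpret selfadjoint_interval h 0 "(norm a)\<^sup>2"
      unfolding h_def by (rule selfadjoint_interval_star_square)
    define r where "r x = sqrt (sqrt x)" for x
    have r: "continuous_on {0..(norm a)\<^sup>2} r" unfolding r_def by (intro continuous_intros)
    have sq: "continuous_on {0..(norm a)\<^sup>2} sqrt" by (intro continuous_intros)
    define l where "l = cfc r h"
    have sl: "star l = l" using cfc_selfadjoint[OF r] by (simp add: selfadjoint_iff l_def)
    have ll: "cfc sqrt h = l * l"
      unfolding l_def cfc_mult[OF r r, symmetric]
      by (rule cfc_cong[OF sq]) (auto simp: r_def)
    have n1: "norm1 a = (norm2 l)\<^sup>2"
      by (simp add: norm1_def norm2_square sl ll flip: h_def)
    have "E (b * u * (l * l)) = E (star l * (b * u * l))"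
      using E_commute[of "b * u * l" l] by (simp add: sl mult.assoc)
    then have "cmod (E (b * u * (l * l))) \<le> norm2 l * norm2 (b * u * l)"
      using Cauchy_Schwarz[of l "b * u * l"] by simp
    also have "\<dots> \<le> norm2 l * (norm (b * u) * norm2 l)"
      by (intro mult_left_mono norm2_mult_left) simp
    also have "\<dots> = norm (b * u) * norm1 a" by (simp add: n1 power2_eq_square)
    also have "\<dots> \<le> norm b * norm1 a"
    proof (rule mult_right_mono)
      have "norm (b * u) \<le> norm b * norm u" by (rule norm_mult_ineq)
      also have "\<dots> \<le> norm b * 1" by (rule mult_left_mono[OF u(1)]) simp
      finally show "norm (b * u) \<le> norm b" by simp
    qed simp
    finally have 1: "cmod (E (b * u * (l * l))) \<le> norm b * norm1 a" .
    have "cmod (E (b * (a - u * (l * l)))) \<le> norm (b * (a - u * (l * l)))" by (rule norm_E_le)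
    also have "\<dots> \<le> norm b * norm (a - u * (l * l))" by (rule norm_mult_ineq)
    also have "\<dots> \<le> norm b * e"
      using u(2) e by (intro mult_left_mono) (auto simp: ll h_def[symmetric])
    finally have 2: "cmod (E (b * (a - u * (l * l)))) \<le> norm b * e" .
    have "E (b * a) = E (b * u * (l * l)) + E (b * (a - u * (l * l)))"
      by (simp add: E_add[symmetric] algebra_simps mult.assoc)
    then show ?thesis using 1 2 norm_triangle_ineq by (smt (verit))
  qed
  have "cmod (E (b * a)) \<le> norm b * norm1 a + norm b * 0"
    by (rule le_at_right_limit[of "\<lambda>e. norm b * norm1 a + norm b * e"]) (intro tendsto_intros main)+
  then show ?thesis by simp
qed

text \<open>Together with \<open>Re_E_mult_le\<close> this says that \<open>norm1 a\<close> is the supremum of \<open>Re E[b a]\<close> over the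
  unit ball; subadditivity and homogeneity of the 1-norm are read off from it.\<close>

lemma norm1_leI:
  assumes "\<And>b. norm b \<le> 1 \<Longrightarrow> Re (E (b * a)) \<le> M"
  shows "norm1 a \<le> M"
proof (rule field_le_epsilon)
  fix e :: real assume "e > 0"
  then obtain b where "norm b \<le> 1" "norm1 a \<le> Re (E (b * a)) + e" using norm1_dual_attained by metis
  then show "norm1 a \<le> M + e" using assms[of b] by simp
qed

lemma Re_E_mult_le: "norm b \<le> 1 \<Longrightarrow> Re (E (b * a)) \<le> norm1 a"
proof -
  assume b: "norm b \<le> 1"
  have "Re (E (b * a)) \<le> norm b * norm1 a"
    using complex_Re_le_cmod norm_E_mult_le order_trans by blast
  also have "\<dots> \<le> 1 * norm1 a" by (rule mult_right_mono[OF b]) simp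
  finally show ?thesis by simp
qed

lemma norm1_triangle: "norm1 (x + y) \<le> norm1 x + norm1 y"
  by (rule norm1_leI) (auto simp: distrib_left E_add intro!: add_mono Re_E_mult_le)

lemma norm1_scaleR_le: "norm1 (r *\<^sub>R x) \<le> \<bar>r\<bar> * norm1 x"
proof (rule norm1_leI)
  fix b :: 'a assume b: "norm b \<le> 1"
  have "Re (E (b * r *\<^sub>R x)) \<le> \<bar>r * Re (E (b * x))\<bar>" by (simp add: E_scaleR)
  also have "\<dots> \<le> \<bar>r\<bar> * norm1 x"
    unfolding abs_mult using Re_E_mult_le[OF b, of x] Re_E_mult_le[of "- b" x] b
    by (intro mult_left_mono) (auto simp: E_minus abs_le_iff)
  finally show "Re (E (b * r *\<^sub>R x)) \<le> \<bar>r\<bar> * norm1 x" .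
qed

lemma norm1_le_norm2: "norm1 x \<le> norm2 x"
proof (rule norm1_leI)
  fix b :: 'a assume b: "norm b \<le> 1"
  have "Re (E (b * x)) \<le> norm2 b * norm2 x"
    using Re_Cauchy_Schwarz[of "star b" x] by (simp add: star_star)
  also have "\<dots> \<le> 1 * norm2 x"
    using norm2_le_norm[of b] b by (intro mult_right_mono) auto
  finally show "Re (E (b * x)) \<le> norm2 x" by simp
qed

lemma norm1_le_norm: "norm1 x \<le> norm x"
  using norm1_le_norm2 norm2_le_norm order_trans by blast

lemma norm1_zero [simp]: "norm1 0 = 0"
  using norm1_le_norm[of 0] norm1_nonneg[of 0] by simp

text \<open>Jensen's inequality for the state: the tangent of \<open>y\<^sup>r\<close> at \<open>norm1 a\<close> lies below the power.\<close>

lemma norm1_le_pnorm: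
  assumes p: "1 \<le> p" "p < top"
  shows "norm1 a \<le> pnorm E p a"
proof (cases "norm1 a = 0")
  case True
  then show ?thesis by (simp add: pnorm_eq_cfc[OF p])
next
  case False
  define m where "m = norm1 a"
  have m: "m > 0" using False by (simp add: m_def less_le)
  define r where "r = enn2real p"
  have r: "1 \<le> r" using pnorm_eq_cfc(2)[OF p] by (simp add: r_def)
  define h where "h = star a * a"
  define c where "c = (norm a)\<^sup>2"
  have si: "selfadjoint_interval h 0 c"
    unfolding h_def c_def by (rule selfadjoint_interval_star_square)
  interpret selfadjoint_interval h 0 c by (rule si)
  have sq: "continuous_on {0..c} sqrt" by (intro continuous_intros)
  define A B where "A = m powr r * (1 - r)" and "B = r * m powr (r - 1)"
  have tangent: "A + B * y \<le> y powr r" if y: "0 \<le> y" for y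
  proof -
    define z where "z = y / m"
    have z: "0 \<le> z" "y = m * z" using y m by (auto simp: z_def)
    have "r * z \<le> z powr r + r - 1"
    proof (cases "r = 1 \<or> z = 0")
      case False
      then have r1: "r > 1" and z0: "z > 0" using r z(1) by auto
      have "(z powr r) powr (1/r) * 1 powr (1 - 1/r) \<le> (1/r) * z powr r + (1 - 1/r) * 1"
        by (rule Youngs_inequality_0) (use r1 z0 in auto)
      moreover have "(z powr r) powr (1/r) = z"
        using r1 z0 by (simp add: powr_powr)
      ultimately have "z \<le> (1/r) * z powr r + (1 - 1/r)" by simp
      then have "r * z \<le> r * ((1/r) * z powr r + (1 - 1/r))" using r1 by (intro mult_left_mono) auto
      also have "\<dots> = z powr r + r - 1" using r1 by (simp add: field_simps)
      finally show ?thesis .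
    qed (use z r in auto)
    then have "m powr r * (r * z) \<le> m powr r * (z powr r + r - 1)"
      by (intro mult_left_mono) auto
    moreover have "m powr r = m powr (r - 1) * m"
      using m powr_add[of m "r - 1" 1] by simp
    ultimately show ?thesis
      using m z by (simp add: A_def B_def powr_mult algebra_simps)
  qed
  have "Re (E (cfc (\<lambda>x. A * 1 + B * sqrt x) h)) \<le> Re (E (cfc (\<lambda>x. sqrt x powr r) h))"
  proof (rule E_cfc_mono[OF si])
    show "continuous_on {0..c} (\<lambda>x. A * 1 + B * sqrt x)" by (intro continuous_intros)
    show "continuous_on {0..c} (\<lambda>x. sqrt x powr r)" using r by (intro continuous_on_sqrt_powr) simp
  qed (use tangent in auto)
  moreover have "Re (E (cfc (\<lambda>x. A * 1 + B * sqrt x) h)) = A + B * m"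
    using cfc_lincomb[OF continuous_on_const[of _ 1] sq, of A B]
    by (simp add: cfc_one E_add E_scaleR E_one m_def norm1_def flip: h_def)
  moreover have "A + B * m = m powr r"
    using m powr_add[of m "r - 1" 1] by (simp add: A_def B_def algebra_simps)
  ultimately have "m powr r \<le> Re (E (cfc (\<lambda>x. sqrt x powr r) h))" by simp
  then have "(m powr r) powr (1/r) \<le> Re (E (cfc (\<lambda>x. sqrt x powr r) h)) powr (1/r)"
    using r by (intro powr_mono2) auto
  moreover have "(m powr r) powr (1/r) = m" using m r by (simp add: powr_powr)
  ultimately show ?thesis by (simp add: pnorm_eq_cfc[OF p] m_def r_def h_def)
qed

lemma pnorm_zero:
  assumes p: "1 \<le> p" "p < top" shows "pnorm E p 0 = 0"
proof -
  interpret selfadjoint_interval "0::'a" 0 0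
    using selfadjoint_interval_star_square[of 0] by simp
  have "norm (cfc (\<lambda>x. sqrt x powr enn2real p) (0::'a)) \<le> 0"
  proof (rule norm_cfc_le)
    show "continuous_on {0..0} (\<lambda>x. sqrt x powr enn2real p)"
      using pnorm_eq_cfc(2)[OF p] by (intro continuous_on_sqrt_powr) simp
  qed auto
  then show ?thesis by (simp add: pnorm_eq_cfc[OF p])
qed

end

section \<open>Lp-spaces as classes of Cauchy sequences\<close>

lemma tendsto_zero_bound:
  fixes f g :: "nat \<Rightarrow> real"
  assumes "\<And>n. 0 \<le> f n" "\<And>n. f n \<le> g n" "g \<longlonglongrightarrow> 0" shows "f \<longlonglongrightarrow> 0"
  by (rule tendsto_sandwich[OF _ _ tendsto_const assms(3)]) (simp_all add: assms)

text \<open>A chosen representative of a class stays asymptotically close to the sequence that generates the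
  class, for every exponent at which 0 has p-norm 0.\<close>

lemma rep_pclass:
  assumes "pnorm E p 0 = 0"
  shows "(\<lambda>n. pnorm E p (rep (pclass E p s) n - s n)) \<longlonglongrightarrow> 0"
proof -
  have "s \<in> pclass E p s" using assms by (simp add: pclass_def)
  then have "rep (pclass E p s) \<in> pclass E p s" unfolding rep_def by (rule someI[where P = "\<lambda>r. r \<in> pclass E p s"])
  then show ?thesis by (simp add: pclass_def)
qed

text \<open>The common properties of the two exponents, 1 and 2, for which the p-norm is shown to be a
  seminorm.\<close>

locale Lp_seminorm =
  fixes E :: "'a::cstar_algebra \<Rightarrow> complex" and p :: ennreal and N :: "'a \<Rightarrow> real"
  assumes N_eq: "pnorm E p = N"
    and N_nonneg: "0 \<le> N x"
    and N_zero: "N 0 = 0"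
    and N_minus: "N (- x) = N x"
    and N_triangle: "N (x + y) \<le> N x + N y"
begin

lemma N_diff_commute: "N (x - y) = N (y - x)"
  using N_minus[of "x - y"] by simp

lemma N_diff_triangle: "N (x - z) \<le> N (x - y) + N (y - z)"
  using N_triangle[of "x - y" "y - z"] by simp

lemma abs_N_diff_le: "\<bar>N x - N y\<bar> \<le> N (x - y)"
  using N_triangle[of "x - y" y] N_triangle[of "y - x" x] N_diff_commute[of x y] by simp

lemma rep_tendsto: "(\<lambda>n. N (rep (pclass E p s) n - s n)) \<longlonglongrightarrow> 0"
  using rep_pclass[of E p s] by (simp add: N_eq N_zero)

lemma pclass_eqI:
  assumes "(\<lambda>n. N (s n - s' n)) \<longlonglongrightarrow> 0"
  shows "pclass E p s = pclass E p s'"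
proof -
  have *: "(\<lambda>n. N (r n - s2 n)) \<longlonglongrightarrow> 0"
    if "(\<lambda>n. N (r n - s1 n)) \<longlonglongrightarrow> 0" "(\<lambda>n. N (s1 n - s2 n)) \<longlonglongrightarrow> 0" for r s1 s2
    by (rule tendsto_zero_bound[OF _ _ tendsto_add_zero[OF that]])
       (simp_all add: N_nonneg N_diff_triangle)
  show ?thesis unfolding pclass_def N_eq
    using *[of _ s s'] *[of _ s' s] assms by (auto simp: N_diff_commute[of "s _" "s' _"])
qed

text \<open>The distance in the completion is a limit of distances in the algebra, so an eventual bound
  on the latter along a representing sequence suffices.\<close>

lemma Lp_tendstoI:
  assumes cauchy: "pCauchy E p s"
    and bound: "\<And>e. e > 0 \<Longrightarrow> \<forall>\<^sub>F i in G. \<forall>\<^sub>F n in sequentially. N (f i - s n) \<le> e"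
  shows "Lp_tendsto E p f (pclass E p s) G"
  unfolding Lp_tendsto_def
proof (intro conjI tendstoI)
  show "pclass E p s \<in> Lp E p UNIV" using cauchy by (auto simp: Lp_def)
  have dist: "0 \<le> Lp_dist E p (Lp_of E p a) (pclass E p s) \<and>
      Lp_dist E p (Lp_of E p a) (pclass E p s) \<le> e"
    if ev: "\<forall>\<^sub>F n in sequentially. N (a - s n) \<le> e" for a e
  proof -
    define x where "x = pclass E p s"
    have "Cauchy (\<lambda>n. N (a - s n))"
    proof (rule metric_CauchyI)
      fix r :: real assume "r > 0"
      then obtain M where M: "\<And>m n. m \<ge> M \<Longrightarrow> n \<ge> M \<Longrightarrow> N (s m - s n) < r"
        using cauchy unfolding pCauchy_def N_eq by metis
      have "dist (N (a - s m)) (N (a - s n)) < r" if "m \<ge> M" "n \<ge> M" for m n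
        using abs_N_diff_le[of "a - s m" "a - s n"] M[OF that(2,1)] by (simp add: dist_real_def)
      then show "\<exists>M. \<forall>m\<ge>M. \<forall>n\<ge>M. dist (N (a - s m)) (N (a - s n)) < r" by blast
    qed
    then obtain L where L: "(\<lambda>n. N (a - s n)) \<longlonglongrightarrow> L"
      using Cauchy_convergent_iff convergent_def by blast
    have "(\<lambda>n. N (rep (Lp_of E p a) n - rep x n) - N (a - s n)) \<longlonglongrightarrow> 0"
    proof (rule tendsto_rabs_zero_cancel, rule tendsto_zero_bound)
      show "(\<lambda>n. N (rep (Lp_of E p a) n - a) + N (rep x n - s n)) \<longlonglongrightarrow> 0"
        unfolding Lp_of_def x_def by (rule tendsto_add_zero) (rule rep_tendsto)+
      show "\<bar>N (rep (Lp_of E p a) n - rep x n) - N (a - s n)\<bar>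
          \<le> N (rep (Lp_of E p a) n - a) + N (rep x n - s n)" for n
        using abs_N_diff_le[of "rep (Lp_of E p a) n - rep x n" "a - s n"]
          N_triangle[of "rep (Lp_of E p a) n - a" "- (rep x n - s n)"] N_minus[of "rep x n - s n"]
        by (simp add: algebra_simps)
    qed simp
    from tendsto_add[OF this L]
    have "(\<lambda>n. N (rep (Lp_of E p a) n - rep x n)) \<longlonglongrightarrow> L" by simp
    then have eq: "Lp_dist E p (Lp_of E p a) x = L"
      unfolding Lp_dist_def N_eq by (rule limI)
    have "0 \<le> L" by (rule tendsto_lowerbound[OF L]) (simp_all add: N_nonneg)
    moreover have "L \<le> e" by (rule tendsto_upperbound[OF L ev]) simp
    ultimately show ?thesis using eq by (simp add: x_def)
  qed
  fix e :: real assume "e > 0"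
  then have "\<forall>\<^sub>F i in G. \<forall>\<^sub>F n in sequentially. N (f i - s n) \<le> e/2" by (intro bound) simp
  then show "\<forall>\<^sub>F i in G. dist (Lp_dist E p (Lp_of E p (f i)) (pclass E p s)) 0 < e"
  proof eventually_elim
    case (elim i)
    then show ?case using dist[OF elim] \<open>e > 0\<close> by simp
  qed
qed

end

context tracial_state
begin

sublocale L1: Lp_seminorm E 1 norm1
  by unfold_locales (simp_all add: pnorm_1 norm1_triangle)

sublocale L2: Lp_seminorm E 2 norm2
  by unfold_locales (simp_all add: pnorm_2 norm2_triangle)

lemma norm1_tendsto_of_pnorm:
  assumes p: "1 \<le> p" "p < top" and s: "(\<lambda>n. pnorm E p (s' n - s n)) \<longlonglongrightarrow> 0"
  shows "(\<lambda>n. norm1 (s' n - s n)) \<longlonglongrightarrow> 0"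
  by (rule tendsto_zero_bound[OF _ _ s])
     (simp_all add: norm1_le_pnorm[OF p])

lemma rep_pclass_norm1:
  assumes p: "1 \<le> p" "p < top"
  shows "(\<lambda>n. norm1 (rep (pclass E p s) n - s n)) \<longlonglongrightarrow> 0"
  by (rule norm1_tendsto_of_pnorm[OF p rep_pclass[where E = E]]) (rule pnorm_zero[OF p])

lemma to_L1_pclass:
  assumes p: "1 \<le> p" "p < top" shows "to_L1 E (pclass E p s) = pclass E 1 s"
  unfolding to_L1_def by (rule L1.pclass_eqI[OF rep_pclass_norm1[OF p]])

lemma Lp_of_in_Lp:
  assumes p: "1 \<le> p" "p < top" and a: "a \<in> S"
  shows "Lp_of E p a \<in> Lp E p S"
  unfolding Lp_def Lp_of_def pCauchy_def
  by (rule CollectI, rule exI[of _ "\<lambda>_. a"]) (use a in \<open>auto simp: pnorm_zero[OF p]\<close>)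

lemma Lp_add_pclass: "Lp_add E 1 (pclass E 1 s) (pclass E 1 s') = pclass E 1 (\<lambda>n. s n + s' n)"
  unfolding Lp_add_def
proof (rule L1.pclass_eqI)
  let ?r = "rep (pclass E 1 s)" and ?r' = "rep (pclass E 1 s')"
  have "norm1 (?r n + ?r' n - (s n + s' n)) \<le> norm1 (?r n - s n) + norm1 (?r' n - s' n)" for n
    using norm1_triangle[of "?r n - s n" "?r' n - s' n"] by (simp add: algebra_simps)
  then show "(\<lambda>n. norm1 (?r n + ?r' n - (s n + s' n))) \<longlonglongrightarrow> 0"
    by (intro tendsto_zero_bound[OF _ _
          tendsto_add_zero[OF L1.rep_tendsto[of s] L1.rep_tendsto[of s']]]) simp_all
qed

lemma Lp_scaleR_pclass: "Lp_scaleR E 1 r (pclass E 1 s) = pclass E 1 (\<lambda>n. r *\<^sub>R s n)"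
  unfolding Lp_scaleR_def
proof (rule L1.pclass_eqI)
  let ?r = "rep (pclass E 1 s)"
  have "norm1 (r *\<^sub>R ?r n - r *\<^sub>R s n) \<le> \<bar>r\<bar> * norm1 (?r n - s n)" for n
    using norm1_scaleR_le[of r "?r n - s n"] by (simp add: scaleR_diff_right)
  then show "(\<lambda>n. norm1 (r *\<^sub>R ?r n - r *\<^sub>R s n)) \<longlonglongrightarrow> 0"
    by (intro tendsto_zero_bound[OF _ _
          tendsto_mult_right_zero[OF L1.rep_tendsto[of s], of "\<bar>r\<bar>"]]) simp_all
qed

text \<open>Continuity of the trace pairing in the 1-norm, \<open>norm_E_mult_le\<close>, makes the pairing independent of
  the representative.\<close>

lemma pairing_pclass:
  assumes "(\<lambda>n. norm1 (s n - a)) \<longlonglongrightarrow> 0"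
  shows "pairing E b (pclass E 1 s) = E (b * a)"
  unfolding pairing_def
proof (rule limI)
  let ?r = "rep (pclass E 1 s)"
  have "(\<lambda>n. E (b * ?r n) - E (b * a)) \<longlonglongrightarrow> 0"
  proof (rule tendsto_norm_zero_cancel, rule tendsto_zero_bound)
    have lim: "(\<lambda>n. norm b * (norm1 (?r n - s n) + norm1 (s n - a))) \<longlonglongrightarrow> norm b * (0 + 0)"
      by (intro tendsto_intros L1.rep_tendsto assms)
    show "(\<lambda>n. norm b * (norm1 (?r n - s n) + norm1 (s n - a))) \<longlonglongrightarrow> 0"
      using lim by simp
    show "cmod (E (b * ?r n) - E (b * a)) \<le> norm b * (norm1 (?r n - s n) + norm1 (s n - a))" for n
    proof -
      have "cmod (E (b * ?r n) - E (b * a)) = cmod (E (b * (?r n - a)))"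
        by (simp add: E_diff algebra_simps)
      also have "\<dots> \<le> norm b * norm1 (?r n - a)" by (rule norm_E_mult_le)
      also have "\<dots> \<le> norm b * (norm1 (?r n - s n) + norm1 (s n - a))"
        by (intro mult_left_mono L1.N_diff_triangle) simp
      finally show ?thesis .
    qed
  qed simp
  then show "(\<lambda>n. E (b * ?r n)) \<longlonglongrightarrow> E (b * a)" by (simp add: LIM_zero_iff)
qed

lemma pairing_const: "pairing E b (pclass E 1 (\<lambda>_. a)) = E (b * a)"
  by (rule pairing_pclass) simp

lemma martingale_increment_orthogonal:
  assumes "martingale E \<N> M" "0 \<le> s" "s \<le> t" "c \<in> \<N> s"
  shows "E (c * (M t - M s)) = 0"
proof -
  have "is_cond_exp E (\<N> s) (Lp_of E 1 (M t)) (Lp_of E 1 (M s))"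
    using assms by (auto simp: martingale_def)
  then have "E (c * M s) = E (c * M t)"
    using assms(4) by (auto simp: is_cond_exp_def Lp_of_def pairing_const)
  then show ?thesis by (simp add: right_diff_distrib E_diff)
qed

end

section \<open>Multilinear maps between Lp-spaces\<close>

text \<open>Operator norms bound the values on the unit ball. Scaling by any \<open>s\<close> above the norm \<open>x\<close> of the
  argument, rather than by \<open>x\<close> itself, covers arguments of norm 0.\<close>

lemma bound_by_homogeneity:
  fixes x y K :: real
  assumes "0 \<le> K" "\<And>s. x < s \<Longrightarrow> y \<le> s * K" shows "y \<le> x * K"
proof (cases "K = 0")
  case True
  then show ?thesis using assms(2)[of "x + 1"] by simp
next
  case False
  then have K: "K > 0" using assms(1) by simp
  have "y / K \<le> x"
  proof (rule dense_ge)
    fix s assume "x < s"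
    then show "y / K \<le> s" using assms(2)[of s] K by (simp add: divide_le_eq)
  qed
  then show ?thesis using K by (simp add: divide_le_eq)
qed

locale two_states = B: tracial_state EB + C: tracial_state EC
  for EB :: "'b::cstar_algebra \<Rightarrow> complex" and EC :: "'c::cstar_algebra \<Rightarrow> complex"
begin

lemma pp_norm_le:
  assumes "trinorm EB EC k \<Lambda> \<le> ennreal K" "0 \<le> K" "length ps = k" "\<forall>p\<in>set ps. 1 \<le> p" "1 \<le> q"
    "sum_list (map inverse ps) = inverse q" "list_all2 (\<lambda>p a. pnorm EB p a \<le> 1) ps as"
  shows "pnorm EC q (\<Lambda> as) \<le> K"
proof -
  have "ennreal (pnorm EC q (\<Lambda> as)) \<le> pp_norm EB EC ps q \<Lambda>"
    unfolding pp_norm_def by (rule SUP_upper) (use assms in simp)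
  also have "\<dots> \<le> trinorm EB EC k \<Lambda>"
    unfolding trinorm_def using SUP_upper[of "(ps, q)"
        "{(ps, q). length ps = k \<and> (\<forall>p\<in>set ps. 1 \<le> p) \<and> 1 \<le> q \<and>
          sum_list (map inverse ps) = inverse q}" "\<lambda>(ps, q). pp_norm EB EC ps q \<Lambda>"] assms
    by simp
  also note assms(1)
  finally show ?thesis using assms(2) by (simp add: ennreal_le_iff)
qed

lemma multilinear_1: "multilinear 1 \<Lambda> \<Longrightarrow> linear (\<lambda>x. \<Lambda> [x])"
  unfolding multilinear_def by (drule spec[of _ "[0]"], drule spec[of _ 0]) simp

lemma linear_pnorm_bound:
  assumes \<Lambda>: "multilinear 1 \<Lambda>" "trinorm EB EC 1 \<Lambda> \<le> ennreal K" "0 \<le> K" and p: "1 \<le> p"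
    and hB: "\<And>r x. pnorm EB p (r *\<^sub>R x) \<le> \<bar>r\<bar> * pnorm EB p x"
    and hC: "\<And>r x. pnorm EC p (r *\<^sub>R x) \<le> \<bar>r\<bar> * pnorm EC p x"
    and nn: "\<And>x. 0 \<le> pnorm EB p x"
  shows "pnorm EC p (\<Lambda> [h]) \<le> K * pnorm EB p h"
proof -
  interpret linear "\<lambda>x. \<Lambda> [x]" by (rule multilinear_1[OF \<Lambda>(1)])
  have "pnorm EC p (\<Lambda> [h]) \<le> s * K" if s: "pnorm EB p h < s" for s
  proof -
    have s0: "s > 0" using s nn[of h] by simp
    have "pnorm EB p ((1/s) *\<^sub>R h) \<le> \<bar>1/s\<bar> * pnorm EB p h" by (rule hB)
    also have "\<dots> \<le> 1" using s s0 by simp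
    finally have "pnorm EC p (\<Lambda> [(1/s) *\<^sub>R h]) \<le> K"
      by (intro pp_norm_le[OF \<Lambda>(2,3), of "[p]"]) (use p in auto)
    moreover have "\<Lambda> [h] = s *\<^sub>R \<Lambda> [(1/s) *\<^sub>R h]" using s0 by (simp add: scale)
    then have "pnorm EC p (\<Lambda> [h]) \<le> \<bar>s\<bar> * pnorm EC p (\<Lambda> [(1/s) *\<^sub>R h])" using hC by metis
    ultimately show ?thesis using s0
      by (metis abs_of_pos mult_left_mono order_trans less_imp_le)
  qed
  then have "pnorm EC p (\<Lambda> [h]) \<le> pnorm EB p h * K" by (rule bound_by_homogeneity[OF \<Lambda>(3)])
  then show ?thesis by (simp add: mult.commute)
qed

lemma trinorm_bound_linear:
  assumes \<Lambda>: "multilinear 1 \<Lambda>" "trinorm EB EC 1 \<Lambda> \<le> ennreal K" "0 \<le> K"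
  shows "norm (\<Lambda> [h]) \<le> K * norm h"
    and "C.norm2 (\<Lambda> [h]) \<le> K * B.norm2 h"
    and "C.norm1 (\<Lambda> [h]) \<le> K * B.norm1 h"
  using linear_pnorm_bound[OF \<Lambda>, of top h] linear_pnorm_bound[OF \<Lambda>, of 2 h] linear_pnorm_bound[OF \<Lambda>, of 1 h]
  by (simp_all add: pnorm_def[of _ top] B.pnorm_2 C.pnorm_2 B.pnorm_1 C.pnorm_1 B.norm2_scaleR
      C.norm2_scaleR B.norm1_scaleR_le C.norm1_scaleR_le)

lemma trinorm_bound_quadratic:
  assumes \<Lambda>: "multilinear 2 \<Lambda>" "trinorm EB EC 2 \<Lambda> \<le> ennreal K" "0 \<le> K"
  shows "C.norm1 (\<Lambda> [h, h]) \<le> K * (B.norm2 h)\<^sup>2"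
proof -
  have main: "C.norm1 (\<Lambda> [h, h]) \<le> s\<^sup>2 * K" if s: "B.norm2 h < s" for s
  proof -
    have s0: "s > 0" using s B.norm2_nonneg[of h] by linarith
    define k where "k = (1/s) *\<^sub>R h"
    have "B.norm2 k \<le> 1" using s s0 by (simp add: k_def B.norm2_scaleR)
    have half: "inverse (2::ennreal) + inverse 2 = 1"
    proof -
      have "inverse (2::ennreal) = ennreal (1/2)" using inverse_ennreal[of 2] by simp
      moreover have "ennreal (1/2) + ennreal (1/2) = ennreal (1/2 + 1/2)"
        by (rule ennreal_plus[symmetric]) simp_all
      ultimately show ?thesis by (simp only: field_sum_of_halves ennreal_1)
    qed
    have le: "C.norm1 (\<Lambda> [k, k]) \<le> K"
      using pp_norm_le[OF \<Lambda>(2,3), of "[2, 2]" 1 "[k, k]"] \<open>B.norm2 k \<le> 1\<close>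
      by (simp add: B.pnorm_2 C.pnorm_1 half)
    have l: "linear (\<lambda>x. \<Lambda> [x, k])" "linear (\<lambda>x. \<Lambda> [h, x])"
      using \<Lambda>(1)[unfolded multilinear_def, rule_format, of "[h, k]" 0]
        \<Lambda>(1)[unfolded multilinear_def, rule_format, of "[h, k]" 1] by simp_all
    have "\<Lambda> [s *\<^sub>R k, k] = s *\<^sub>R \<Lambda> [k, k]" "\<Lambda> [h, s *\<^sub>R k] = s *\<^sub>R \<Lambda> [h, k]"
      using linear_cmul[OF l(1), of s k] linear_cmul[OF l(2), of s k] by simp_all
    moreover have "h = s *\<^sub>R k" using s0 by (simp add: k_def)
    ultimately have "\<Lambda> [h, h] = (s\<^sup>2) *\<^sub>R \<Lambda> [k, k]" by (simp add: power2_eq_square)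
    then have "C.norm1 (\<Lambda> [h, h]) \<le> s\<^sup>2 * C.norm1 (\<Lambda> [k, k])"
      using C.norm1_scaleR_le[of "s\<^sup>2" "\<Lambda> [k, k]"] by simp
    also have "\<dots> \<le> s\<^sup>2 * K" by (rule mult_left_mono[OF le]) simp
    finally show ?thesis .
  qed
  have "C.norm1 (\<Lambda> [h, h]) \<le> (B.norm2 h)\<^sup>2 * K"
    by (rule le_at_right_limit[of "\<lambda>s. s\<^sup>2 * K"]) (intro tendsto_intros main)+
  then show ?thesis by (simp add: mult.commute)
qed

text \<open>Adaptedness is applied to the classes of \<open>b\<close> and of its conditional expectation 0. Convergence
  in any p-norm implies convergence in the 1-norm, for which the map is bounded; this identifies the
  classes that adaptedness relates with those of \<open>\<Lambda> [b]\<close> and of 0.\<close>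

lemma FF_preserves_zero_expectation:
  assumes \<Lambda>: "\<Lambda> \<in> FF EB NB EC NC 1 t" and u: "t \<le> u"
    and NB: "star_subalgebra (NB u)" and b: "\<And>c. c \<in> NB u \<Longrightarrow> EB (c * b) = 0" and c: "c \<in> NC u"
  shows "EC (c * \<Lambda> [b]) = 0"
proof -
  have BB: "\<Lambda> \<in> BB EB EC 1" using \<Lambda> by (simp add: FF_def)
  then have ml: "multilinear 1 \<Lambda>" and "trinorm EB EC 1 \<Lambda> < top" by (auto simp: BB_def)
  then obtain K where K: "trinorm EB EC 1 \<Lambda> \<le> ennreal K" "0 \<le> K"
    using that[of "enn2real (trinorm EB EC 1 \<Lambda>)"] by simp
  interpret linear "\<lambda>x. \<Lambda> [x]" by (rule multilinear_1[OF ml])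
  obtain ps q where ps: "length ps = 1" "\<forall>p\<in>set ps. 1 \<le> p \<and> p < top" "1 \<le> q" "q < top"
    and ce: "\<forall>i<1. \<forall>xs b z. length xs = 1 \<longrightarrow>
           (\<forall>j<1. j \<noteq> i \<longrightarrow> xs ! j \<in> Lp EB (ps ! j) (NB u)) \<longrightarrow>
           b \<in> Lp EB (ps ! i) UNIV \<longrightarrow> z \<in> Lp EB (ps ! i) (NB u) \<longrightarrow>
           is_cond_exp EB (NB u) (to_L1 EB b) (to_L1 EB z) \<longrightarrow>
           is_cond_exp EC (NC u) (to_L1 EC (Lp_extend EC q \<Lambda> (xs[i := b])))
             (to_L1 EC (Lp_extend EC q \<Lambda> (xs[i := z])))"
    using mp[OF spec[OF conjunct2[OF CollectD[OF \<Lambda>[unfolded FF_def]]], of u] u]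
    by (elim exE conjE) (rule that)
  define p where "p = ps ! 0"
  have p: "1 \<le> p" "p < top" using ps by (auto simp: p_def)
  have z0: "0 \<in> NB u" using NB unfolding star_subalgebra_def by (metis cscale_zero_left)
  have "is_cond_exp EB (NB u) (to_L1 EB (Lp_of EB p b)) (to_L1 EB (Lp_of EB p 0))"
    unfolding is_cond_exp_def Lp_of_def B.to_L1_pclass[OF p] B.pairing_const
    using B.Lp_of_in_Lp[OF _ _ z0, of 1] b by (simp add: Lp_of_def)
  then have ce: "is_cond_exp EC (NC u) (to_L1 EC (Lp_extend EC q \<Lambda> [Lp_of EB p b]))
      (to_L1 EC (Lp_extend EC q \<Lambda> [Lp_of EB p 0]))"
    using ce[rule_format, of 0 "[Lp_of EB p 0]" "Lp_of EB p b" "Lp_of EB p 0"]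
      B.Lp_of_in_Lp[OF p] z0
    by (simp add: p_def)
  have pair: "pairing EC c (to_L1 EC (Lp_extend EC q \<Lambda> [Lp_of EB p x])) = EC (c * \<Lambda> [x])" for x
  proof -
    have "(\<lambda>n. C.norm1 (\<Lambda> [rep (Lp_of EB p x) n] - \<Lambda> [x])) \<longlonglongrightarrow> 0"
    proof (rule tendsto_zero_bound)
      show "(\<lambda>n. K * B.norm1 (rep (Lp_of EB p x) n - x)) \<longlonglongrightarrow> 0"
        unfolding Lp_of_def by (rule tendsto_mult_right_zero) (rule B.rep_pclass_norm1[OF p])
      show "C.norm1 (\<Lambda> [rep (Lp_of EB p x) n] - \<Lambda> [x]) \<le> K * B.norm1 (rep (Lp_of EB p x) n - x)" for n
        unfolding diff[symmetric] by (rule trinorm_bound_linear(3)[OF ml K])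
    qed simp
    then show ?thesis
      unfolding Lp_extend_def by (simp add: C.to_L1_pclass[OF ps(3,4)] C.pairing_pclass)
  qed
  show ?thesis
    using ce c pair[of b] pair[of 0] zero by (simp add: is_cond_exp_def)
qed

end

section \<open>Partitions and their refinements\<close>

lemma left_nb_eqI:
  assumes "finite P" "l \<in> P" "l < s" "s \<noteq> 0" "\<And>r. r \<in> P \<Longrightarrow> r < s \<Longrightarrow> r \<le> l"
  shows "left_nb P s = l"
  unfolding left_nb_def using assms by (auto intro!: Max_eqI)

lemma left_nb_zero [simp]: "left_nb P 0 = 0"
  by (simp add: left_nb_def)

lemma incr_zero [simp]: "incr X P 0 = 0"
  by (simp add: incr_def)

lemma
  assumes P: "is_partition t P" and s: "s \<in> P" "s \<noteq> 0"
  shows left_nb_in: "left_nb P s \<in> P"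
    and left_nb_less: "left_nb P s < s"
    and left_nb_ge: "r \<in> P \<Longrightarrow> r < s \<Longrightarrow> r \<le> left_nb P s"
proof -
  have fin: "finite {r \<in> P. r < s}" using P by (simp add: is_partition_def)
  have "0 \<in> {r \<in> P. r < s}" using P s by (force simp: is_partition_def)
  then have "left_nb P s \<in> {r \<in> P. r < s}"
    using Max_in[OF fin] s by (auto simp: left_nb_def)
  then show "left_nb P s \<in> P" "left_nb P s < s" by auto
  show "r \<in> P \<Longrightarrow> r < s \<Longrightarrow> r \<le> left_nb P s"
    using Max_ge[OF fin, of r] s by (auto simp: left_nb_def)
qed

lemma partition_nonneg: "is_partition t P \<Longrightarrow> s \<in> P \<Longrightarrow> 0 \<le> s"
  and partition_le: "is_partition t P \<Longrightarrow> s \<in> P \<Longrightarrow> s \<le> t"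
  by (auto simp: is_partition_def)

lemma left_nb_bounds:
  assumes P: "is_partition t P" and s: "s \<in> P"
  shows "0 \<le> left_nb P s" "left_nb P s \<le> s" "left_nb P s \<in> P"
proof -
  show in_P: "left_nb P s \<in> P"
    using left_nb_in[OF P s] P by (cases "s = 0") (auto simp: is_partition_def)
  show "left_nb P s \<le> s" using left_nb_less[OF P s] by (cases "s = 0") auto
  show "0 \<le> left_nb P s" by (rule partition_nonneg[OF P in_P])
qed

lemma mesh_less:
  assumes P: "is_partition t P" "mesh P < d" and s: "s \<in> P"
  shows "s - left_nb P s < d"
proof -
  have "s - left_nb P s \<le> mesh P"
    unfolding mesh_def using P s by (intro Max_ge) (auto simp: is_partition_def)
  then show ?thesis using P by simp
qed

text \<open>The right end point of the interval of \<open>P\<close> that contains \<open>r\<close>, intervals being open on the left;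
  the point 0 forms a degenerate interval.\<close>

definition next_nb :: "real set \<Rightarrow> real \<Rightarrow> real" where
  "next_nb P r = Min {s \<in> P. r \<le> s}"

lemma
  assumes P: "is_partition t P" and r: "r \<le> t"
  shows next_nb_in: "next_nb P r \<in> P"
    and next_nb_ge: "r \<le> next_nb P r"
    and next_nb_le: "s \<in> P \<Longrightarrow> r \<le> s \<Longrightarrow> next_nb P r \<le> s"
proof -
  have fin: "finite {s \<in> P. r \<le> s}" using P by (simp add: is_partition_def)
  have "t \<in> {s \<in> P. r \<le> s}" using P r by (simp add: is_partition_def)
  then have "next_nb P r \<in> {s \<in> P. r \<le> s}"
    using Min_in[OF fin] by (auto simp: next_nb_def)
  then show "next_nb P r \<in> P" "r \<le> next_nb P r" by auto
  show "s \<in> P \<Longrightarrow> r \<le> s \<Longrightarrow> next_nb P r \<le> s"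
    using Min_le[OF fin, of s] by (auto simp: next_nb_def)
qed

lemma next_nb_self: "is_partition t P \<Longrightarrow> r \<in> P \<Longrightarrow> next_nb P r = r"
  by (meson next_nb_ge next_nb_le order_antisym order_refl partition_le)

text \<open>Inserting one point \<open>q\<close> splits the interval that ends at \<open>next_nb P q\<close> into two.\<close>

lemma sum_incr_insert:
  fixes H :: "real \<Rightarrow> 'a::cstar_algebra \<Rightarrow> 'c::ab_group_add"
  assumes P: "is_partition t P" and q: "q \<notin> P" "0 \<le> q" "q \<le> t"
    and add: "\<And>s x y. s \<in> P \<Longrightarrow> H s (x + y) = H s x + H s y"
  shows "(\<Sum>s\<in>P. H s (incr X P s)) = (\<Sum>r\<in>insert q P. H (next_nb P r) (incr X (insert q P) r))"
proof -
  define s where "s = next_nb P q"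
  define l where "l = left_nb P s"
  have fin: "finite P" and P0: "0 \<in> P" using P by (auto simp: is_partition_def)
  have s: "s \<in> P" "q < s" "\<And>r. r \<in> P \<Longrightarrow> q \<le> r \<Longrightarrow> s \<le> r"
    using next_nb_in[OF P q(3)] next_nb_ge[OF P q(3)] next_nb_le[OF P q(3)] q(1)
    by (auto simp: s_def less_le)
  have s0: "s \<noteq> 0" using s q by auto
  have l: "l \<in> P" "l < s" "\<And>r. r \<in> P \<Longrightarrow> r < s \<Longrightarrow> r \<le> l"
    using left_nb_in[OF P s(1) s0] left_nb_less[OF P s(1) s0] left_nb_ge[OF P s(1) s0]
    by (auto simp: l_def)
  have lq: "l < q" using s(3)[OF l(1)] l(2) by force
  have q0: "q \<noteq> 0" using q P0 by auto
  have lnq: "left_nb (insert q P) q = l"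
    by (rule left_nb_eqI) (use fin l lq q0 s(2) in \<open>auto intro: l(3)\<close>)
  have lns: "left_nb (insert q P) s = q"
    by (rule left_nb_eqI) (use fin s(2) s0 l lq in force)+
  have other: "left_nb (insert q P) r = left_nb P r" if r: "r \<in> P" "r \<noteq> s" for r
  proof (cases "r = 0")
    case False
    note rr = left_nb_in[OF P r(1) False] left_nb_less[OF P r(1) False] left_nb_ge[OF P r(1) False]
    show ?thesis
    proof (rule left_nb_eqI)
      fix x assume "x \<in> insert q P" "x < r"
      moreover have "q \<le> left_nb P r" if "q < r"
      proof -
        have "s < r" using s(3)[OF r(1)] r(2) that by simp
        then show ?thesis using rr(3)[OF s(1)] s(2) by simp
      qed
      ultimately show "x \<le> left_nb P r" using rr(3) by auto
    qed (use fin rr False in auto)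
  qed simp
  have nq: "next_nb P q = s" by (simp add: s_def)
  have nr: "next_nb P r = r" if "r \<in> P" for r by (rule next_nb_self[OF P that])
  have "(\<Sum>r\<in>insert q P. H (next_nb P r) (incr X (insert q P) r))
      = H s (X q - X l) + (\<Sum>r\<in>P. H r (incr X (insert q P) r))"
    using fin q(1) nr by (simp add: nq incr_def lnq)
  also have "(\<Sum>r\<in>P. H r (incr X (insert q P) r))
      = H s (X s - X q) + (\<Sum>r\<in>P - {s}. H r (incr X (insert q P) r))"
    using fin s(1) by (simp add: sum.remove incr_def lns)
  also have "(\<Sum>r\<in>P - {s}. H r (incr X (insert q P) r)) = (\<Sum>r\<in>P - {s}. H r (incr X P r))"
    by (rule sum.cong) (auto simp: incr_def other)
  also have "H s (X q - X l) + (H s (X s - X q) + (\<Sum>r\<in>P - {s}. H r (incr X P r)))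
      = H s (incr X P s) + (\<Sum>r\<in>P - {s}. H r (incr X P r))"
    using add[OF s(1), of "X q - X l" "X s - X q"] by (simp add: incr_def l_def algebra_simps)
  also have "\<dots> = (\<Sum>s\<in>P. H s (incr X P s))" using fin s(1) by (simp add: sum.remove)
  finally show ?thesis by simp
qed

lemma is_partition_Un: "is_partition t P \<Longrightarrow> is_partition t Q \<Longrightarrow> is_partition t (P \<union> Q)"
  by (auto simp: is_partition_def)

text \<open>This puts Riemann sums for different partitions on a common refinement, where they can be
  compared term by term.\<close>

lemma sum_incr_refine:
  fixes H :: "real \<Rightarrow> 'a::cstar_algebra \<Rightarrow> 'c::ab_group_add"
  assumes P: "is_partition t P" and R: "is_partition t R" "P \<subseteq> R"
    and add: "\<And>s x y. s \<in> P \<Longrightarrow> H s (x + y) = H s x + H s y"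
  shows "(\<Sum>s\<in>P. H s (incr X P s)) = (\<Sum>r\<in>R. H (next_nb P r) (incr X R r))"
proof -
  have "finite Q \<Longrightarrow> Q \<subseteq> {0..t} \<Longrightarrow>
    (\<Sum>s\<in>P. H s (incr X P s)) = (\<Sum>r\<in>P \<union> Q. H (next_nb P r) (incr X (P \<union> Q) r))" for Q
  proof (induction Q rule: finite_induct)
    case empty
    show ?case by (auto intro!: sum.cong simp: next_nb_self[OF P])
  next
    case (insert q Q)
    show ?case
    proof (cases "q \<in> P")
      case True
      then have "P \<union> insert q Q = P \<union> Q" by auto
      then show ?thesis using insert by simp
    next
      case False
      define R' where "R' = P \<union> Q"
      have R': "is_partition t R'" using P insert by (auto simp: R'_def is_partition_def)
      have "(\<Sum>r\<in>R'. H (next_nb P r) (incr X R' r))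
          = (\<Sum>r\<in>insert q R'. H (next_nb P (next_nb R' r)) (incr X (insert q R') r))"
        by (rule sum_incr_insert[OF R', of q "\<lambda>r. H (next_nb P r)"])
           (use False insert add next_nb_in[OF P partition_le[OF R']] in \<open>auto simp: R'_def\<close>)
      also have "\<dots> = (\<Sum>r\<in>insert q R'. H (next_nb P r) (incr X (insert q R') r))"
      proof (rule sum.cong)
        fix r assume "r \<in> insert q R'"
        then have r: "r \<le> t" using R' insert by (auto simp: is_partition_def)
        have nr: "next_nb R' r \<le> t" by (rule partition_le[OF R' next_nb_in[OF R' r]])
        have "next_nb P r \<in> R'" using next_nb_in[OF P r] by (simp add: R'_def)
        then have "next_nb R' r \<le> next_nb P r" using next_nb_le[OF R' r] next_nb_ge[OF P r] by blast
        then have "next_nb P (next_nb R' r) \<le> next_nb P r"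
          using next_nb_le[OF P nr next_nb_in[OF P r]] by blast
        moreover have "next_nb P r \<le> next_nb P (next_nb R' r)"
          using next_nb_le[OF P r next_nb_in[OF P nr]] next_nb_ge[OF P nr] next_nb_ge[OF R' r] by simp
        ultimately show "H (next_nb P (next_nb R' r)) (incr X (insert q R') r)
            = H (next_nb P r) (incr X (insert q R') r)" by simp
      qed simp
      finally show ?thesis using insert by (simp add: R'_def)
    qed
  qed
  from this[of R] show ?thesis
    using R by (simp add: is_partition_def Un_absorb1)
qed

lemma sum_incr:
  assumes P: "is_partition t P" and t: "0 \<le> t"
  shows "(\<Sum>s\<in>P. incr X P s) = X t - X 0"
proof -
  have P0: "is_partition t {0, t}" using t by (simp add: is_partition_def)
  have "left_nb {0, t} t = 0" by (cases "t = 0") (use t in \<open>auto intro!: left_nb_eqI\<close>)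
  moreover have "(\<Sum>s\<in>{0, t}. incr X {0, t} s) = incr X {0, t} t" by (cases "t = 0") auto
  ultimately have "(\<Sum>s\<in>{0, t}. incr X {0, t} s) = X t - X 0" by (simp add: incr_def)
  then show ?thesis
    using sum_incr_refine[OF P0 P, of "\<lambda>_ x. x" X] P by (simp add: is_partition_def)
qed

text \<open>These inequalities place the interval of \<open>R\<close> that ends at \<open>r\<close> inside an interval of \<open>P\<close>.\<close>

lemma refine_bounds:
  assumes P: "is_partition t P" "mesh P < d" and R: "is_partition t R" "P \<subseteq> R" and r: "r \<in> R"
  shows "next_nb P r \<in> P" "left_nb P (next_nb P r) \<le> left_nb R r"
    "r \<le> next_nb P r" "next_nb P r < left_nb P (next_nb P r) + d"
proof -
  have rt: "r \<le> t" "0 \<le> r" using R r by (auto simp: is_partition_def)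
  note n = next_nb_in[OF P(1) rt(1)] next_nb_ge[OF P(1) rt(1)] next_nb_le[OF P(1) rt(1)]
  show "next_nb P r \<in> P" "r \<le> next_nb P r" by (rule n)+
  show "next_nb P r < left_nb P (next_nb P r) + d" using mesh_less[OF P n(1)] by simp
  show "left_nb P (next_nb P r) \<le> left_nb R r"
  proof (cases "r = 0")
    case True
    then have "next_nb P r = 0" using next_nb_self[OF P(1), of 0] P(1) by (simp add: is_partition_def)
    then show ?thesis using True by simp
  next
    case False
    have nz: "next_nb P r \<noteq> 0" using False rt n(2) by simp
    note l = left_nb_in[OF P(1) n(1) nz] left_nb_less[OF P(1) n(1) nz]
    have "left_nb P (next_nb P r) < r" using n(3)[OF l(1)] l(2) by force
    then show ?thesis using left_nb_ge[OF R(1) r False] l(1) R(2) by blast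
  qed
qed

lemma ex_fine_partition:
  assumes t: "0 \<le> t" and d: "0 < d"
  obtains P where "is_partition t P" "mesh P < d"
proof -
  obtain n :: nat where n: "t / d < real n" using reals_Archimedean2 by blast
  define m where "m = Suc n"
  have m: "m > 0" "t / real m < d"
  proof -
    have "t / d < real m" using n by (simp add: m_def)
    then show "t / real m < d" using d by (simp add: m_def field_simps)
  qed (simp add: m_def)
  define g where "g i = t * real i / real m" for i
  define P where "P = g ` {..m}"
  have P: "is_partition t P"
  proof -
    have "0 \<in> P" unfolding P_def by (rule image_eqI[of _ _ 0]) (auto simp: g_def)
    moreover have "t \<in> P" unfolding P_def using m by (intro image_eqI[of _ _ m]) (auto simp: g_def)
    moreover have "g i \<in> {0..t}" if "i \<le> m" for i
      using that t m mult_left_mono[of "real i" "real m" t] by (auto simp: g_def field_simps)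
    ultimately show ?thesis by (auto simp: is_partition_def P_def)
  qed
  have "s - left_nb P s \<le> t / real m" if s: "s \<in> P" for s
  proof (cases "s = 0")
    case True
    then show ?thesis using t by simp
  next
    case False
    obtain i where i: "i \<le> m" "s = g i" using s by (auto simp: P_def)
    then obtain j where j: "i = Suc j" using False by (cases i) (auto simp: g_def)
    have eq: "g i - g j = t / real m" by (simp add: j g_def add_divide_distrib distrib_left)
    have "t > 0" using False i t by (cases "t = 0") (auto simp: g_def)
    then have "t / real m > 0" using m by simp
    then have "g j < s" using eq i by simp
    moreover have "g j \<in> P" using i j by (auto simp: P_def)
    ultimately have "g j \<le> left_nb P s" by (intro left_nb_ge[OF P s False])
    then show ?thesis using eq i by simp
  qed
  then have "mesh P \<le> t / real m"
    unfolding mesh_def using P by (subst Max_le_iff) (auto simp: is_partition_def)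
  then show ?thesis using that[OF P] m by simp
qed

lemma fine_partition_sequence:
  assumes t: "0 \<le> t"
  obtains Q where "\<And>n. is_partition t (Q n)"
    "\<And>d. d > 0 \<Longrightarrow> \<forall>\<^sub>F n in sequentially. mesh (Q n) < d"
proof -
  have "\<exists>P. is_partition t P \<and> mesh P < inverse (real (Suc n))" for n
    using ex_fine_partition[OF t, of "inverse (real (Suc n))"] by auto
  then obtain Q where Q: "\<And>n. is_partition t (Q n)" "\<And>n. mesh (Q n) < inverse (real (Suc n))"
    by metis
  show ?thesis
  proof (rule that[OF Q(1)])
    fix d :: real assume "d > 0"
    then have "\<forall>\<^sub>F n in sequentially. inverse (real (Suc n)) < d"
      using LIMSEQ_inverse_real_of_nat by (rule order_tendstoD(2)[rotated])
    then show "\<forall>\<^sub>F n in sequentially. mesh (Q n) < d"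
      by (rule eventually_mono) (use Q(2) order_less_trans in blast)
  qed
qed

text \<open>Completeness is available for sequences. A sequence of partitions with vanishing mesh carries the
  limit of a family that is Cauchy as the mesh tends to 0.\<close>

lemma mesh_Cauchy_sequence:
  fixes S :: "real set \<Rightarrow> 'c::ab_group_add" and N :: "'c \<Rightarrow> real"
  assumes t: "0 \<le> t" and cauchy: "\<And>e. e > 0 \<Longrightarrow> \<exists>d>0. \<forall>P P'. is_partition t P \<longrightarrow> mesh P < d \<longrightarrow>
      is_partition t P' \<longrightarrow> mesh P' < d \<longrightarrow> N (S P - S P') \<le> e"
  obtains \<sigma> where "\<forall>e>0. \<exists>M. \<forall>m\<ge>M. \<forall>n\<ge>M. N (\<sigma> m - \<sigma> n) < e"
    "\<forall>e>0. \<exists>d>0. \<forall>P. is_partition t P \<longrightarrow> mesh P < d \<longrightarrow> (\<forall>\<^sub>F n in sequentially. N (S P - \<sigma> n) \<le> e)"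
proof -
  obtain Q where Q: "\<And>n. is_partition t (Q n)"
    "\<And>d. d > 0 \<Longrightarrow> \<forall>\<^sub>F n in sequentially. mesh (Q n) < d"
    using fine_partition_sequence[OF t] by blast
  show ?thesis
  proof (rule that[of "\<lambda>n. S (Q n)"]; intro allI impI)
    fix e :: real assume e: "e > 0"
    then obtain d where d: "d > 0" "\<And>P P'. is_partition t P \<Longrightarrow> mesh P < d \<Longrightarrow>
        is_partition t P' \<Longrightarrow> mesh P' < d \<Longrightarrow> N (S P - S P') \<le> e/2"
      using cauchy[of "e/2"] by (meson half_gt_zero)
    obtain M where M: "\<And>n. n \<ge> M \<Longrightarrow> mesh (Q n) < d"
      using Q(2)[OF d(1)] unfolding eventually_sequentially by blast
    have "N (S (Q m) - S (Q n)) < e" if "m \<ge> M" "n \<ge> M" for m n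
      using d(2)[OF Q(1) M[OF that(1)] Q(1) M[OF that(2)]] e by simp
    then show "\<exists>M. \<forall>m\<ge>M. \<forall>n\<ge>M. N (S (Q m) - S (Q n)) < e" by blast
  next
    fix e :: real assume "e > 0"
    then obtain d where d: "d > 0" "\<And>P P'. is_partition t P \<Longrightarrow> mesh P < d \<Longrightarrow>
        is_partition t P' \<Longrightarrow> mesh P' < d \<Longrightarrow> N (S P - S P') \<le> e"
      using cauchy by blast
    have "\<forall>\<^sub>F n in sequentially. N (S P - S (Q n)) \<le> e" if "is_partition t P" "mesh P < d" for P
      using Q(2)[OF d(1)] by eventually_elim (intro d(2) that Q(1))
    then show "\<exists>d>0. \<forall>P. is_partition t P \<longrightarrow> mesh P < d \<longrightarrow>
        (\<forall>\<^sub>F n in sequentially. N (S P - S (Q n)) \<le> e)" using d(1) by blast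
  qed
qed

lemma eventually_mesh_to_0:
  assumes "d > 0" "\<And>P. is_partition t P \<Longrightarrow> mesh P < d \<Longrightarrow> S P"
  shows "\<forall>\<^sub>F P in mesh_to_0 t. S P"
  unfolding mesh_to_0_def
  by (rule eventually_INF1[of d]) (use assms in \<open>auto simp: eventually_principal\<close>)

lemma eventually_tagged_mesh_to_0:
  assumes "d > 0" "\<And>P \<xi>. is_partition t P \<Longrightarrow> mesh P < d \<Longrightarrow> \<forall>s\<in>P. \<xi> s \<in> {left_nb P s..s} \<Longrightarrow> S (P, \<xi>)"
  shows "\<forall>\<^sub>F x in tagged_mesh_to_0 t. S x"
  unfolding tagged_mesh_to_0_def
  by (rule eventually_INF1[of d]) (use assms in \<open>auto simp: eventually_principal\<close>)

section \<open>Riemann--Stieltjes integrals against processes of bounded variation\<close>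

text \<open>Both tags that belong to a point \<open>r\<close> of the refinement are within the mesh of \<open>r\<close>, so each
  coefficient differs from the one at \<open>r\<close> by at most \<open>e\<close>.\<close>

lemma tagged_sums_close:
  fixes H :: "real \<Rightarrow> 'a::cstar_algebra \<Rightarrow> 'c::cstar_algebra"
  assumes add: "\<And>s x y. 0 \<le> s \<Longrightarrow> H s (x + y) = H s x + H s y"
    and K: "\<And>P. is_partition t P \<Longrightarrow> (\<Sum>s\<in>P. norm (incr A P s)) \<le> K"
    and e: "0 \<le> e"
    and close: "\<And>s s' h. 0 \<le> s \<Longrightarrow> s \<le> t \<Longrightarrow> 0 \<le> s' \<Longrightarrow> s' \<le> t \<Longrightarrow> \<bar>s - s'\<bar> < d \<Longrightarrow>
        norm (H s h - H s' h) \<le> e * norm h"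
    and P: "is_partition t P" "mesh P < d" "\<forall>s\<in>P. \<xi> s \<in> {left_nb P s..s}"
    and P': "is_partition t P'" "mesh P' < d" "\<forall>s\<in>P'. \<xi>' s \<in> {left_nb P' s..s}"
  shows "norm ((\<Sum>s\<in>P. H (\<xi> s) (incr A P s)) - (\<Sum>s\<in>P'. H (\<xi>' s) (incr A P' s))) \<le> 2 * e * K"
proof -
  define R where "R = P \<union> P'"
  have R: "is_partition t R" using is_partition_Un[OF P(1) P'(1)] by (simp add: R_def)
  have tag: "norm (H (\<xi> (next_nb P r)) h - H r h) \<le> e * norm h"
    if P: "is_partition t P" "mesh P < d" "\<forall>s\<in>P. \<xi> s \<in> {left_nb P s..s}" "P \<subseteq> R"
      and r: "r \<in> R" for P \<xi> r h
  proof -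
    note b = refine_bounds[OF P(1,2) R P(4) r]
    have x: "left_nb P (next_nb P r) \<le> \<xi> (next_nb P r)" "\<xi> (next_nb P r) \<le> next_nb P r"
      using P(3) b(1) by auto
    have r0: "0 \<le> r" "r \<le> t" using R r by (auto simp: is_partition_def)
    have l: "left_nb P (next_nb P r) \<le> r" using b(2) left_nb_bounds(2)[OF R r] by simp
    have n: "next_nb P r \<le> t" "0 \<le> left_nb P (next_nb P r)"
      using partition_le[OF P(1) b(1)] left_nb_bounds(1)[OF P(1) b(1)] by auto
    show ?thesis
      by (rule close) (use x r0 l n b in auto)
  qed
  have tag0: "0 \<le> \<xi> s" if "is_partition t P" "\<forall>s\<in>P. \<xi> s \<in> {left_nb P s..s}" "s \<in> P" for P \<xi> s
    using that(2,3) left_nb_bounds(1)[OF that(1,3)] by force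
  have eq: "(\<Sum>s\<in>P. H (\<xi> s) (incr A P s)) = (\<Sum>r\<in>R. H (\<xi> (next_nb P r)) (incr A R r))"
    by (rule sum_incr_refine[OF P(1) R, of "\<lambda>s. H (\<xi> s)"])
       (auto simp: R_def add tag0[OF P(1,3)])
  have eq': "(\<Sum>s\<in>P'. H (\<xi>' s) (incr A P' s)) = (\<Sum>r\<in>R. H (\<xi>' (next_nb P' r)) (incr A R r))"
    by (rule sum_incr_refine[OF P'(1) R, of "\<lambda>s. H (\<xi>' s)"])
       (auto simp: R_def add tag0[OF P'(1,3)])
  have "norm (H (\<xi> (next_nb P r)) (incr A R r) - H (\<xi>' (next_nb P' r)) (incr A R r))
      \<le> 2 * e * norm (incr A R r)" if r: "r \<in> R" for r
  proof -
    have "norm (H (\<xi> (next_nb P r)) (incr A R r) - H r (incr A R r)) \<le> e * norm (incr A R r)"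
      "norm (H (\<xi>' (next_nb P' r)) (incr A R r) - H r (incr A R r)) \<le> e * norm (incr A R r)"
      using tag[OF P, of r] tag[OF P', of r] r by (auto simp: R_def)
    from norm_diff_triangle_le[OF this(1) this(2)[unfolded norm_minus_commute[of "H (\<xi>' _) _"]]]
    show ?thesis by simp
  qed
  then have "norm ((\<Sum>s\<in>P. H (\<xi> s) (incr A P s)) - (\<Sum>s\<in>P'. H (\<xi>' s) (incr A P' s)))
      \<le> (\<Sum>r\<in>R. 2 * e * norm (incr A R r))"
    unfolding eq eq' sum_subtractf[symmetric] by (rule sum_norm_le)
  also have "\<dots> \<le> 2 * e * K"
    unfolding sum_distrib_left[symmetric] using K[OF R] e by (intro mult_left_mono) auto
  finally show ?thesis .
qed

lemma variation_bound_nonneg: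
  assumes "\<And>P. is_partition t P \<Longrightarrow> (\<Sum>s\<in>P. norm (incr A P s)) \<le> K" "0 \<le> t"
  shows "0 \<le> K"
  using assms(1)[of "{0, t}"] assms(2) sum_nonneg[of "{0, t}" "\<lambda>s. norm (incr A {0, t} s)"]
  by (simp add: is_partition_def)

lemma has_RS_integral_exists:
  fixes H :: "real \<Rightarrow> 'a::cstar_algebra list \<Rightarrow> 'c::cstar_algebra"
  assumes t: "0 \<le> t" and add: "\<And>s x y. 0 \<le> s \<Longrightarrow> H s [x + y] = H s [x] + H s [y]"
    and K: "\<And>P. is_partition t P \<Longrightarrow> (\<Sum>s\<in>P. norm (incr A P s)) \<le> K"
    and close: "\<And>e. e > 0 \<Longrightarrow> \<exists>d>0. \<forall>s s' h. 0 \<le> s \<longrightarrow> s \<le> t \<longrightarrow> 0 \<le> s' \<longrightarrow> s' \<le> t \<longrightarrow>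
        \<bar>s - s'\<bar> < d \<longrightarrow> norm (H s [h] - H s' [h]) \<le> e * norm h"
  obtains I where "has_RS_integral H A t I"
    "\<And>e. e > 0 \<Longrightarrow> \<exists>d>0. \<forall>P. is_partition t P \<longrightarrow> mesh P < d \<longrightarrow>
        norm ((\<Sum>s\<in>P. H (left_nb P s) [incr A P s]) - I) \<le> e"
proof -
  define S where "S P \<xi> = (\<Sum>s\<in>P. H (\<xi> s) [incr A P s])" for P and \<xi> :: "real \<Rightarrow> real"
  define L where "L P = S P (left_nb P)" for P
  have tagL: "\<forall>s\<in>P. left_nb P s \<in> {left_nb P s..s}" if "is_partition t P" for P
    using left_nb_bounds[OF that] by auto
  have K0: "K \<ge> 0" by (rule variation_bound_nonneg[OF K t])
  have cauchy: "\<exists>d>0. \<forall>P \<xi> P' \<xi>'. is_partition t P \<longrightarrow> mesh P < d \<longrightarrow> (\<forall>s\<in>P. \<xi> s \<in> {left_nb P s..s}) \<longrightarrow>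
      is_partition t P' \<longrightarrow> mesh P' < d \<longrightarrow> (\<forall>s\<in>P'. \<xi>' s \<in> {left_nb P' s..s}) \<longrightarrow>
      norm (S P \<xi> - S P' \<xi>') \<le> e" if e: "e > 0" for e
  proof -
    define e' where "e' = e / (2 * (K + 1))"
    have e': "e' > 0" using e K0 by (simp add: e'_def)
    have "2 * (K + 1) \<noteq> 0" using K0 by simp
    then have "e' * (2 * (K + 1)) = e" by (metis e'_def nonzero_divide_eq_eq)
    moreover have "2 * e' * K \<le> e' * (2 * (K + 1))" using e' by (simp add: algebra_simps)
    ultimately have le: "2 * e' * K \<le> e" by simp
    obtain d where d: "d > 0" "\<And>s s' h. 0 \<le> s \<Longrightarrow> s \<le> t \<Longrightarrow> 0 \<le> s' \<Longrightarrow> s' \<le> t \<Longrightarrow>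
        \<bar>s - s'\<bar> < d \<Longrightarrow> norm (H s [h] - H s' [h]) \<le> e' * norm h"
      using close[OF e'] by blast
    have "norm (S P \<xi> - S P' \<xi>') \<le> e"
      if "is_partition t P" "mesh P < d" "\<forall>s\<in>P. \<xi> s \<in> {left_nb P s..s}"
        "is_partition t P'" "mesh P' < d" "\<forall>s\<in>P'. \<xi>' s \<in> {left_nb P' s..s}" for P \<xi> P' \<xi>'
      using tagged_sums_close[of "\<lambda>s x. H s [x]" t A K e' d, OF add K _ d(2) that] e' le
      unfolding S_def by linarith
    then show ?thesis using d(1) by blast
  qed
  have cauchyL: "\<exists>d>0. \<forall>P P'. is_partition t P \<longrightarrow> mesh P < d \<longrightarrow>
      is_partition t P' \<longrightarrow> mesh P' < d \<longrightarrow> norm (L P - L P') \<le> e" if e: "e > 0" for e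
  proof -
    obtain d where "d > 0" "\<And>P \<xi> P' \<xi>'. is_partition t P \<Longrightarrow> mesh P < d \<Longrightarrow>
          (\<forall>s\<in>P. \<xi> s \<in> {left_nb P s..s}) \<Longrightarrow>
          is_partition t P' \<Longrightarrow> mesh P' < d \<Longrightarrow> (\<forall>s\<in>P'. \<xi>' s \<in> {left_nb P' s..s}) \<Longrightarrow>
          norm (S P \<xi> - S P' \<xi>') \<le> e"
      using cauchy[OF e] by metis
    then show ?thesis using tagL unfolding L_def by (intro exI[of _ d]) simp
  qed
  obtain s where s: "\<forall>e>0. \<exists>M. \<forall>m\<ge>M. \<forall>n\<ge>M. norm (s m - s n) < e"
    and lims: "\<forall>e>0. \<exists>d>0. \<forall>P. is_partition t P \<longrightarrow> mesh P < d \<longrightarrow>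
      (\<forall>\<^sub>F n in sequentially. norm (L P - s n) \<le> e)"
    by (rule mesh_Cauchy_sequence[OF t cauchyL])
  have "Cauchy s" using s by (intro CauchyI) auto
  then obtain I where I: "s \<longlonglongrightarrow> I" using Cauchy_convergent_iff convergent_def by blast
  have lim: "\<exists>d>0. \<forall>P. is_partition t P \<longrightarrow> mesh P < d \<longrightarrow> norm (L P - I) \<le> e" if e: "e > 0" for e
  proof -
    obtain d where d: "d > 0" "\<And>P. is_partition t P \<Longrightarrow> mesh P < d \<Longrightarrow>
      \<forall>\<^sub>F n in sequentially. norm (L P - s n) \<le> e" using lims e by blast
    have "norm (L P - I) \<le> e" if "is_partition t P" "mesh P < d" for P
      by (rule tendsto_upperbound[OF tendsto_norm[OF tendsto_diff[OF tendsto_const I]] d(2)[OF that]]) simp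
    then show ?thesis using d(1) by blast
  qed
  show ?thesis
  proof (rule that)
    show "has_RS_integral H A t I"
      unfolding has_RS_integral_def
    proof (rule tendstoI)
      fix e :: real assume "e > 0"
      then have e: "e/3 > 0" by simp
      obtain d where d: "d > 0" "\<And>P. is_partition t P \<Longrightarrow> mesh P < d \<Longrightarrow> norm (L P - I) \<le> e/3"
        using lim[OF e] by blast
      obtain d' where d': "d' > 0" "\<And>P \<xi> P' \<xi>'. is_partition t P \<Longrightarrow> mesh P < d' \<Longrightarrow>
          (\<forall>s\<in>P. \<xi> s \<in> {left_nb P s..s}) \<Longrightarrow>
          is_partition t P' \<Longrightarrow> mesh P' < d' \<Longrightarrow> (\<forall>s\<in>P'. \<xi>' s \<in> {left_nb P' s..s}) \<Longrightarrow>
          norm (S P \<xi> - S P' \<xi>') \<le> e/3"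
        using cauchy[OF e] by metis
      show "\<forall>\<^sub>F x in tagged_mesh_to_0 t.
          dist (case x of (P, \<xi>) \<Rightarrow> \<Sum>s\<in>P. H (\<xi> s) [incr A P s]) I < e"
      proof (rule eventually_tagged_mesh_to_0[of "min d d'"])
        fix P \<xi> assume P: "is_partition t P" "mesh P < min d d'" "\<forall>s\<in>P. \<xi> s \<in> {left_nb P s..s}"
        then have "norm (S P \<xi> - L P) \<le> e/3" "norm (L P - I) \<le> e/3"
          unfolding L_def using d(2)[unfolded L_def] d'(2) tagL by auto
        from norm_diff_triangle_le[OF this]
        show "dist (case (P, \<xi>) of (P, \<xi>) \<Rightarrow> \<Sum>s\<in>P. H (\<xi> s) [incr A P s]) I < e"
          using e by (simp add: S_def dist_norm)
      qed (use d d' in simp)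
    qed
    fix e :: real assume "e > 0"
    from lim[OF this] show "\<exists>d>0. \<forall>P. is_partition t P \<longrightarrow> mesh P < d \<longrightarrow>
        norm ((\<Sum>s\<in>P. H (left_nb P s) [incr A P s]) - I) \<le> e"
      unfolding L_def S_def .
  qed
qed

section \<open>Stochastic integrals\<close>

context tracial_state
begin

lemma norm2_sum_orthogonal:
  assumes "finite R" and orth: "\<And>r r'. r \<in> R \<Longrightarrow> r' \<in> R \<Longrightarrow> r < r' \<Longrightarrow> E (star (Y r) * Y r') = 0"
  shows "(norm2 (\<Sum>r\<in>R. Y r))\<^sup>2 = (\<Sum>r\<in>R. (norm2 (Y (r::real)))\<^sup>2)"
  using assms
proof (induction R rule: finite_linorder_max_induct)
  case (insert b R)
  have "star (\<Sum>r\<in>R. Y r) * Y b = (\<Sum>r\<in>R. star (Y r) * Y b)"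
    using linear_sum[OF bounded_linear.linear[OF bounded_linear_star], of Y R]
    by (simp add: sum_distrib_right)
  then have "E (star (\<Sum>r\<in>R. Y r) * Y b) = 0"
    using insert by (simp add: E_sum)
  moreover have "(\<Sum>r\<in>insert b R. Y r) = (\<Sum>r\<in>R. Y r) + Y b"
    using insert by (subst sum.insert) (auto simp: add.commute)
  ultimately show ?case using insert by (subst sum.insert) (auto simp: norm2_add_square)
qed simp

lemma norm2_sum_le: "norm2 (\<Sum>r\<in>R. Y r) \<le> (\<Sum>r\<in>R. norm2 (Y r))"
  by (induction R rule: infinite_finite_induct) (auto intro: order_trans[OF norm2_triangle])

lemma norm1_sum_le: "norm1 (\<Sum>r\<in>R. Y r) \<le> (\<Sum>r\<in>R. norm1 (Y r))"
  by (induction R rule: infinite_finite_induct) (auto intro: order_trans[OF norm1_triangle])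

lemma martingale_incr_orthogonal:
  assumes M: "martingale E \<N> M" and R: "is_partition t R" and r: "r \<in> R" "r \<noteq> 0"
    and c: "c \<in> \<N> (left_nb R r)"
  shows "E (c * incr M R r) = 0"
  unfolding incr_def using left_nb_bounds[OF R r(1)] c
  by (intro martingale_increment_orthogonal[OF M]) auto

lemma incr_in_filtration:
  assumes N: "filtration \<N>" and M: "adapted \<N> M" and R: "is_partition t R" and r: "r \<in> R"
  shows "incr M R r \<in> \<N> r"
proof -
  have b: "0 \<le> left_nb R r" "left_nb R r \<le> r" using left_nb_bounds[OF R r] by auto
  then have sub: "star_subalgebra (\<N> r)" and "\<N> (left_nb R r) \<subseteq> \<N> r"
    using N by (auto simp: filtration_def)
  then have "M r \<in> \<N> r" "M (left_nb R r) \<in> \<N> r" using M b by (auto simp: adapted_def)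
  moreover have "- 1 *\<^sub>R M (left_nb R r) \<in> \<N> r"
    using calculation sub cscale_of_real[of "-1" "M (left_nb R r)"]
    unfolding star_subalgebra_def by metis
  ultimately show ?thesis using sub unfolding star_subalgebra_def incr_def
    by (metis diff_conv_add_uminus scaleR_minus1_left)
qed

text \<open>Earlier increments belong to the algebra at the left end point of a later one, which is orthogonal
  to that algebra.\<close>

lemma sum_norm2_martingale_incr:
  assumes N: "filtration \<N>" and M: "martingale E \<N> M" and R: "is_partition t R" and t: "0 \<le> t"
  shows "(\<Sum>r\<in>R. (norm2 (incr M R r))\<^sup>2) = (norm2 (M t - M 0))\<^sup>2"
proof -
  have ad: "adapted \<N> M" using M by (simp add: martingale_def)
  have "(norm2 (\<Sum>r\<in>R. incr M R r))\<^sup>2 = (\<Sum>r\<in>R. (norm2 (incr M R r))\<^sup>2)"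
  proof (rule norm2_sum_orthogonal)
    show "finite R" using R by (simp add: is_partition_def)
    fix r r' assume r: "r \<in> R" "r' \<in> R" "r < r'"
    have r0: "0 \<le> r" "r' \<noteq> 0" using partition_nonneg[OF R] r by force+
    have le: "r \<le> left_nb R r'" by (rule left_nb_ge[OF R r(2) r0(2) r(1) r(3)])
    then have "incr M R r \<in> \<N> (left_nb R r')" "star_subalgebra (\<N> (left_nb R r'))"
      using incr_in_filtration[OF N ad R r(1)] N r0 by (auto simp: filtration_def)
    then have "star (incr M R r) \<in> \<N> (left_nb R r')" by (simp add: star_subalgebra_def)
    then show "E (star (incr M R r) * incr M R r') = 0"
      by (rule martingale_incr_orthogonal[OF M R r(2) r0(2)])
  qed
  then show ?thesis by (simp add: sum_incr[OF R t])
qed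

end

context two_states
begin

text \<open>Passing to a common refinement, the difference of two sums becomes a sum over the refinement.
  Its martingale part consists of orthogonal terms, because each coefficient is evaluated at or
  before the left end point; its remaining part is controlled by the total variation.\<close>

lemma left_sums_close:
  fixes H :: "real \<Rightarrow> 'b list \<Rightarrow> 'c"
  assumes NB: "filtration NB" and NC: "filtration NC" and t: "0 \<le> t"
    and M: "martingale EB NB M"
    and X: "\<And>s. 0 \<le> s \<Longrightarrow> X s = X 0 + M s + B s"
    and K: "\<And>P. is_partition t P \<Longrightarrow> (\<Sum>s\<in>P. norm (incr B P s)) \<le> K"
    and H: "\<And>s. 0 \<le> s \<Longrightarrow> s \<le> t \<Longrightarrow> H s \<in> FF EB NB EC NC 1 s"
    and lin: "\<And>s. 0 \<le> s \<Longrightarrow> s \<le> t \<Longrightarrow> linear (\<lambda>x. H s [x])"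
    and e: "0 \<le> e"
    and close: "\<And>s s' h. 0 \<le> s \<Longrightarrow> s \<le> t \<Longrightarrow> 0 \<le> s' \<Longrightarrow> s' \<le> t \<Longrightarrow> \<bar>s - s'\<bar> < d \<Longrightarrow>
        C.norm2 (H s [h] - H s' [h]) \<le> e * B.norm2 h"
    and P: "is_partition t P" "mesh P < d" and P': "is_partition t P'" "mesh P' < d"
  shows "C.norm2 ((\<Sum>s\<in>P. H (left_nb P s) [incr X P s]) - (\<Sum>s\<in>P'. H (left_nb P' s) [incr X P' s]))
    \<le> e * (B.norm2 (M t - M 0) + K)"
proof -
  define R where "R = P \<union> P'"
  have R: "is_partition t R" using is_partition_Un[OF P(1) P'(1)] by (simp add: R_def)
  define a where "a P r = left_nb P (next_nb P r)" for P r
  have a: "0 \<le> a P r" "a P r \<le> t" "a P r \<le> left_nb R r" "left_nb R r \<le> r" "r < a P r + d"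
    if P: "is_partition t P" "mesh P < d" "P \<subseteq> R" and r: "r \<in> R" for P r
    using refine_bounds[OF P(1,2) R P(3) r] left_nb_bounds[OF P(1) refine_bounds(1)[OF P(1,2) R P(3) r]]
      left_nb_bounds[OF R r] partition_le[OF R r] by (auto simp: a_def)
  have refine: "(\<Sum>s\<in>P. H (left_nb P s) [incr X P s]) = (\<Sum>r\<in>R. H (a P r) [incr X R r])"
    if P: "is_partition t P" "P \<subseteq> R" for P
    unfolding a_def
    using left_nb_bounds[OF P(1)] partition_le[OF P(1)] linear_add[OF lin]
    by (intro sum_incr_refine[OF P(1) R P(2), of "\<lambda>s x. H (left_nb P s) [x]"]) (meson order_trans)
  define G where "G r x = H (a P r) [x] - H (a P' r) [x]" for r x
  have PR: "P \<subseteq> R" "P' \<subseteq> R" by (auto simp: R_def)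
  note aP = a[OF P PR(1)] and aP' = a[OF P' PR(2)]
  have linG: "linear (G r)" if "r \<in> R" for r
    unfolding G_def by (intro linear_compose_sub lin aP aP' that)
  have boundG: "C.norm2 (G r x) \<le> e * B.norm2 x" if "r \<in> R" for r x
    unfolding G_def by (rule close) (use aP[OF that] aP'[OF that] in auto)
  have X_split: "incr X R r = incr M R r + incr B R r" if r: "r \<in> R" for r
    using X[OF partition_nonneg[OF R r]] X[OF left_nb_bounds(1)[OF R r]] by (simp add: incr_def)
  have "(\<Sum>s\<in>P. H (left_nb P s) [incr X P s]) - (\<Sum>s\<in>P'. H (left_nb P' s) [incr X P' s])
      = (\<Sum>r\<in>R. G r (incr X R r))"
    unfolding refine[OF P(1) PR(1)] refine[OF P'(1) PR(2)] G_def sum_subtractf ..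
  also have "\<dots> = (\<Sum>r\<in>R. G r (incr M R r)) + (\<Sum>r\<in>R. G r (incr B R r))"
    unfolding sum.distrib[symmetric] by (rule sum.cong) (auto simp: X_split linear_add[OF linG])
  finally have split: "(\<Sum>s\<in>P. H (left_nb P s) [incr X P s]) - (\<Sum>s\<in>P'. H (left_nb P' s) [incr X P' s])
      = (\<Sum>r\<in>R. G r (incr M R r)) + (\<Sum>r\<in>R. G r (incr B R r))" .
  have ad: "adapted NB M" using M by (simp add: martingale_def)
  have "(C.norm2 (\<Sum>r\<in>R. G r (incr M R r)))\<^sup>2 = (\<Sum>r\<in>R. (C.norm2 (G r (incr M R r)))\<^sup>2)"
  proof (rule C.norm2_sum_orthogonal)
    show "finite R" using R by (simp add: is_partition_def)
    fix r r' assume r: "r \<in> R" "r' \<in> R" "r < r'"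
    have r0: "0 \<le> r" "r' \<noteq> 0" using partition_nonneg[OF R] r by force+
    define u where "u = left_nb R r'"
    have ru: "r \<le> u" unfolding u_def by (rule left_nb_ge[OF R r(2) r0(2) r(1) r(3)])
    then have u0: "0 \<le> u" using r0 by simp
    have subC: "star_subalgebra (NC u)" and subB: "star_subalgebra (NB u)" and NCu: "NC r \<subseteq> NC u"
      using NB NC ru r0 by (auto simp: filtration_def)
    have in_C: "H s [incr M R r] \<in> NC u" if s: "0 \<le> s" "s \<le> t" "s \<le> r" for s
    proof -
      have "H s [incr M R r] \<in> NC r"
        using H[OF s(1,2)] s(3) B.incr_in_filtration[OF NB ad R r(1)] by (auto simp: FF_def)
      then show ?thesis using NCu by blast
    qed
    have orth: "EC (c * H s [incr M R r']) = 0" if s: "0 \<le> s" "s \<le> t" "s \<le> u" and c: "c \<in> NC u" for s c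
      by (rule FF_preserves_zero_expectation[OF H[OF s(1,2)] s(3) subB _ c])
         (unfold u_def, rule B.martingale_incr_orthogonal[OF M R r(2) r0(2)])
    have st: "star x \<in> NC u" if "x \<in> NC u" for x using subC that by (simp add: star_subalgebra_def)
    note s1 = aP[OF r(1)] and s2 = aP'[OF r(1)] and s3 = aP[OF r(2)] and s4 = aP'[OF r(2)]
    have "EC (star (H s [incr M R r]) * G r' (incr M R r')) = 0" if s: "0 \<le> s" "s \<le> t" "s \<le> r" for s
      using orth[OF s3(1,2) _ st[OF in_C[OF s]]] orth[OF s4(1,2) _ st[OF in_C[OF s]]] s3(3) s4(3)
      by (simp add: G_def right_diff_distrib C.E_diff u_def)
    from this[OF s1(1,2)] this[OF s2(1,2)]
    show "EC (star (G r (incr M R r)) * G r' (incr M R r')) = 0"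
      using s1 s2 by (simp add: G_def[of r] star_diff left_diff_distrib C.E_diff)
  qed
  also have "\<dots> \<le> (\<Sum>r\<in>R. e\<^sup>2 * (B.norm2 (incr M R r))\<^sup>2)"
    unfolding power_mult_distrib[symmetric] by (intro sum_mono power_mono boundG) auto
  also have "\<dots> = (e * B.norm2 (M t - M 0))\<^sup>2"
    by (simp add: sum_distrib_left[symmetric] B.sum_norm2_martingale_incr[OF NB M R t]
        power_mult_distrib)
  finally have m: "C.norm2 (\<Sum>r\<in>R. G r (incr M R r)) \<le> e * B.norm2 (M t - M 0)"
    by (rule power2_le_imp_le) (simp add: e)
  have "C.norm2 (\<Sum>r\<in>R. G r (incr B R r)) \<le> (\<Sum>r\<in>R. C.norm2 (G r (incr B R r)))"
    by (rule C.norm2_sum_le)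
  also have "\<dots> \<le> (\<Sum>r\<in>R. e * norm (incr B R r))"
  proof (rule sum_mono)
    fix r assume "r \<in> R"
    then show "C.norm2 (G r (incr B R r)) \<le> e * norm (incr B R r)"
      using boundG[of r "incr B R r"] mult_left_mono[OF B.norm2_le_norm e] order_trans by blast
  qed
  also have "\<dots> \<le> e * K"
    unfolding sum_distrib_left[symmetric] by (rule mult_left_mono[OF K[OF R] e])
  finally have b: "C.norm2 (\<Sum>r\<in>R. G r (incr B R r)) \<le> e * K" .
  show ?thesis
    unfolding split using C.norm2_triangle[of "\<Sum>r\<in>R. G r (incr M R r)" "\<Sum>r\<in>R. G r (incr B R r)"] m b
    by (simp add: distrib_left)
qed

end

section \<open>Differentiation along segments\<close>

lemma subspace_UNIV_or_selfadjoint: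
  "V = UNIV \<or> V = selfadjoint \<Longrightarrow> subspace (V :: 'a::cstar_algebra set)"
  by (auto simp: subspace_def selfadjoint_iff star_add)

lemma norm_le_opnorm:
  assumes "length hs = k" "set hs \<subseteq> V" "\<forall>h\<in>set hs. norm h \<le> 1"
  shows "ennreal (norm (\<Lambda> hs)) \<le> opnorm V k \<Lambda>"
  unfolding opnorm_def by (rule SUP_upper) (use assms in simp)

lemma multilinear_Cons:
  assumes "multilinear (Suc k) \<Lambda>" "length hs = k" shows "linear (\<lambda>x. \<Lambda> (x # hs))"
  using assms(1)[unfolded multilinear_def, rule_format, of "0 # hs" 0] assms(2) by simp

lemma Ck_derivs_multilinear:
  assumes "Ck_derivs V S k f D" "i \<le> k" "x \<in> S" shows "multilinear i (D i x)"
  using assms by (auto simp: Ck_derivs_def multilinear_on_def cmultilinear_def split: if_splits)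

lemma Ck_derivs_segment:
  fixes f :: "'a::cstar_algebra \<Rightarrow> 'c::cstar_algebra"
  assumes D: "Ck_derivs V S k f D" and i: "i < k"
    and path: "\<And>\<theta>. \<theta> \<in> {0..1} \<Longrightarrow> x + \<theta> *\<^sub>R h \<in> S" and \<theta>: "\<theta> \<in> {0..1}"
    and hs: "length hs = i" "set hs \<subseteq> V" "\<forall>h\<in>set hs. norm h \<le> 1"
  shows "((\<lambda>\<theta>. D i (x + \<theta> *\<^sub>R h) hs) has_vector_derivative D (Suc i) (x + \<theta> *\<^sub>R h) (h # hs))
    (at \<theta> within {0..1})"
  unfolding has_vector_derivative_def has_derivative_within_alt
proof (intro conjI allI impI)
  define z where "z = x + \<theta> *\<^sub>R h"
  define L where "L = D (Suc i) z (h # hs)"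
  show "bounded_linear (\<lambda>xa. xa *\<^sub>R D (Suc i) (x + \<theta> *\<^sub>R h) (h # hs))"
    by (rule bounded_linear_scaleR_left)
  fix e :: real assume e: "e > 0"
  define c where "c = norm h + 1"
  have c: "c > 0" by (simp add: c_def add_nonneg_pos)
  have z: "z \<in> S" unfolding z_def by (rule path[OF \<theta>])
  have lin: "linear (\<lambda>k. D (Suc i) z (k # hs))"
    by (rule multilinear_Cons[OF Ck_derivs_multilinear[OF D _ z] hs(1)]) (use i in simp)
  define \<Psi> where "\<Psi> y hs = D i y hs - D i z hs - D (Suc i) z ((y - z) # hs)" for y hs
  have "((\<lambda>y. opnorm V i (\<Psi> y) / ennreal (norm (y - z))) \<longlongrightarrow> 0) (at z within S)"
    using D i z unfolding Ck_derivs_def \<Psi>_def by blast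
  then have "\<forall>\<^sub>F y in at z within S. opnorm V i (\<Psi> y) / ennreal (norm (y - z)) < ennreal (e / c)"
    by (rule order_tendstoD(2)) (use e c in simp)
  then obtain r where r: "r > 0" "\<And>y. y \<in> S \<Longrightarrow> y \<noteq> z \<Longrightarrow> dist y z < r \<Longrightarrow>
      opnorm V i (\<Psi> y) / ennreal (norm (y - z)) < ennreal (e / c)"
    unfolding eventually_at by blast
  have "norm (D i (x + \<eta> *\<^sub>R h) hs - D i z hs - (\<eta> - \<theta>) *\<^sub>R L) \<le> e * norm (\<eta> - \<theta>)"
    if \<eta>: "\<eta> \<in> {0..1}" and near: "norm (\<eta> - \<theta>) < r / c" for \<eta>
  proof -
    define y where "y = x + \<eta> *\<^sub>R h"
    have y: "y \<in> S" unfolding y_def by (rule path[OF \<eta>])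
    have yz: "y - z = (\<eta> - \<theta>) *\<^sub>R h" by (simp add: y_def z_def algebra_simps)
    have eq: "D i y hs - D i z hs - (\<eta> - \<theta>) *\<^sub>R L = \<Psi> y hs"
      unfolding \<Psi>_def yz L_def using linear_cmul[OF lin, of "\<eta> - \<theta>" h] by simp
    have nyz: "norm (y - z) = \<bar>\<eta> - \<theta>\<bar> * norm h" by (simp add: yz)
    have "\<bar>\<eta> - \<theta>\<bar> * norm h \<le> \<bar>\<eta> - \<theta>\<bar> * c" by (rule mult_left_mono) (auto simp: c_def)
    then have le: "norm (y - z) \<le> \<bar>\<eta> - \<theta>\<bar> * c" by (simp add: nyz)
    have "norm (\<Psi> y hs) \<le> e / c * norm (y - z)"
    proof (cases "y = z")
      case True
      then show ?thesis using linear_0[OF lin] by (simp add: \<Psi>_def)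
    next
      case False
      have "\<bar>\<eta> - \<theta>\<bar> * c < r" using near c by (simp add: pos_less_divide_eq)
      then have "dist y z < r" using le by (simp add: dist_norm)
      from r(2)[OF y False this] have "opnorm V i (\<Psi> y) < ennreal (e / c) * ennreal (norm (y - z))"
        using False by (subst (asm) divide_less_ennreal) auto
      also have "\<dots> = ennreal (e / c * norm (y - z))"
        by (rule ennreal_mult[symmetric]) (use e c in auto)
      finally have "ennreal (norm (\<Psi> y hs)) \<le> ennreal (e / c * norm (y - z))"
        using norm_le_opnorm[OF hs, of "\<Psi> y"] by simp
      then show ?thesis using e c by (simp add: ennreal_le_iff)
    qed
    also have "\<dots> \<le> e / c * (\<bar>\<eta> - \<theta>\<bar> * c)" using le e c by (intro mult_left_mono) auto
    also have "\<dots> = e * norm (\<eta> - \<theta>)" using c by simp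
    finally show ?thesis using eq by (simp add: y_def)
  qed
  then show "\<exists>d>0. \<forall>y\<in>{0..1}. norm (y - \<theta>) < d \<longrightarrow>
      norm (D i (x + y *\<^sub>R h) hs - D i (x + \<theta> *\<^sub>R h) hs
        - (y - \<theta>) *\<^sub>R D (Suc i) (x + \<theta> *\<^sub>R h) (h # hs)) \<le> e * norm (y - \<theta>)"
    using r(1) c unfolding z_def L_def by (intro exI[of _ "r / c"]) auto
qed

lemma Ck_derivs_segment_0:
  fixes f :: "'a::cstar_algebra \<Rightarrow> 'c::cstar_algebra"
  assumes D: "Ck_derivs V S k f D" and k: "0 < k"
    and path: "\<And>\<theta>. \<theta> \<in> {0..1} \<Longrightarrow> x + \<theta> *\<^sub>R h \<in> S" and \<theta>: "\<theta> \<in> {0..1}"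
  shows "((\<lambda>\<theta>. f (x + \<theta> *\<^sub>R h)) has_vector_derivative D 1 (x + \<theta> *\<^sub>R h) [h]) (at \<theta> within {0..1})"
proof -
  have deriv: "((\<lambda>\<theta>. D 0 (x + \<theta> *\<^sub>R h) []) has_vector_derivative D (Suc 0) (x + \<theta> *\<^sub>R h) [h])
      (at \<theta> within {0..1})"
    by (rule Ck_derivs_segment[OF D k path \<theta>]) auto
  have eq: "f (x + \<eta> *\<^sub>R h) = D 0 (x + \<eta> *\<^sub>R h) []" if "\<eta> \<in> {0..1}" for \<eta>
    using D path[OF that] by (simp add: Ck_derivs_def)
  from has_vector_derivative_transform[OF \<theta> eq deriv] show ?thesis by simp
qed

text \<open>The operator norm tests directions in the unit ball only, so the derivative is taken in the
  normalised direction and then rescaled by linearity.\<close>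

lemma Ck_derivs_segment_1:
  fixes f :: "'a::cstar_algebra \<Rightarrow> 'c::cstar_algebra"
  assumes D: "Ck_derivs V S k f D" and k: "1 < k" and V: "subspace V" "h \<in> V"
    and path: "\<And>\<theta>. \<theta> \<in> {0..1} \<Longrightarrow> x + \<theta> *\<^sub>R h \<in> S" and \<theta>: "\<theta> \<in> {0..1}"
  shows "((\<lambda>\<theta>. D 1 (x + \<theta> *\<^sub>R h) [h]) has_vector_derivative D 2 (x + \<theta> *\<^sub>R h) [h, h])
    (at \<theta> within {0..1})"
proof -
  define c where "c = norm h"
  define g where "g = (1 / c) *\<^sub>R h"
  have g: "g \<in> V" "norm g \<le> 1" and h: "h = c *\<^sub>R g"
    using V by (auto simp: g_def c_def subspace_def)
  have lin1: "linear (\<lambda>k. D 1 y [k])" if "y \<in> S" for y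
    using multilinear_Cons[of 0 "D 1 y" "[]"] Ck_derivs_multilinear[OF D, of 1 y] k that by simp
  have lin2: "linear (\<lambda>l. D 2 y [h, l])" if "y \<in> S" for y
  proof -
    have "multilinear 2 (D 2 y)" by (rule Ck_derivs_multilinear[OF D _ that]) (use k in simp)
    from this[unfolded multilinear_def, rule_format, of "[h, h]" 1] show ?thesis by simp
  qed
  have "((\<lambda>\<theta>. D 1 (x + \<theta> *\<^sub>R h) [g]) has_vector_derivative D (Suc 1) (x + \<theta> *\<^sub>R h) [h, g])
      (at \<theta> within {0..1})"
    by (rule Ck_derivs_segment[OF D k path \<theta>]) (use g in auto)
  then have "((\<lambda>\<theta>. c *\<^sub>R D 1 (x + \<theta> *\<^sub>R h) [g]) has_vector_derivative
      c *\<^sub>R D (Suc 1) (x + \<theta> *\<^sub>R h) [h, g]) (at \<theta> within {0..1})"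
    by (rule bounded_linear.has_vector_derivative[OF bounded_linear_scaleR_right])
  moreover have "c *\<^sub>R D (Suc 1) (x + \<theta> *\<^sub>R h) [h, g] = D 2 (x + \<theta> *\<^sub>R h) [h, h]"
    using linear_cmul[OF lin2[OF path[OF \<theta>]], of c g] h by (simp add: numeral_2_eq_2)
  ultimately have deriv: "((\<lambda>\<theta>. c *\<^sub>R D 1 (x + \<theta> *\<^sub>R h) [g]) has_vector_derivative
      D 2 (x + \<theta> *\<^sub>R h) [h, h]) (at \<theta> within {0..1})" by simp
  have eq: "D 1 (x + \<eta> *\<^sub>R h) [h] = c *\<^sub>R D 1 (x + \<eta> *\<^sub>R h) [g]" if "\<eta> \<in> {0..1}" for \<eta>
    using linear_cmul[OF lin1[OF path[OF that]], of c g] h by simp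
  from has_vector_derivative_transform[OF \<theta> eq deriv] show ?thesis .
qed

context tracial_state
begin

lemma bounded_linear_Re_E: "bounded_linear (\<lambda>y. Re (E (b * y)))"
proof (rule bounded_linear_intro[where K = "norm b"])
  fix y :: 'a
  have "\<bar>Re (E (b * y))\<bar> \<le> cmod (E (b * y))" by (rule abs_Re_le_cmod)
  also have "\<dots> \<le> norm (b * y)" by (rule norm_E_le)
  also have "\<dots> \<le> norm y * norm b" using norm_mult_ineq[of b y] by (simp add: mult.commute)
  finally show "norm (Re (E (b * y))) \<le> norm y * norm b" by simp
qed (simp_all add: distrib_left E_add E_scaleR)

text \<open>There is no mean value equality for maps into the algebra. By duality it is enough to apply
  the real one to \<open>\<theta> \<mapsto> Re E[b g(\<theta>)]\<close> for each \<open>b\<close> in the unit ball.\<close>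

lemma real_mean_value:
  assumes g: "\<And>\<theta>. \<theta> \<in> {0..1} \<Longrightarrow> (g has_vector_derivative g' \<theta>) (at \<theta> within {0..1})"
    and "0 < (c::real)" "c \<le> 1"
  obtains \<xi> where "\<xi> \<in> {0<..<c}" "Re (E (b * g c)) - Re (E (b * g 0)) = c * Re (E (b * g' \<xi>))"
proof -
  have "\<exists>\<xi>\<in>{0<..<c}. Re (E (b * g c)) - Re (E (b * g 0)) = (\<lambda>x. x *\<^sub>R Re (E (b * g' \<xi>))) (c - 0)"
  proof (rule mvt_simple[OF assms(2)])
    fix x assume x: "0 \<le> x" "x \<le> c"
    then have "(g has_vector_derivative g' x) (at x within {0..c})"
      using assms(3) by (intro has_vector_derivative_within_subset[OF g]) auto
    from bounded_linear.has_vector_derivative[OF bounded_linear_Re_E this]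
    show "((\<lambda>x. Re (E (b * g x))) has_derivative (\<lambda>y. y *\<^sub>R Re (E (b * g' x)))) (at x within {0..c})"
      by (simp add: has_vector_derivative_def)
  qed
  then show ?thesis using that by auto
qed

lemma norm1_first_order:
  assumes g: "\<And>\<theta>. \<theta> \<in> {0..1::real} \<Longrightarrow> (g has_vector_derivative g' \<theta>) (at \<theta> within {0..1})"
    and M: "\<And>\<theta>. \<theta> \<in> {0..1} \<Longrightarrow> norm1 (g' \<theta> - L) \<le> M"
  shows "norm1 (g 1 - g 0 - L) \<le> M"
proof (rule norm1_leI)
  fix b :: 'a assume b: "norm b \<le> 1"
  obtain \<xi> where \<xi>: "\<xi> \<in> {0<..<1}" "Re (E (b * g 1)) - Re (E (b * g 0)) = 1 * Re (E (b * g' \<xi>))"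
    by (rule real_mean_value[OF g, of 1 b]) auto
  then have "Re (E (b * (g 1 - g 0 - L))) = Re (E (b * (g' \<xi> - L)))"
    by (simp add: right_diff_distrib E_diff)
  also have "\<dots> \<le> norm1 (g' \<xi> - L)" by (rule Re_E_mult_le[OF b])
  also have "\<dots> \<le> M" using \<xi> by (intro M) auto
  finally show "Re (E (b * (g 1 - g 0 - L))) \<le> M" .
qed

text \<open>Subtracting the quadratic Taylor polynomial and applying the mean value theorem twice leaves
  \<open>\<xi> (g''(\<zeta>) - g''(0))\<close> with \<open>0 < \<zeta> < \<xi> < 1\<close>.\<close>

lemma norm1_second_order:
  assumes g: "\<And>\<theta>. \<theta> \<in> {0..1::real} \<Longrightarrow> (g has_vector_derivative g' \<theta>) (at \<theta> within {0..1})"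
    and g': "\<And>\<theta>. \<theta> \<in> {0..1::real} \<Longrightarrow> (g' has_vector_derivative g'' \<theta>) (at \<theta> within {0..1})"
    and M: "\<And>\<theta>. \<theta> \<in> {0..1} \<Longrightarrow> norm1 (g'' \<theta> - g'' 0) \<le> M"
  shows "norm1 (g 1 - g 0 - g' 0 - (1/2) *\<^sub>R g'' 0) \<le> M"
proof (rule norm1_leI)
  fix b :: 'a assume b: "norm b \<le> 1"
  define k where "k \<theta> = g \<theta> - \<theta> *\<^sub>R g' 0 - (\<theta>\<^sup>2 / 2) *\<^sub>R g'' 0" for \<theta>
  define k' where "k' \<theta> = g' \<theta> - g' 0 - \<theta> *\<^sub>R g'' 0" for \<theta>
  have k: "(k has_vector_derivative k' \<theta>) (at \<theta> within {0..1})" if "\<theta> \<in> {0..1}" for \<theta>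
    unfolding k_def k'_def
    by (rule derivative_eq_intros g[OF that] refl | simp)+
  have M0: "0 \<le> M" using M[of 0] norm1_nonneg[of "g'' 0 - g'' 0"] by simp
  obtain \<xi> where \<xi>: "\<xi> \<in> {0<..<1}" "Re (E (b * k 1)) - Re (E (b * k 0)) = 1 * Re (E (b * k' \<xi>))"
    by (rule real_mean_value[OF k, of 1 b]) auto
  obtain \<zeta> where \<zeta>: "\<zeta> \<in> {0<..<\<xi>}" "Re (E (b * g' \<xi>)) - Re (E (b * g' 0)) = \<xi> * Re (E (b * g'' \<zeta>))"
    by (rule real_mean_value[OF g', of \<xi> b]) (use \<xi> in auto)
  have "Re (E (b * (g 1 - g 0 - g' 0 - (1/2) *\<^sub>R g'' 0))) = Re (E (b * k 1)) - Re (E (b * k 0))"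
    by (simp add: k_def right_diff_distrib E_diff)
  also have "\<dots> = \<xi> * Re (E (b * (g'' \<zeta> - g'' 0)))"
    using \<xi>(2) \<zeta>(2) by (simp add: k'_def right_diff_distrib E_diff E_scaleR)
  also have "\<dots> \<le> \<xi> * M"
    using \<xi>(1) \<zeta>(1) order_trans[OF Re_E_mult_le[OF b] M, of \<zeta>] by (intro mult_left_mono) auto
  also have "\<dots> \<le> 1 * M" using \<xi>(1) M0 by (intro mult_right_mono) auto
  finally show "Re (E (b * (g 1 - g 0 - g' 0 - (1/2) *\<^sub>R g'' 0))) \<le> M" by simp
qed

end

section \<open>Uniformity along a compact path\<close>

text \<open>A Lebesgue number argument. Both points are compared with the centre \<open>u\<close> of a common ball, which
  leaves the triangle inequality to be applied to the values of the maps.\<close>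

lemma cont_wrt_compact:
  fixes D :: "'u::metric_space \<Rightarrow> 'a list \<Rightarrow> 'c::cstar_algebra"
  assumes cont: "cont_wrt N S D" and N0: "N (\<lambda>_. 0) = 0" and K: "compact K" "K \<subseteq> S" and e: "0 < e"
  obtains d where "d > 0" "\<And>p v. p \<in> K \<Longrightarrow> v \<in> S \<Longrightarrow> dist v p < d \<Longrightarrow>
    \<exists>u\<in>S. N (\<lambda>hs. D v hs - D u hs) < e \<and> N (\<lambda>hs. D p hs - D u hs) < e"
proof -
  have "\<exists>r>0. \<forall>v\<in>S. dist v u < r \<longrightarrow> N (\<lambda>hs. D v hs - D u hs) < e" if u: "u \<in> S" for u
  proof -
    have "((\<lambda>v. N (\<lambda>hs. D v hs - D u hs)) \<longlongrightarrow> 0) (at u within S)"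
      using cont u by (simp add: cont_wrt_def)
    then have "\<forall>\<^sub>F v in at u within S. N (\<lambda>hs. D v hs - D u hs) < e"
      by (rule order_tendstoD(2)) (rule e)
    then obtain r where "r > 0" "\<And>v. v \<in> S \<Longrightarrow> v \<noteq> u \<Longrightarrow> dist v u < r \<Longrightarrow> N (\<lambda>hs. D v hs - D u hs) < e"
      unfolding eventually_at by blast
    moreover have "N (\<lambda>hs. D u hs - D u hs) < e" using N0 e by simp
    ultimately show ?thesis by metis
  qed
  then obtain r where r: "\<And>u. u \<in> S \<Longrightarrow> r u > 0"
    "\<And>u v. u \<in> S \<Longrightarrow> v \<in> S \<Longrightarrow> dist v u < r u \<Longrightarrow> N (\<lambda>hs. D v hs - D u hs) < e" by metis
  have cover: "K \<subseteq> \<Union>((\<lambda>u. ball u (r u)) ` S)" using K(2) r(1) by force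
  obtain d where d: "d > 0" "\<And>p. p \<in> K \<Longrightarrow> \<exists>G\<in>(\<lambda>u. ball u (r u)) ` S. ball p d \<subseteq> G"
    using Heine_Borel_lemma[OF K(1) cover] by auto
  show ?thesis
  proof (rule that[OF d(1)])
    fix p v assume pv: "p \<in> K" "v \<in> S" "dist v p < d"
    obtain u where u: "u \<in> S" "ball p d \<subseteq> ball u (r u)" using d(2)[OF pv(1)] by auto
    have "p \<in> ball p d" "v \<in> ball p d" using d(1) pv(3) by (auto simp: dist_commute)
    then have "p \<in> ball u (r u)" "v \<in> ball u (r u)" using u(2) by blast+
    then have "N (\<lambda>hs. D v hs - D u hs) < e" "N (\<lambda>hs. D p hs - D u hs) < e"
      using r(2)[OF u(1)] pv K(2) by (auto simp: dist_commute)
    then show "\<exists>u\<in>S. N (\<lambda>hs. D v hs - D u hs) < e \<and> N (\<lambda>hs. D p hs - D u hs) < e"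
      using u(1) by blast
  qed
qed

lemma multilinear_diff:
  assumes "multilinear k f" "multilinear k g" shows "multilinear k (\<lambda>hs. f hs - g hs)"
  unfolding multilinear_def
  by (intro allI impI linear_compose_sub assms[unfolded multilinear_def, rule_format])

context two_states
begin

lemma trinorm_zero: "trinorm EB EC k (\<lambda>_. 0) = 0"
proof -
  have z: "pnorm EC q 0 = 0" if "1 \<le> q" for q
    using C.pnorm_zero[OF that] by (cases "q = top") (auto simp: pnorm_def[of _ top] less_top)
  have pp: "pp_norm EB EC ps q (\<lambda>_. 0) \<le> 0" if "1 \<le> q" for ps q
    unfolding pp_norm_def by (rule SUP_least) (simp add: z[OF that])
  have "trinorm EB EC k (\<lambda>_. 0) \<le> 0"
    unfolding trinorm_def by (rule SUP_least) (use pp in auto)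
  then show ?thesis by simp
qed

lemma uniformly_close:
  fixes D :: "'u::metric_space \<Rightarrow> 'b list \<Rightarrow> 'c"
  assumes cont: "cont_wrt (trinorm EB EC k) S D" and D: "\<And>u. u \<in> S \<Longrightarrow> D u \<in> BB EB EC k"
    and K: "compact K" "K \<subseteq> S" and e: "0 < e"
  obtains d where "d > 0" "\<And>p v. p \<in> K \<Longrightarrow> v \<in> S \<Longrightarrow> dist v p < d \<Longrightarrow> \<exists>u. \<forall>w\<in>{v, p}.
    multilinear k (\<lambda>hs. D w hs - D u hs) \<and> trinorm EB EC k (\<lambda>hs. D w hs - D u hs) \<le> ennreal (e/2)"
proof -
  have e2: "0 < ennreal (e/2)" using e by simp
  obtain d where d: "d > 0" "\<And>p v. p \<in> K \<Longrightarrow> v \<in> S \<Longrightarrow> dist v p < d \<Longrightarrow>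
    \<exists>u\<in>S. trinorm EB EC k (\<lambda>hs. D v hs - D u hs) < ennreal (e/2) \<and>
      trinorm EB EC k (\<lambda>hs. D p hs - D u hs) < ennreal (e/2)"
    using cont_wrt_compact[OF cont trinorm_zero K e2] by blast
  show ?thesis
  proof (rule that[OF d(1)])
    fix p v assume pv: "p \<in> K" "v \<in> S" "dist v p < d"
    have pS: "p \<in> S" using pv K by blast
    obtain u where u: "u \<in> S" "trinorm EB EC k (\<lambda>hs. D v hs - D u hs) < ennreal (e/2)"
      "trinorm EB EC k (\<lambda>hs. D p hs - D u hs) < ennreal (e/2)"
      using d(2)[OF pv] by auto
    have "multilinear k (\<lambda>hs. D w hs - D u hs)" if "w \<in> S" for w
      using D[OF that] D[OF u(1)] by (intro multilinear_diff) (auto simp: BB_def)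
    then show "\<exists>u. \<forall>w\<in>{v, p}. multilinear k (\<lambda>hs. D w hs - D u hs) \<and>
        trinorm EB EC k (\<lambda>hs. D w hs - D u hs) \<le> ennreal (e/2)"
      using u pv(2) pS by (intro exI[of _ u]) auto
  qed
qed

lemma uniformly_close_linear:
  fixes D :: "'u::metric_space \<Rightarrow> 'b list \<Rightarrow> 'c"
  assumes cont: "cont_wrt (trinorm EB EC 1) S D" and D: "\<And>u. u \<in> S \<Longrightarrow> D u \<in> BB EB EC 1"
    and K: "compact K" "K \<subseteq> S" and e: "0 < e"
  obtains d where "d > 0" "\<And>p v h. p \<in> K \<Longrightarrow> v \<in> S \<Longrightarrow> dist v p < d \<Longrightarrow>
    norm (D v [h] - D p [h]) \<le> e * norm h \<and> C.norm2 (D v [h] - D p [h]) \<le> e * B.norm2 h"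
proof (rule uniformly_close[OF cont D K e])
  fix d assume d: "d > 0" and close: "\<And>p v. p \<in> K \<Longrightarrow> v \<in> S \<Longrightarrow> dist v p < d \<Longrightarrow> \<exists>u. \<forall>w\<in>{v, p}.
    multilinear 1 (\<lambda>hs. D w hs - D u hs) \<and> trinorm EB EC 1 (\<lambda>hs. D w hs - D u hs) \<le> ennreal (e/2)"
  show ?thesis
  proof (rule that[OF d])
    fix p v h assume "p \<in> K" "v \<in> S" "dist v p < d"
    from close[OF this] obtain u where u: "\<And>w. w \<in> {v, p} \<Longrightarrow> multilinear 1 (\<lambda>hs. D w hs - D u hs)"
      "\<And>w. w \<in> {v, p} \<Longrightarrow> trinorm EB EC 1 (\<lambda>hs. D w hs - D u hs) \<le> ennreal (e/2)" by blast
    have b: "norm (D w [h] - D u [h]) \<le> e/2 * norm h \<and> C.norm2 (D w [h] - D u [h]) \<le> e/2 * B.norm2 h"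
      if "w \<in> {v, p}" for w
      using trinorm_bound_linear[OF u(1)[OF that] u(2)[OF that], of h] e by simp
    show "norm (D v [h] - D p [h]) \<le> e * norm h \<and> C.norm2 (D v [h] - D p [h]) \<le> e * B.norm2 h"
      using b[of v] b[of p] norm_triangle_ineq[of "D v [h] - D u [h]" "D u [h] - D p [h]"]
        C.L2.N_diff_triangle[of "D v [h]" "D p [h]" "D u [h]"]
      by (simp add: norm_minus_commute[of "D u [h]"] C.L2.N_diff_commute[of "D u [h]"])
  qed
qed

lemma uniformly_close_quadratic:
  fixes D :: "'u::metric_space \<Rightarrow> 'b list \<Rightarrow> 'c"
  assumes cont: "cont_wrt (trinorm EB EC 2) S D" and D: "\<And>u. u \<in> S \<Longrightarrow> D u \<in> BB EB EC 2"
    and K: "compact K" "K \<subseteq> S" and e: "0 < e"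
  obtains d where "d > 0" "\<And>p v h. p \<in> K \<Longrightarrow> v \<in> S \<Longrightarrow> dist v p < d \<Longrightarrow>
    C.norm1 (D v [h, h] - D p [h, h]) \<le> e * (B.norm2 h)\<^sup>2"
proof (rule uniformly_close[OF cont D K e])
  fix d assume d: "d > 0" and close: "\<And>p v. p \<in> K \<Longrightarrow> v \<in> S \<Longrightarrow> dist v p < d \<Longrightarrow> \<exists>u. \<forall>w\<in>{v, p}.
    multilinear 2 (\<lambda>hs. D w hs - D u hs) \<and> trinorm EB EC 2 (\<lambda>hs. D w hs - D u hs) \<le> ennreal (e/2)"
  show ?thesis
  proof (rule that[OF d])
    fix p v h assume "p \<in> K" "v \<in> S" "dist v p < d"
    from close[OF this] obtain u where u: "\<And>w. w \<in> {v, p} \<Longrightarrow> multilinear 2 (\<lambda>hs. D w hs - D u hs)"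
      "\<And>w. w \<in> {v, p} \<Longrightarrow> trinorm EB EC 2 (\<lambda>hs. D w hs - D u hs) \<le> ennreal (e/2)" by blast
    have b: "C.norm1 (D w [h, h] - D u [h, h]) \<le> e/2 * (B.norm2 h)\<^sup>2" if "w \<in> {v, p}" for w
      using trinorm_bound_quadratic[OF u(1)[OF that] u(2)[OF that], of h] e by simp
    show "C.norm1 (D v [h, h] - D p [h, h]) \<le> e * (B.norm2 h)\<^sup>2"
      using b[of v] b[of p] C.L1.N_diff_triangle[of "D v [h, h]" "D p [h, h]" "D u [h, h]"]
      by (simp add: C.L1.N_diff_commute[of "D u [h, h]"])
  qed
qed

lemma has_L2_integral_exists:
  fixes H :: "real \<Rightarrow> 'b list \<Rightarrow> 'c"
  assumes NB: "filtration NB" and NC: "filtration NC" and t: "0 \<le> t"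
    and M: "martingale EB NB M"
    and X: "\<And>s. 0 \<le> s \<Longrightarrow> X s = X 0 + M s + B s"
    and K: "\<And>P. is_partition t P \<Longrightarrow> (\<Sum>s\<in>P. norm (incr B P s)) \<le> K"
    and H: "\<And>s. 0 \<le> s \<Longrightarrow> s \<le> t \<Longrightarrow> H s \<in> FF EB NB EC NC 1 s"
    and close: "\<And>e. e > 0 \<Longrightarrow> \<exists>d>0. \<forall>s s' h. 0 \<le> s \<longrightarrow> s \<le> t \<longrightarrow> 0 \<le> s' \<longrightarrow> s' \<le> t \<longrightarrow>
        \<bar>s - s'\<bar> < d \<longrightarrow> C.norm2 (H s [h] - H s' [h]) \<le> e * B.norm2 h"
  obtains \<sigma> where "pCauchy EC 2 \<sigma>" "has_L2_integral EC H X t (pclass EC 2 \<sigma>)"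
    "\<forall>e>0. \<exists>d>0. \<forall>P. is_partition t P \<longrightarrow> mesh P < d \<longrightarrow>
        (\<forall>\<^sub>F n in sequentially. C.norm2 ((\<Sum>s\<in>P. H (left_nb P s) [incr X P s]) - \<sigma> n) \<le> e)"
proof -
  define S where "S P = (\<Sum>s\<in>P. H (left_nb P s) [incr X P s])" for P
  define c where "c = B.norm2 (M t - M 0) + K + 1"
  have "K \<ge> 0" by (rule variation_bound_nonneg[OF K t])
  then have c: "c > 0" "B.norm2 (M t - M 0) + K \<le> c"
    using B.norm2_nonneg[of "M t - M 0"] by (auto simp: c_def add_nonneg_pos)
  have lin: "linear (\<lambda>x. H s [x])" if "0 \<le> s" "s \<le> t" for s
    using H[OF that] by (intro multilinear_1) (auto simp: FF_def BB_def)
  have cauchy: "\<exists>d>0. \<forall>P P'. is_partition t P \<longrightarrow> mesh P < d \<longrightarrow> is_partition t P' \<longrightarrow> mesh P' < d \<longrightarrow>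
      C.norm2 (S P - S P') \<le> e" if e: "e > 0" for e
  proof -
    have e': "e / c > 0" using e c by simp
    obtain d where d: "d > 0" "\<And>s s' h. 0 \<le> s \<Longrightarrow> s \<le> t \<Longrightarrow> 0 \<le> s' \<Longrightarrow> s' \<le> t \<Longrightarrow>
        \<bar>s - s'\<bar> < d \<Longrightarrow> C.norm2 (H s [h] - H s' [h]) \<le> e / c * B.norm2 h"
      using close[OF e'] by blast
    have "C.norm2 (S P - S P') \<le> e"
      if P: "is_partition t P" "mesh P < d" "is_partition t P'" "mesh P' < d" for P P'
    proof -
      have "C.norm2 (S P - S P') \<le> e / c * (B.norm2 (M t - M 0) + K)"
        unfolding S_def
        by (rule left_sums_close[OF NB NC t M X K H lin less_imp_le[OF e'] d(2) P])
      also have "\<dots> \<le> e / c * c" using c e' by (intro mult_left_mono) auto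
      finally show ?thesis using c by simp
    qed
    then show ?thesis using d(1) by blast
  qed
  obtain \<sigma> where \<sigma>: "\<forall>e>0. \<exists>M. \<forall>m\<ge>M. \<forall>n\<ge>M. C.norm2 (\<sigma> m - \<sigma> n) < e"
    and lim: "\<forall>e>0. \<exists>d>0. \<forall>P. is_partition t P \<longrightarrow> mesh P < d \<longrightarrow>
      (\<forall>\<^sub>F n in sequentially. C.norm2 (S P - \<sigma> n) \<le> e)"
    by (rule mesh_Cauchy_sequence[OF t cauchy])
  have pC: "pCauchy EC 2 \<sigma>" using \<sigma> by (simp add: pCauchy_def C.pnorm_2)
  have "Lp_tendsto EC 2 S (pclass EC 2 \<sigma>) (mesh_to_0 t)"
  proof (rule C.L2.Lp_tendstoI[OF pC])
    fix e :: real assume "e > 0"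
    then obtain d where "d > 0" "\<forall>P. is_partition t P \<longrightarrow> mesh P < d \<longrightarrow>
        (\<forall>\<^sub>F n in sequentially. C.norm2 (S P - \<sigma> n) \<le> e)" using lim by blast
    then show "\<forall>\<^sub>F P in mesh_to_0 t. \<forall>\<^sub>F n in sequentially. C.norm2 (S P - \<sigma> n) \<le> e"
      by (intro eventually_mesh_to_0[of d]) auto
  qed
  then have int: "has_L2_integral EC H X t (pclass EC 2 \<sigma>)"
    unfolding has_L2_integral_def S_def .
  show ?thesis
    by (rule that[OF pC int]) (fold S_def, rule lim)
qed

end

section \<open>Ito's formula\<close>

text \<open>The neighbourhood condition in \<open>Ckl_derivs\<close>, for one centre and one radius.\<close>

definition Ckl_box where
  "Ckl_box V W U k l F D1 D2 v w r \<longleftrightarrow> (V \<inter> ball v r) \<times> (W \<inter> ball w r) \<subseteq> U \<and>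
    (\<forall>x' \<in> V \<inter> ball v r. \<forall>y \<in> W \<inter> ball w r.
      Ck_derivs W (W \<inter> ball w r) l (\<lambda>y'. F (x', y')) (\<lambda>j y'. D2 j (x', y')) \<and>
      Ck_derivs V (V \<inter> ball v r) k (\<lambda>x'. F (x', y)) (\<lambda>i x'. D1 i (x', y)))"

text \<open>The radius \<open>d\<close> is a Lebesgue number of the cover of \<open>K\<close> by the boxes.\<close>

lemma Ckl_derivs_uniform_box:
  assumes D: "Ckl_derivs V W U k l F D1 D2" and K: "compact K" "K \<subseteq> U"
  obtains d where "d > 0" "\<And>a x. (a, x) \<in> K \<Longrightarrow> \<exists>v w r. ball a d \<subseteq> ball v r \<and> ball x d \<subseteq> ball w r \<and>
    Ckl_box V W U k l F D1 D2 v w r"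
proof -
  define ok where "ok = Ckl_box V W U k l F D1 D2"
  define G where "G = {ball v r \<times> ball w r | v w r. ok v w r}"
  have "\<exists>r>0. ok v w r" if "(v, w) \<in> U" for v w
    using D that unfolding Ckl_derivs_def ok_def Ckl_box_def by blast
  then have cover: "K \<subseteq> \<Union>G"
  proof -
    assume *: "\<And>v w. (v, w) \<in> U \<Longrightarrow> \<exists>r>0. ok v w r"
    show ?thesis
    proof
      fix p assume "p \<in> K"
      moreover obtain v w where p: "p = (v, w)" by (cases p)
      ultimately obtain r where "r > 0" "ok v w r" using * K(2) by blast
      then show "p \<in> \<Union>G" unfolding G_def p by (intro UnionI[of "ball v r \<times> ball w r"]) auto
    qed
  qed
  have "open g" if "g \<in> G" for g using that by (auto simp: G_def open_Times)
  then obtain d where d: "d > 0" "\<And>p. p \<in> K \<Longrightarrow> \<exists>g\<in>G. ball p d \<subseteq> g"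
    using Heine_Borel_lemma[OF K(1) cover] by metis
  show ?thesis
  proof (rule that[OF d(1)], fold ok_def)
    fix a x assume "(a, x) \<in> K"
    from d(2)[OF this] obtain v w r where g: "ok v w r" "ball (a, x) d \<subseteq> ball v r \<times> ball w r"
      by (auto simp: G_def)
    have "ball a d \<subseteq> ball v r"
    proof
      fix y assume "y \<in> ball a d"
      then have "(y, x) \<in> ball (a, x) d" by (simp add: dist_Pair_Pair)
      then show "y \<in> ball v r" using g(2) by blast
    qed
    moreover have "ball x d \<subseteq> ball w r"
    proof
      fix y assume "y \<in> ball x d"
      then have "(a, y) \<in> ball (a, x) d" by (simp add: dist_Pair_Pair)
      then show "y \<in> ball w r" using g(2) by blast
    qed
    ultimately show "\<exists>v w r. ball a d \<subseteq> ball v r \<and> ball x d \<subseteq> ball w r \<and> ok v w r" using g(1) by blast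
  qed
qed

text \<open>The martingale part contributes the squared 2-norm of its total increment. In the other part, one
  factor of each square is at most \<open>K\<close> and the sum of the other factors is at most \<open>K\<close>.\<close>

lemma (in tracial_state) sum_norm2_incr_bounded:
  assumes N: "filtration \<N>" and M: "martingale E \<N> M" and R: "is_partition t R" and t: "0 \<le> t"
    and X: "\<And>s. 0 \<le> s \<Longrightarrow> X s = X 0 + M s + B s"
    and K: "(\<Sum>s\<in>R. norm (incr B R s)) \<le> K"
  shows "(\<Sum>r\<in>R. (norm2 (incr X R r))\<^sup>2) \<le> 2 * (norm2 (M t - M 0))\<^sup>2 + 2 * K\<^sup>2"
proof -
  have fin: "finite R" using R by (simp add: is_partition_def)
  have "(norm2 (incr X R r))\<^sup>2 \<le> 2 * (norm2 (incr M R r))\<^sup>2 + 2 * (K * norm (incr B R r))"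
    if r: "r \<in> R" for r
  proof -
    have eq: "incr X R r = incr M R r + incr B R r"
      using X[OF partition_nonneg[OF R r]] X[OF left_nb_bounds(1)[OF R r]] by (simp add: incr_def)
    have "norm (incr B R r) \<le> K"
      using member_le_sum[OF r, of "\<lambda>s. norm (incr B R s)"] fin K by simp
    then have "norm2 (incr B R r) \<le> K" "0 \<le> K"
      using norm2_le_norm[of "incr B R r"] norm2_nonneg[of "incr B R r"] by linarith+
    then have "(norm2 (incr B R r))\<^sup>2 \<le> K * norm (incr B R r)"
      unfolding power2_eq_square by (intro mult_mono norm2_le_norm) auto
    moreover have "(norm2 (incr X R r))\<^sup>2 \<le> (norm2 (incr M R r) + norm2 (incr B R r))\<^sup>2"
      unfolding eq by (intro power_mono norm2_triangle) simp
    moreover have "(norm2 (incr M R r) + norm2 (incr B R r))\<^sup>2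
        \<le> 2 * (norm2 (incr M R r))\<^sup>2 + 2 * (norm2 (incr B R r))\<^sup>2"
      using sum_squares_bound[of "norm2 (incr M R r)" "norm2 (incr B R r)"] by (simp add: power2_sum)
    ultimately show ?thesis by linarith
  qed
  then have "(\<Sum>r\<in>R. (norm2 (incr X R r))\<^sup>2)
      \<le> (\<Sum>r\<in>R. 2 * (norm2 (incr M R r))\<^sup>2 + 2 * (K * norm (incr B R r)))" by (rule sum_mono)
  also have "\<dots> = 2 * (norm2 (M t - M 0))\<^sup>2 + 2 * (K * (\<Sum>r\<in>R. norm (incr B R r)))"
    by (simp add: sum.distrib sum_norm2_martingale_incr[OF N M R t] flip: sum_distrib_left)
  also have "K * (\<Sum>r\<in>R. norm (incr B R r)) \<le> K\<^sup>2"
  proof -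
    have "0 \<le> K" using K sum_nonneg[of R "\<lambda>s. norm (incr B R s)"] by simp
    then show ?thesis unfolding power2_eq_square using K by (rule mult_left_mono[rotated])
  qed
  finally show ?thesis by simp
qed

locale three_states = C: tracial_state EC + A: two_states EA EC + B: two_states EB EC
  for EA :: "'a::cstar_algebra \<Rightarrow> complex" and EB :: "'b::cstar_algebra \<Rightarrow> complex"
    and EC :: "'c::cstar_algebra \<Rightarrow> complex"
begin

text \<open>The first coordinate is moved after the second one, so that the second-order expansion in the
  second coordinate starts from the given point.\<close>

lemma taylor_increment:
  assumes V: "V = UNIV \<or> V = selfadjoint" and W: "W = UNIV \<or> W = selfadjoint"
    and UVW: "U \<subseteq> V \<times> W"
    and F: "adapted_Ckl_derivs EA NA EB NB EC NC V W U 1 2 F D1 D2"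
    and K: "compact K" "K \<subseteq> U" and e: "0 < e"
  obtains d where "d > 0" "\<And>a x a' x'. (a, x) \<in> K \<Longrightarrow> a' \<in> V \<Longrightarrow> x' \<in> W \<Longrightarrow>
    norm (a' - a) < d \<Longrightarrow> norm (x' - x) < d \<Longrightarrow>
    C.norm1 (F (a', x') - F (a, x) - D1 1 (a, x) [a' - a] - D2 1 (a, x) [x' - x]
        - (1/2) *\<^sub>R D2 2 (a, x) [x' - x, x' - x])
      \<le> e * norm (a' - a) + e * (B.B.norm2 (x' - x))\<^sup>2"
proof -
  have Ckl: "Ckl_derivs V W U 1 2 F D1 D2"
    and D1: "\<And>u. u \<in> U \<Longrightarrow> D1 1 u \<in> BB EA EC 1" "cont_wrt (trinorm EA EC 1) U (D1 1)"
    and D2: "\<And>u. u \<in> U \<Longrightarrow> D2 2 u \<in> BB EB EC 2" "cont_wrt (trinorm EB EC 2) U (D2 2)"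
    using F unfolding adapted_Ckl_derivs_def by auto
  obtain d0 where d0: "d0 > 0" and box: "\<And>a x. (a, x) \<in> K \<Longrightarrow>
    \<exists>v w r. ball a d0 \<subseteq> ball v r \<and> ball x d0 \<subseteq> ball w r \<and>
    Ckl_box V W U 1 2 F D1 D2 v w r"
    using Ckl_derivs_uniform_box[OF Ckl K] by blast
  obtain d1 where d1: "d1 > 0" "\<And>p v h. p \<in> K \<Longrightarrow> v \<in> U \<Longrightarrow> dist v p < d1 \<Longrightarrow>
    norm (D1 1 v [h] - D1 1 p [h]) \<le> e * norm h"
    using A.uniformly_close_linear[OF D1(2,1) K e] by metis
  obtain d2 where d2: "d2 > 0" "\<And>p v h. p \<in> K \<Longrightarrow> v \<in> U \<Longrightarrow> dist v p < d2 \<Longrightarrow>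
    C.norm1 (D2 2 v [h, h] - D2 2 p [h, h]) \<le> e * (B.B.norm2 h)\<^sup>2"
    using B.uniformly_close_quadratic[OF D2(2,1) K e] by metis
  define d where "d = min d0 (min (d1/2) d2)"
  have d: "d > 0" "d \<le> d0" "d + d \<le> d1" "d \<le> d2" using d0 d1 d2 by (auto simp: d_def)
  show ?thesis
  proof (rule that[OF d(1)])
    fix a x a' x'
    assume ax: "(a, x) \<in> K" and a': "a' \<in> V" and x': "x' \<in> W"
      and na: "norm (a' - a) < d" and nx: "norm (x' - x) < d"
    define h k where "h = a' - a" and "k = x' - x"
    have aV: "a \<in> V" and xW: "x \<in> W" using ax K(2) UVW by auto
    have sV: "subspace V" and sW: "subspace W"
      using V W by (auto intro: subspace_UNIV_or_selfadjoint)
    have hV: "h \<in> V" and kW: "k \<in> W"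
      using sV sW aV xW a' x' by (auto simp: h_def k_def subspace_diff)
    obtain v w r where r: "ball a d0 \<subseteq> ball v r" "ball x d0 \<subseteq> ball w r"
      "(V \<inter> ball v r) \<times> (W \<inter> ball w r) \<subseteq> U"
      "\<forall>x' \<in> V \<inter> ball v r. \<forall>y \<in> W \<inter> ball w r.
        Ck_derivs W (W \<inter> ball w r) 2 (\<lambda>y'. F (x', y')) (\<lambda>j y'. D2 j (x', y')) \<and>
        Ck_derivs V (V \<inter> ball v r) 1 (\<lambda>x'. F (x', y)) (\<lambda>i x'. D1 i (x', y))"
      using box[OF ax] unfolding Ckl_box_def by blast
    have small: "norm (\<theta> *\<^sub>R y) \<le> norm y" if "\<theta> \<in> {0..1}" for \<theta> and y :: "'z::real_normed_vector"
      using that mult_right_mono[of \<theta> 1 "norm y"] by simp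
    have near: "y + \<theta> *\<^sub>R z \<in> ball y d0" if "\<theta> \<in> {0..1}" "norm z < d"
      for \<theta> and y z :: "'z::real_normed_vector"
      using small[OF that(1), of z] that(2) d(2) by (simp add: dist_norm)
    have pa: "a + \<theta> *\<^sub>R h \<in> V \<inter> ball v r" if "\<theta> \<in> {0..1}" for \<theta>
      using sV aV hV subsetD[OF r(1) near[OF that na]] by (simp add: h_def subspace_add subspace_scale)
    have px: "x + \<theta> *\<^sub>R k \<in> W \<inter> ball w r" if "\<theta> \<in> {0..1}" for \<theta>
      using sW xW kW subsetD[OF r(2) near[OF that nx]] by (simp add: k_def subspace_add subspace_scale)
    have x1: "x' \<in> W \<inter> ball w r" using px[of 1] by (simp add: k_def)
    have a0: "a \<in> V \<inter> ball v r" using pa[of 0] by simp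
    have C1: "Ck_derivs V (V \<inter> ball v r) 1 (\<lambda>a. F (a, x')) (\<lambda>i a. D1 i (a, x'))"
      and C2: "Ck_derivs W (W \<inter> ball w r) 2 (\<lambda>y. F (a, y)) (\<lambda>j y. D2 j (a, y))"
      using r(4) x1 a0 by blast+
    have "C.norm1 (F (a + 1 *\<^sub>R h, x') - F (a + 0 *\<^sub>R h, x') - D1 1 (a, x) [h]) \<le> e * norm h"
    proof (rule C.norm1_first_order)
      fix \<theta> :: real assume \<theta>: "\<theta> \<in> {0..1}"
      show "((\<lambda>\<theta>. F (a + \<theta> *\<^sub>R h, x')) has_vector_derivative D1 1 (a + \<theta> *\<^sub>R h, x') [h])
          (at \<theta> within {0..1})"
        by (rule Ck_derivs_segment_0[OF C1 _ pa \<theta>]) simp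
      have inU: "(a + \<theta> *\<^sub>R h, x') \<in> U" using r(3) pa[OF \<theta>] x1 by blast
      have "dist (a + \<theta> *\<^sub>R h, x') (a, x) \<le> norm (\<theta> *\<^sub>R h) + norm k"
        using sqrt_sum_squares_le_sum[of "norm (\<theta> *\<^sub>R h)" "norm k"]
        unfolding dist_Pair_Pair by (simp add: dist_norm k_def)
      also have "\<dots> < d1" using small[OF \<theta>, of h] na nx d(3) by (simp add: h_def k_def)
      finally have "norm (D1 1 (a + \<theta> *\<^sub>R h, x') [h] - D1 1 (a, x) [h]) \<le> e * norm h"
        by (rule d1(2)[OF ax inU])
      then show "C.norm1 (D1 1 (a + \<theta> *\<^sub>R h, x') [h] - D1 1 (a, x) [h]) \<le> e * norm h"
        using C.norm1_le_norm order_trans by blast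
    qed
    then have 1: "C.norm1 (F (a', x') - F (a, x') - D1 1 (a, x) [h]) \<le> e * norm h"
      by (simp add: h_def)
    have "C.norm1 (F (a, x + 1 *\<^sub>R k) - F (a, x + 0 *\<^sub>R k) - D2 1 (a, x + 0 *\<^sub>R k) [k]
        - (1/2) *\<^sub>R D2 2 (a, x + 0 *\<^sub>R k) [k, k]) \<le> e * (B.B.norm2 k)\<^sup>2"
    proof (rule C.norm1_second_order)
      fix \<theta> :: real assume \<theta>: "\<theta> \<in> {0..1}"
      show "((\<lambda>\<theta>. F (a, x + \<theta> *\<^sub>R k)) has_vector_derivative D2 1 (a, x + \<theta> *\<^sub>R k) [k])
          (at \<theta> within {0..1})"
        by (rule Ck_derivs_segment_0[OF C2 _ px \<theta>]) simp
      show "((\<lambda>\<theta>. D2 1 (a, x + \<theta> *\<^sub>R k) [k]) has_vector_derivative D2 2 (a, x + \<theta> *\<^sub>R k) [k, k])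
          (at \<theta> within {0..1})"
        by (rule Ck_derivs_segment_1[OF C2 _ sW kW px \<theta>]) simp
      have inU: "(a, x + \<theta> *\<^sub>R k) \<in> U" using r(3) px[OF \<theta>] a0 by blast
      have "dist (a, x + \<theta> *\<^sub>R k) (a, x) < d2"
        using small[OF \<theta>, of k] nx d(4) by (simp add: dist_Pair_Pair dist_norm k_def)
      from d2(2)[OF ax inU this]
      show "C.norm1 (D2 2 (a, x + \<theta> *\<^sub>R k) [k, k] - D2 2 (a, x + 0 *\<^sub>R k) [k, k])
          \<le> e * (B.B.norm2 k)\<^sup>2" by simp
    qed
    then have 2: "C.norm1 (F (a, x') - F (a, x) - D2 1 (a, x) [k] - (1/2) *\<^sub>R D2 2 (a, x) [k, k])
        \<le> e * (B.B.norm2 k)\<^sup>2" by (simp add: k_def)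
    have "F (a', x') - F (a, x) - D1 1 (a, x) [h] - D2 1 (a, x) [k] - (1/2) *\<^sub>R D2 2 (a, x) [k, k]
        = (F (a', x') - F (a, x') - D1 1 (a, x) [h])
          + (F (a, x') - F (a, x) - D2 1 (a, x) [k] - (1/2) *\<^sub>R D2 2 (a, x) [k, k])" by simp
    then show "C.norm1 (F (a', x') - F (a, x) - D1 1 (a, x) [a' - a] - D2 1 (a, x) [x' - x]
        - (1/2) *\<^sub>R D2 2 (a, x) [x' - x, x' - x]) \<le> e * norm (a' - a) + e * (B.B.norm2 (x' - x))\<^sup>2"
      using 1 2 C.norm1_triangle unfolding h_def[symmetric] k_def[symmetric] by (smt (verit))
  qed
qed

end

theorem theorem6p10:
  fixes EA :: "'a::cstar_algebra \<Rightarrow> complex" and NA :: "real \<Rightarrow> 'a set"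
    and EB :: "'b::cstar_algebra \<Rightarrow> complex" and NB :: "real \<Rightarrow> 'b set"
    and EC :: "'c::cstar_algebra \<Rightarrow> complex" and NC :: "real \<Rightarrow> 'c set"
    and V :: "'a set" and W :: "'b set" and U :: "('a \<times> 'b) set"
    and A :: "real \<Rightarrow> 'a" and X :: "real \<Rightarrow> 'b"
    and F :: "'a \<times> 'b \<Rightarrow> 'c"
    and D1 :: "nat \<Rightarrow> 'a \<times> 'b \<Rightarrow> 'a list \<Rightarrow> 'c"
    and D2 :: "nat \<Rightarrow> 'a \<times> 'b \<Rightarrow> 'b list \<Rightarrow> 'c"
    and t :: real
  assumes "faithful_tracial_state EA" and "filtration NA"
    and "faithful_tracial_state EB" and "filtration NB"
    and "faithful_tracial_state EC" and "filtration NC"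
    and "V = UNIV \<or> V = selfadjoint"
    and "W = UNIV \<or> W = selfadjoint"
    and "openin (top_of_set (V \<times> W)) U"
    and "continuous_on {0..} A" and "FV_process NA A"
    and "decomposable EB NB X"
    and "\<And>s. s \<ge> 0 \<Longrightarrow> (A s, X s) \<in> U"
    and "adapted_Ckl_derivs EA NA EB NB EC NC V W U 1 2 F D1 D2"
    and "t \<ge> 0"
  shows "\<exists>Ia Ix Ixx.
      has_RS_integral (\<lambda>s. D1 1 (A s, X s)) A t Ia \<and>
      has_L2_integral EC (\<lambda>s. D2 1 (A s, X s)) X t Ix \<and>
      has_L1_quadratic_integral EC (\<lambda>s. D2 2 (A s, X s)) X t Ixx \<and>
      Lp_of EC 1 (F (A t, X t)) =
        Lp_add EC 1 (Lp_add EC 1 (Lp_add EC 1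
          (Lp_of EC 1 (F (A 0, X 0))) (Lp_of EC 1 Ia)) (to_L1 EC Ix)) (Lp_scaleR EC 1 (1/2) Ixx)"
proof -
  note NB = assms(4) and NC = assms(6) and V = assms(7) and W = assms(8) and F = assms(14) and t = assms(15)
  interpret three_states EA EB EC
    by unfold_locales (rule assms)+
  have UVW: "U \<subseteq> V \<times> W" using assms(9) openin_imp_subset by blast
  define u where "u s = (A s, X s)" for s
  have u: "u s \<in> U" "A s \<in> V" "X s \<in> W" if "0 \<le> s" for s
    using assms(13)[OF that] UVW by (auto simp: u_def)
  obtain M B where MB: "martingale EB NB M" "continuous_on {0..} M" "FV_process NB B"
    "continuous_on {0..} B" and XMB: "\<And>s. 0 \<le> s \<Longrightarrow> X s = X 0 + M s + B s"
    using assms(12) unfolding decomposable_def by blast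
  have contX: "continuous_on {0..t} X"
  proof -
    have "continuous_on {0..t} (\<lambda>s. X 0 + M s + B s)"
      by (intro continuous_intros continuous_on_subset[OF MB(2)] continuous_on_subset[OF MB(4)]) auto
    then show ?thesis
      by (rule continuous_on_eq) (simp add: XMB[symmetric])
  qed
  have contA: "continuous_on {0..t} A" by (rule continuous_on_subset[OF assms(10)]) auto
  have contu: "continuous_on {0..t} u" unfolding u_def by (intro continuous_intros contA contX)
  define K where "K = u ` {0..t}"
  have K: "compact K" "K \<subseteq> U"
    unfolding K_def using compact_continuous_image[OF contu] u by auto
  obtain KA where KA: "\<And>P. is_partition t P \<Longrightarrow> (\<Sum>s\<in>P. norm (incr A P s)) \<le> KA"
    using assms(11) t unfolding FV_process_def by blast
  obtain KB where KB: "\<And>P. is_partition t P \<Longrightarrow> (\<Sum>s\<in>P. norm (incr B P s)) \<le> KB"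
    using MB(3) t unfolding FV_process_def by blast
  have along_path: "\<exists>d>0. \<forall>s s'. 0 \<le> s \<longrightarrow> s \<le> t \<longrightarrow> 0 \<le> s' \<longrightarrow> s' \<le> t \<longrightarrow> \<bar>s - s'\<bar> < d \<longrightarrow>
      R (u s) (u s')" if r: "r > 0" "\<And>p v. p \<in> K \<Longrightarrow> v \<in> U \<Longrightarrow> dist v p < r \<Longrightarrow> R v p" for r R
  proof -
    have "uniformly_continuous_on {0..t} u"
      by (rule compact_uniformly_continuous[OF contu compact_Icc])
    then obtain d where d: "d > 0" "\<And>s s'. s \<in> {0..t} \<Longrightarrow> s' \<in> {0..t} \<Longrightarrow> \<bar>s - s'\<bar> < d \<Longrightarrow>
        dist (u s) (u s') < r"
      using r(1) unfolding uniformly_continuous_on_def dist_real_def by metis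
    have "R (u s) (u s')" if "0 \<le> s" "s \<le> t" "0 \<le> s'" "s' \<le> t" "\<bar>s - s'\<bar> < d" for s s'
      using that by (intro r(2) d(2) u(1)) (auto simp: K_def)
    then show ?thesis using d(1) by blast
  qed
  have D1: "\<And>v. v \<in> U \<Longrightarrow> D1 1 v \<in> BB EA EC 1" "cont_wrt (trinorm EA EC 1) U (D1 1)"
    and D2: "\<And>v. v \<in> U \<Longrightarrow> D2 1 v \<in> BB EB EC 1" "cont_wrt (trinorm EB EC 1) U (D2 1)"
    using F unfolding adapted_Ckl_derivs_def by auto
  have FF2: "D2 1 (u s) \<in> FF EB NB EC NC 1 s" if s: "0 \<le> s" "s \<le> t" for s
  proof -
    have "u s \<in> (NA s \<times> NB s) \<inter> U"
      using u(1)[OF s(1)] assms(11,12) s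
      by (auto simp: u_def FV_process_def decomposable_def adapted_def)
    then show ?thesis using F s unfolding adapted_Ckl_derivs_def by auto
  qed
  have lin1: "D1 1 (u s) [x + y] = D1 1 (u s) [x] + D1 1 (u s) [y]" if "0 \<le> s" for s x y
    using A.multilinear_1[of "D1 1 (u s)"] D1(1)[OF u(1)[OF that]] linear_add
    by (fastforce simp: BB_def)
  have close1: "\<exists>d>0. \<forall>s s' h. 0 \<le> s \<longrightarrow> s \<le> t \<longrightarrow> 0 \<le> s' \<longrightarrow> s' \<le> t \<longrightarrow>
        \<bar>s - s'\<bar> < d \<longrightarrow> norm (D1 1 (u s) [h] - D1 1 (u s') [h]) \<le> e * norm h" if e: "e > 0" for e
  proof -
    obtain r where r: "r > 0" "\<And>p v. p \<in> K \<Longrightarrow> v \<in> U \<Longrightarrow> dist v p < r \<Longrightarrow>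
        \<forall>h. norm (D1 1 v [h] - D1 1 p [h]) \<le> e * norm h"
      using A.uniformly_close_linear[OF D1(2,1) K e] by metis
    from along_path[OF r(1), of "\<lambda>v p. \<forall>h. norm (D1 1 v [h] - D1 1 p [h]) \<le> e * norm h", OF r(2)]
    show ?thesis by blast
  qed
  have close2: "\<exists>d>0. \<forall>s s' h. 0 \<le> s \<longrightarrow> s \<le> t \<longrightarrow> 0 \<le> s' \<longrightarrow> s' \<le> t \<longrightarrow>
        \<bar>s - s'\<bar> < d \<longrightarrow> C.norm2 (D2 1 (u s) [h] - D2 1 (u s') [h]) \<le> e * B.B.norm2 h"
    if e: "e > 0" for e
  proof -
    obtain r where r: "r > 0" "\<And>p v. p \<in> K \<Longrightarrow> v \<in> U \<Longrightarrow> dist v p < r \<Longrightarrow>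
        \<forall>h. C.norm2 (D2 1 v [h] - D2 1 p [h]) \<le> e * B.B.norm2 h"
      using B.uniformly_close_linear[OF D2(2,1) K e] by metis
    from along_path[OF r(1), of "\<lambda>v p. \<forall>h. C.norm2 (D2 1 v [h] - D2 1 p [h]) \<le> e * B.B.norm2 h", OF r(2)]
    show ?thesis by blast
  qed
  define RS where "RS P = (\<Sum>s\<in>P. D1 1 (u (left_nb P s)) [incr A P s])" for P
  define S where "S P = (\<Sum>s\<in>P. D2 1 (u (left_nb P s)) [incr X P s])" for P
  define Q where "Q P = (\<Sum>s\<in>P. D2 2 (u (left_nb P s)) [incr X P s, incr X P s])" for P
  obtain Ia where Ia: "has_RS_integral (\<lambda>s. D1 1 (u s)) A t Ia"
    and RS_lim: "\<And>e. e > 0 \<Longrightarrow> \<exists>d>0. \<forall>P. is_partition t P \<longrightarrow> mesh P < d \<longrightarrow> norm (RS P - Ia) \<le> e"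
    unfolding RS_def using has_RS_integral_exists[OF t lin1 KA close1] by blast
  obtain \<sigma> where \<sigma>: "pCauchy EC 2 \<sigma>" "has_L2_integral EC (\<lambda>s. D2 1 (u s)) X t (pclass EC 2 \<sigma>)"
    and S_lim: "\<forall>e>0. \<exists>d>0. \<forall>P. is_partition t P \<longrightarrow> mesh P < d \<longrightarrow>
        (\<forall>\<^sub>F n in sequentially. C.norm2 (S P - \<sigma> n) \<le> e)"
    unfolding S_def
    by (rule B.has_L2_integral_exists[OF NB NC t MB(1) XMB KB FF2 close2])

  define err where "err P = F (u t) - F (u 0) - RS P - S P - (1/2) *\<^sub>R Q P" for P
  define c where "c = KA + (2 * (B.B.norm2 (M t - M 0))\<^sup>2 + 2 * KB\<^sup>2) + 1"
  have "0 \<le> KA" by (rule variation_bound_nonneg[OF KA t])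
  then have c: "c > 0" unfolding c_def by (intro add_nonneg_pos add_nonneg_nonneg) auto
  have err_lim: "\<exists>d>0. \<forall>P. is_partition t P \<longrightarrow> mesh P < d \<longrightarrow> C.norm1 (err P) \<le> e" if e: "e > 0" for e
  proof -
    have ec: "e / c > 0" using e c by simp
    obtain r where r: "r > 0" "\<And>a x a' x'. (a, x) \<in> K \<Longrightarrow> a' \<in> V \<Longrightarrow> x' \<in> W \<Longrightarrow>
      norm (a' - a) < r \<Longrightarrow> norm (x' - x) < r \<Longrightarrow>
      C.norm1 (F (a', x') - F (a, x) - D1 1 (a, x) [a' - a] - D2 1 (a, x) [x' - x]
          - (1/2) *\<^sub>R D2 2 (a, x) [x' - x, x' - x])
        \<le> e / c * norm (a' - a) + e / c * (B.B.norm2 (x' - x))\<^sup>2"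
      using taylor_increment[OF V W UVW F K ec] by metis
    obtain d where d: "d > 0" "\<And>s s'. 0 \<le> s \<Longrightarrow> s \<le> t \<Longrightarrow> 0 \<le> s' \<Longrightarrow> s' \<le> t \<Longrightarrow> \<bar>s - s'\<bar> < d \<Longrightarrow>
        dist (u s) (u s') < r" using along_path[OF r(1), of "\<lambda>v p. dist v p < r"] by blast
    have "C.norm1 (err P) \<le> e" if P: "is_partition t P" "mesh P < d" for P
    proof -
      define T where "T s = F (u s) - F (u (left_nb P s)) - D1 1 (u (left_nb P s)) [incr A P s]
        - D2 1 (u (left_nb P s)) [incr X P s]
        - (1/2) *\<^sub>R D2 2 (u (left_nb P s)) [incr X P s, incr X P s]" for s
      have "(\<Sum>s\<in>P. F (u s) - F (u (left_nb P s))) = F (u t) - F (u 0)"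
        using sum_incr[OF P(1) t, of "\<lambda>s. F (u s)"] by (simp add: incr_def)
      then have "err P = (\<Sum>s\<in>P. T s)"
        unfolding err_def T_def RS_def S_def Q_def
        by (simp add: sum_subtractf scaleR_sum_right)
      also have "C.norm1 \<dots> \<le> (\<Sum>s\<in>P. C.norm1 (T s))" by (rule C.norm1_sum_le)
      also have "\<dots> \<le> (\<Sum>s\<in>P. e / c * norm (incr A P s) + e / c * (B.B.norm2 (incr X P s))\<^sup>2)"
      proof (rule sum_mono)
        fix s assume s: "s \<in> P"
        note l = left_nb_bounds[OF P(1) s]
        have st: "0 \<le> s" "s \<le> t" using partition_nonneg[OF P(1) s] partition_le[OF P(1) s] by auto
        have "dist (u s) (u (left_nb P s)) < r"
          using mesh_less[OF P s] l st by (intro d(2)) auto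
        then have n: "norm (A s - A (left_nb P s)) < r" "norm (X s - X (left_nb P s)) < r"
          using dist_fst_le[of "u s" "u (left_nb P s)"] dist_snd_le[of "u s" "u (left_nb P s)"]
          by (auto simp: u_def dist_norm)
        have "(A (left_nb P s), X (left_nb P s)) \<in> K" using l st by (auto simp: K_def u_def)
        from r(2)[OF this u(2,3)[OF st(1)] n]
        show "C.norm1 (T s) \<le> e / c * norm (incr A P s) + e / c * (B.B.norm2 (incr X P s))\<^sup>2"
          by (simp add: T_def u_def incr_def)
      qed
      also have "\<dots> = e / c * ((\<Sum>s\<in>P. norm (incr A P s)) + (\<Sum>s\<in>P. (B.B.norm2 (incr X P s))\<^sup>2))"
        by (simp only: sum.distrib distrib_left sum_distrib_left)
      also have "\<dots> \<le> e / c * c"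
        using KA[OF P(1)] B.B.sum_norm2_incr_bounded[OF NB MB(1) P(1) t XMB KB[OF P(1)]] ec
        by (intro mult_left_mono) (auto simp: c_def)
      also have "\<dots> = e" using c by simp
      finally show ?thesis .
    qed
    then show ?thesis using d(1) by blast
  qed

  \<comment> \<open>The quadratic sums converge because all the other terms of the expansion do.\<close>
  define q where "q n = 2 *\<^sub>R (F (u t) - F (u 0) - Ia - \<sigma> n)" for n
  have pCq: "pCauchy EC 1 q"
    unfolding pCauchy_def C.pnorm_1
  proof (intro allI impI)
    fix e :: real assume "e > 0"
    then obtain N where N: "\<And>m n. m \<ge> N \<Longrightarrow> n \<ge> N \<Longrightarrow> C.norm2 (\<sigma> m - \<sigma> n) < e/2"
      using \<sigma>(1) unfolding pCauchy_def C.pnorm_2 by (meson half_gt_zero)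
    have "C.norm1 (q m - q n) < e" if "m \<ge> N" "n \<ge> N" for m n
    proof -
      have "q m - q n = 2 *\<^sub>R (\<sigma> n - \<sigma> m)" by (simp add: q_def algebra_simps)
      then have "C.norm1 (q m - q n) \<le> 2 * C.norm1 (\<sigma> n - \<sigma> m)"
        using C.norm1_scaleR_le[of 2] by simp
      also have "\<dots> \<le> 2 * C.norm2 (\<sigma> n - \<sigma> m)" using C.norm1_le_norm2 by simp
      also have "\<dots> < e" using N[OF that(2,1)] by simp
      finally show ?thesis .
    qed
    then show "\<exists>N. \<forall>m\<ge>N. \<forall>n\<ge>N. C.norm1 (q m - q n) < e" by blast
  qed
  have "Lp_tendsto EC 1 Q (pclass EC 1 q) (mesh_to_0 t)"
  proof (rule C.L1.Lp_tendstoI[OF pCq])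
    fix e :: real assume "e > 0"
    then have e6: "e / 6 > 0" by simp
    obtain d1 where d1: "d1 > 0" "\<And>P. is_partition t P \<Longrightarrow> mesh P < d1 \<Longrightarrow> C.norm1 (err P) \<le> e / 6"
      using err_lim[OF e6] by blast
    obtain d2 where d2: "d2 > 0" "\<And>P. is_partition t P \<Longrightarrow> mesh P < d2 \<Longrightarrow> norm (RS P - Ia) \<le> e / 6"
      using RS_lim[OF e6] by blast
    obtain d3 where d3: "d3 > 0" "\<And>P. is_partition t P \<Longrightarrow> mesh P < d3 \<Longrightarrow>
        \<forall>\<^sub>F n in sequentially. C.norm2 (S P - \<sigma> n) \<le> e / 6"
      using S_lim[rule_format, OF e6] by blast
    show "\<forall>\<^sub>F P in mesh_to_0 t. \<forall>\<^sub>F n in sequentially. C.norm1 (Q P - q n) \<le> e"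
    proof (rule eventually_mesh_to_0)
      show "min d1 (min d2 d3) > 0" using d1 d2 d3 by simp
      fix P assume P: "is_partition t P" "mesh P < min d1 (min d2 d3)"
      then have 1: "C.norm1 (err P) \<le> e / 6" and 2: "norm (RS P - Ia) \<le> e / 6"
        and 3: "\<forall>\<^sub>F n in sequentially. C.norm2 (S P - \<sigma> n) \<le> e / 6"
        using d1(2) d2(2) d3(2) by auto
      from 3 show "\<forall>\<^sub>F n in sequentially. C.norm1 (Q P - q n) \<le> e"
      proof eventually_elim
        case (elim n)
        have "Q P - q n = (- 2) *\<^sub>R (err P + (RS P - Ia) + (S P - \<sigma> n))"
          by (simp add: err_def q_def algebra_simps)
        then have "C.norm1 (Q P - q n) \<le> 2 * C.norm1 (err P + (RS P - Ia) + (S P - \<sigma> n))"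
          using C.norm1_scaleR_le[of "- 2"] by simp
        also have "C.norm1 (err P + (RS P - Ia) + (S P - \<sigma> n))
            \<le> C.norm1 (err P) + C.norm1 (RS P - Ia) + C.norm1 (S P - \<sigma> n)"
          using C.norm1_triangle[of "err P + (RS P - Ia)" "S P - \<sigma> n"]
            C.norm1_triangle[of "err P" "RS P - Ia"] by simp
        also have "\<dots> \<le> e / 6 + e / 6 + e / 6"
          using 1 2 elim C.norm1_le_norm[of "RS P - Ia"] C.norm1_le_norm2[of "S P - \<sigma> n"] by simp
        finally show ?case by simp
      qed
    qed
  qed
  then have Ixx: "has_L1_quadratic_integral EC (\<lambda>s. D2 2 (u s)) X t (pclass EC 1 q)"
    unfolding has_L1_quadratic_integral_def Q_def .
  have two: "1 \<le> (2::ennreal)" "(2::ennreal) < top" by simp_all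
  have "F (u 0) + Ia + \<sigma> n + (1/2) *\<^sub>R q n = F (u t)" for n by (simp add: q_def)
  then have "Lp_of EC 1 (F (u t)) = Lp_add EC 1 (Lp_add EC 1 (Lp_add EC 1
      (Lp_of EC 1 (F (u 0))) (Lp_of EC 1 Ia)) (to_L1 EC (pclass EC 2 \<sigma>)))
      (Lp_scaleR EC 1 (1/2) (pclass EC 1 q))"
    unfolding Lp_of_def C.to_L1_pclass[OF two] C.Lp_add_pclass C.Lp_scaleR_pclass by simp
  then show ?thesis using Ia \<sigma>(2) Ixx unfolding u_def by blast
qed

end
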